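(* Let $X$ be an algebraic variety over a field $k$, let $E$ be a globally generated vector bundle (locally free sheaf of finite rank) on $X$, and let $l \le \operatorname{rk} E$ be a non-negative integer. Then for a generic vector subspace $V \in Gr(l, H^0(X,E))$ the evaluation map $V \otimes_k \mathcal{O}_X \to E$ is a monomorphism of sheaves.
   Context: An algebraic variety is a reduced and irreducible scheme of finite type over $k$. $Gr(l,H)$ denotes the Grassmannian variety of $l$-dimensional $k$-subspaces of a finite-dimensional vector space $H$; here $H^0(X,E)$ is taken to be finite-dimensional so that this makes sense. "For a generic $V$" means: there is a nonempty Zariski-open subset of $Gr(l,H^0(X,E))$ such that the conclusion holds for all $V$ in this subset. The evaluation map sends $v \otimes f$ to $f\cdot v$. *)

theory Defs
  imports
    "HOL-Analysis.Abstract_Topology"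
    "HOL-Combinatorics.Permutations"
    "HOL-Algebra.Generated_Rings"
    "HOL-Algebra.RingHom"
    "HOL-Algebra.Free_Abelian_Groups"
    "Jordan_Normal_Form.Missing_VectorSpace"
begin

section \<open>Sheaves and locally ringed spaces\<close>

text \<open>
  A presheaf is given by its sections over each open set (its values on sets that are not open
  are irrelevant) and by restriction maps; \<open>res X U V\<close> restricts from \<open>U\<close> to \<open>V \<subseteq> U\<close>.
  In the fourth clause of \<open>sheaf_on\<close> existence and uniqueness of the glued section are one
  statement; the empty cover forces exactly one section over the empty set.
\<close>

definition sheaf_on ::
    "'p topology \<Rightarrow> ('p set \<Rightarrow> 's set) \<Rightarrow> ('p set \<Rightarrow> 'p set \<Rightarrow> 's \<Rightarrow> 's) \<Rightarrow> bool" where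
  "sheaf_on T C \<rho> \<longleftrightarrow>
     (\<forall>U V s. openin T U \<and> openin T V \<and> V \<subseteq> U \<and> s \<in> C U \<longrightarrow> \<rho> U V s \<in> C V) \<and>
     (\<forall>U s. openin T U \<and> s \<in> C U \<longrightarrow> \<rho> U U s = s) \<and>
     (\<forall>U V W s. openin T U \<and> openin T V \<and> openin T W \<and> W \<subseteq> V \<and> V \<subseteq> U \<and> s \<in> C U
        \<longrightarrow> \<rho> V W (\<rho> U V s) = \<rho> U W s) \<and>
     (\<forall>\<C> s. (\<forall>U\<in>\<C>. openin T U \<and> s U \<in> C U) \<and>
             (\<forall>U\<in>\<C>. \<forall>V\<in>\<C>. \<rho> U (U \<inter> V) (s U) = \<rho> V (U \<inter> V) (s V))
        \<longrightarrow> (\<exists>!t. t \<in> C (\<Union>\<C>) \<and> (\<forall>U\<in>\<C>. \<rho> (\<Union>\<C>) U t = s U)))"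

record ('p, 'r) ringed_space =
  base :: "'p topology"
  str :: "'p set \<Rightarrow> 'r ring"
  res :: "'p set \<Rightarrow> 'p set \<Rightarrow> 'r \<Rightarrow> 'r"

abbreviation points :: "('p, 'r) ringed_space \<Rightarrow> 'p set" where
  "points X \<equiv> topspace (base X)"

definition is_ringed_space :: "('p, 'r) ringed_space \<Rightarrow> bool" where
  "is_ringed_space X \<longleftrightarrow>
     sheaf_on (base X) (\<lambda>U. carrier (str X U)) (res X) \<and>
     (\<forall>U. openin (base X) U \<longrightarrow> cring (str X U)) \<and>
     (\<forall>U V. openin (base X) U \<and> openin (base X) V \<and> V \<subseteq> U
        \<longrightarrow> res X U V \<in> ring_hom (str X U) (str X V))"

text \<open>The germ at \<open>x\<close> of a section \<open>s\<close> over \<open>U\<close> is a unit of the stalk: an inverse germ lives,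
  and is inverse, over some smaller neighbourhood.\<close>

definition germ_unit :: "('p, 'r) ringed_space \<Rightarrow> 'p \<Rightarrow> 'p set \<Rightarrow> 'r \<Rightarrow> bool" where
  "germ_unit X x U s \<longleftrightarrow>
     (\<exists>W. openin (base X) W \<and> x \<in> W \<and> W \<subseteq> U \<and> res X U W s \<in> Units (str X W))"

text \<open>A stalk is a local ring iff it is nonzero (no neighbourhood has \<open>1 = 0\<close>) and its non-units
  are closed under addition; finitely many germs have representatives on a common neighbourhood.\<close>

definition locally_ringed_space :: "('p, 'r) ringed_space \<Rightarrow> bool" where
  "locally_ringed_space X \<longleftrightarrow> is_ringed_space X \<and>
     (\<forall>x U. openin (base X) U \<and> x \<in> U \<longrightarrow> \<one>\<^bsub>str X U\<^esub> \<noteq> \<zero>\<^bsub>str X U\<^esub>) \<and>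
     (\<forall>x U s t. openin (base X) U \<and> x \<in> U \<and> s \<in> carrier (str X U) \<and> t \<in> carrier (str X U) \<and>
        germ_unit X x U (s \<oplus>\<^bsub>str X U\<^esub> t) \<longrightarrow> germ_unit X x U s \<or> germ_unit X x U t)"

definition preim :: "('p, 'r) ringed_space \<Rightarrow> ('p \<Rightarrow> 'q) \<Rightarrow> 'q set \<Rightarrow> 'p set" where
  "preim X f V = {x \<in> points X. f x \<in> V}"

text \<open>A morphism \<open>X \<rightarrow> Y\<close> is a continuous map \<open>f\<close> with ring maps
  \<open>fs V : O_Y(V) \<rightarrow> O_X(f^{-1}V)\<close>; the last clause says that the maps on stalks are local.\<close>

definition lrs_morphism ::
    "('p, 'r) ringed_space \<Rightarrow> ('q, 't) ringed_space \<Rightarrow> ('p \<Rightarrow> 'q) \<Rightarrow> ('q set \<Rightarrow> 't \<Rightarrow> 'r) \<Rightarrow> bool" where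
  "lrs_morphism X Y f fs \<longleftrightarrow>
     continuous_map (base X) (base Y) f \<and>
     (\<forall>V. openin (base Y) V \<longrightarrow> fs V \<in> ring_hom (str Y V) (str X (preim X f V))) \<and>
     (\<forall>V W s. openin (base Y) V \<and> openin (base Y) W \<and> W \<subseteq> V \<and> s \<in> carrier (str Y V)
        \<longrightarrow> res X (preim X f V) (preim X f W) (fs V s) = fs W (res Y V W s)) \<and>
     (\<forall>x V s. x \<in> points X \<and> openin (base Y) V \<and> f x \<in> V \<and> s \<in> carrier (str Y V) \<and>
        germ_unit X x (preim X f V) (fs V s) \<longrightarrow> germ_unit Y (f x) V s)"

definition lrs_iso ::
    "('p, 'r) ringed_space \<Rightarrow> ('q, 't) ringed_space \<Rightarrow> ('p \<Rightarrow> 'q) \<Rightarrow> ('q set \<Rightarrow> 't \<Rightarrow> 'r) \<Rightarrow> bool" where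
  "lrs_iso X Y f fs \<longleftrightarrow>
     lrs_morphism X Y f fs \<and> homeomorphic_map (base X) (base Y) f \<and>
     (\<forall>V. openin (base Y) V
        \<longrightarrow> bij_betw (fs V) (carrier (str Y V)) (carrier (str X (preim X f V))))"

definition open_sub :: "('p, 'r) ringed_space \<Rightarrow> 'p set \<Rightarrow> ('p, 'r) ringed_space" where
  "open_sub X U = X\<lparr>base := subtopology (base X) U\<rparr>"


section \<open>Affine schemes\<close>

definition prime_spectrum :: "'a ring \<Rightarrow> 'a set set" where
  "prime_spectrum A = {P. primeideal P A}"

definition spec_topology :: "'a ring \<Rightarrow> 'a set topology" where
  "spec_topology A =
     topology (\<lambda>U. \<exists>S \<subseteq> carrier A. U = {P \<in> prime_spectrum A. \<not> S \<subseteq> P})"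

lemma openin_spec_topology:
  "openin (spec_topology A) U \<longleftrightarrow> (\<exists>S \<subseteq> carrier A. U = {P \<in> prime_spectrum A. \<not> S \<subseteq> P})"
proof -
  let ?D = "\<lambda>S. {P \<in> prime_spectrum A. \<not> S \<subseteq> P}"
  have "istopology (\<lambda>U. \<exists>S \<subseteq> carrier A. U = ?D S)"
    unfolding istopology_def
  proof (intro conjI allI impI)
    fix U V
    assume "\<exists>S \<subseteq> carrier A. U = ?D S" and "\<exists>S \<subseteq> carrier A. V = ?D S"
    then obtain S T where S: "S \<subseteq> carrier A" "U = ?D S" and T: "T \<subseteq> carrier A" "V = ?D T"
      by blast
    let ?ST = "{s \<otimes>\<^bsub>A\<^esub> t | s t. s \<in> S \<and> t \<in> T}"
    have "?ST \<subseteq> P \<longleftrightarrow> S \<subseteq> P \<or> T \<subseteq> P" if "P \<in> prime_spectrum A" for P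
    proof -
      interpret primeideal P A using that by (simp add: prime_spectrum_def)
      show ?thesis
      proof
        assume "?ST \<subseteq> P"
        then show "S \<subseteq> P \<or> T \<subseteq> P"
          using I_prime S(1) T(1) by (smt (verit, best) mem_Collect_eq subset_iff)
      next
        assume "S \<subseteq> P \<or> T \<subseteq> P"
        then show "?ST \<subseteq> P"
          using I_l_closed I_r_closed S(1) T(1) by blast
      qed
    qed
    moreover have "?ST \<subseteq> carrier A" if "U \<inter> V \<noteq> {}"
    proof -
      from that obtain P where "primeideal P A"
        using S(2) by (auto simp: prime_spectrum_def)
      then interpret primeideal P A .
      show ?thesis using S(1) T(1) by auto
    qed
    moreover have "U \<inter> V = {P \<in> prime_spectrum A. \<not> (S \<subseteq> P \<or> T \<subseteq> P)}"
      using S(2) T(2) by blast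
    ultimately have "U \<inter> V = ?D ?ST" and "U \<inter> V \<noteq> {} \<Longrightarrow> ?ST \<subseteq> carrier A"
      by (simp_all cong: conj_cong)
    then show "\<exists>S \<subseteq> carrier A. U \<inter> V = ?D S"
      by (cases "U \<inter> V = {}") (auto intro: exI[of _ "{}"])
  next
    fix \<K>
    assume *: "\<forall>K\<in>\<K>. \<exists>S \<subseteq> carrier A. K = ?D S"
    then obtain S where "\<And>K. K \<in> \<K> \<Longrightarrow> S K \<subseteq> carrier A \<and> K = ?D (S K)"
      by metis
    then show "\<exists>S \<subseteq> carrier A. \<Union>\<K> = ?D S"
      by (intro exI[of _ "\<Union>K\<in>\<K>. S K"]) blast
  qed
  then show ?thesis by (simp add: spec_topology_def)
qed

text \<open>The localization of \<open>A\<close> at a prime \<open>P\<close>; \<open>fraction A P a s\<close> is the fraction \<open>a/s\<close>.\<close>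

definition frac_rel :: "'a ring \<Rightarrow> 'a set \<Rightarrow> (('a \<times> 'a) \<times> ('a \<times> 'a)) set" where
  "frac_rel A P = {((a, s), (b, t)).
     a \<in> carrier A \<and> b \<in> carrier A \<and> s \<in> carrier A - P \<and> t \<in> carrier A - P \<and>
     (\<exists>u \<in> carrier A - P. u \<otimes>\<^bsub>A\<^esub> (a \<otimes>\<^bsub>A\<^esub> t \<ominus>\<^bsub>A\<^esub> b \<otimes>\<^bsub>A\<^esub> s) = \<zero>\<^bsub>A\<^esub>)}"

definition fraction :: "'a ring \<Rightarrow> 'a set \<Rightarrow> 'a \<Rightarrow> 'a \<Rightarrow> ('a \<times> 'a) set" where
  "fraction A P a s = frac_rel A P `` {(a, s)}"

definition localization :: "'a ring \<Rightarrow> 'a set \<Rightarrow> ('a \<times> 'a) set ring" where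
  "localization A P = \<lparr>
     carrier = (carrier A \<times> (carrier A - P)) // frac_rel A P,
     monoid.mult = (\<lambda>x y. \<Union>(a, s)\<in>x. \<Union>(b, t)\<in>y. fraction A P (a \<otimes>\<^bsub>A\<^esub> b) (s \<otimes>\<^bsub>A\<^esub> t)),
     monoid.one = fraction A P \<one>\<^bsub>A\<^esub> \<one>\<^bsub>A\<^esub>,
     ring.zero = fraction A P \<zero>\<^bsub>A\<^esub> \<one>\<^bsub>A\<^esub>,
     ring.add = (\<lambda>x y. \<Union>(a, s)\<in>x. \<Union>(b, t)\<in>y.
              fraction A P (a \<otimes>\<^bsub>A\<^esub> t \<oplus>\<^bsub>A\<^esub> b \<otimes>\<^bsub>A\<^esub> s) (s \<otimes>\<^bsub>A\<^esub> t))\<rparr>"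

text \<open>A section over \<open>U\<close> assigns to each \<open>P \<in> U\<close> an element of the localization at \<open>P\<close> and is
  locally given by a single fraction.\<close>

definition spec_sections :: "'a ring \<Rightarrow> 'a set set \<Rightarrow> ('a set \<Rightarrow> ('a \<times> 'a) set) set" where
  "spec_sections A U = {\<sigma> \<in> extensional U. \<forall>P\<in>U.
     \<exists>W a s. openin (spec_topology A) W \<and> P \<in> W \<and> W \<subseteq> U \<and> a \<in> carrier A \<and> s \<in> carrier A \<and>
       (\<forall>Q\<in>W. s \<notin> Q \<and> \<sigma> Q = fraction A Q a s)}"

definition Spec :: "'a ring \<Rightarrow> ('a set, 'a set \<Rightarrow> ('a \<times> 'a) set) ringed_space" where
  "Spec A = \<lparr>
     base = spec_topology A,
     str = (\<lambda>U. \<lparr>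
       carrier = spec_sections A U,
       monoid.mult = (\<lambda>\<sigma> \<tau>. \<lambda>P\<in>U. \<sigma> P \<otimes>\<^bsub>localization A P\<^esub> \<tau> P),
       monoid.one = (\<lambda>P\<in>U. \<one>\<^bsub>localization A P\<^esub>),
       ring.zero = (\<lambda>P\<in>U. \<zero>\<^bsub>localization A P\<^esub>),
       ring.add = (\<lambda>\<sigma> \<tau>. \<lambda>P\<in>U. \<sigma> P \<oplus>\<^bsub>localization A P\<^esub> \<tau> P)\<rparr>),
     res = (\<lambda>U V \<sigma>. restrict \<sigma> V)\<rparr>"

definition spec_const :: "'a ring \<Rightarrow> 'a \<Rightarrow> ('a set \<Rightarrow> ('a \<times> 'a) set)" where
  "spec_const A a = (\<lambda>P\<in>prime_spectrum A. fraction A P a \<one>\<^bsub>A\<^esub>)"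

text \<open>The ring \<open>A\<close> may be taken over the type of sections of \<open>X\<close>: an affine scheme is
  isomorphic to the spectrum of its ring of global sections.\<close>

definition affine_open :: "('p, 'r) ringed_space \<Rightarrow> 'p set \<Rightarrow> bool" where
  "affine_open X U \<longleftrightarrow> openin (base X) U \<and>
     (\<exists>(A :: 'r ring) f fs. cring A \<and> lrs_iso (open_sub X U) (Spec A) f fs)"


section \<open>Algebraic varieties\<close>

definition scheme :: "('p, 'r) ringed_space \<Rightarrow> bool" where
  "scheme X \<longleftrightarrow> locally_ringed_space X \<and> (\<forall>x \<in> points X. \<exists>U. x \<in> U \<and> affine_open X U)"

definition reduced :: "('p, 'r) ringed_space \<Rightarrow> bool" where
  "reduced X \<longleftrightarrow> (\<forall>U s (n::nat). openin (base X) U \<and> s \<in> carrier (str X U) \<and>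
     s [^]\<^bsub>str X U\<^esub> n = \<zero>\<^bsub>str X U\<^esub> \<longrightarrow> s = \<zero>\<^bsub>str X U\<^esub>)"

definition irreducible_space :: "'p topology \<Rightarrow> bool" where
  "irreducible_space T \<longleftrightarrow> topspace T \<noteq> {} \<and>
     (\<forall>C D. closedin T C \<and> closedin T D \<and> C \<union> D = topspace T
        \<longrightarrow> C = topspace T \<or> D = topspace T)"

definition fin_gen_algebra :: "'b ring \<Rightarrow> 'a ring \<Rightarrow> ('b \<Rightarrow> 'a) \<Rightarrow> bool" where
  "fin_gen_algebra B A \<phi> \<longleftrightarrow>
     (\<exists>S. finite S \<and> S \<subseteq> carrier A \<and> generate_ring A (\<phi> ` carrier B \<union> S) = carrier A)"

definition finite_type ::
    "('p, 'r) ringed_space \<Rightarrow> ('q, 't) ringed_space \<Rightarrow> ('p \<Rightarrow> 'q) \<Rightarrow> ('q set \<Rightarrow> 't \<Rightarrow> 'r) \<Rightarrow> bool" where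
  "finite_type X Y f fs \<longleftrightarrow>
     (\<exists>\<V>. (\<forall>V\<in>\<V>. affine_open Y V) \<and> \<Union>\<V> = points Y \<and>
        (\<forall>V\<in>\<V>. \<exists>\<U>. finite \<U> \<and> \<Union>\<U> = preim X f V \<and>
           (\<forall>U\<in>\<U>. affine_open X U \<and>
              fin_gen_algebra (str Y V) (str X U) (res X (preim X f V) U \<circ> fs V))))"

text \<open>An algebraic variety over \<open>k\<close>, with structure morphism \<open>(\<pi>, \<pi>s) : X \<rightarrow> Spec k\<close>.\<close>

definition variety ::
    "'k ring \<Rightarrow> ('p, 'r) ringed_space \<Rightarrow> ('p \<Rightarrow> 'k set) \<Rightarrow>
     ('k set set \<Rightarrow> ('k set \<Rightarrow> ('k \<times> 'k) set) \<Rightarrow> 'r) \<Rightarrow> bool" where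
  "variety k X \<pi> \<pi>s \<longleftrightarrow>
     scheme X \<and> lrs_morphism X (Spec k) \<pi> \<pi>s \<and> finite_type X (Spec k) \<pi> \<pi>s \<and>
     reduced X \<and> irreducible_space (base X)"

text \<open>The image of a scalar of \<open>k\<close> in \<open>O_X(U)\<close>, and \<open>O_X(U)\<close> as a \<open>k\<close>-module.  The fields
  \<open>mult\<close> and \<open>one\<close> of a module record are never used.\<close>

definition scalar ::
    "'k ring \<Rightarrow> ('p, 'r) ringed_space \<Rightarrow>
     ('k set set \<Rightarrow> ('k set \<Rightarrow> ('k \<times> 'k) set) \<Rightarrow> 'r) \<Rightarrow> 'p set \<Rightarrow> 'k \<Rightarrow> 'r" where
  "scalar k X \<pi>s U a = res X (points X) U (\<pi>s (points (Spec k)) (spec_const k a))"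

definition str_module ::
    "'k ring \<Rightarrow> ('p, 'r) ringed_space \<Rightarrow>
     ('k set set \<Rightarrow> ('k set \<Rightarrow> ('k \<times> 'k) set) \<Rightarrow> 'r) \<Rightarrow> 'p set \<Rightarrow> ('k, 'r) module" where
  "str_module k X \<pi>s U = \<lparr>
     carrier = carrier (str X U),
     monoid.mult = monoid.mult (str X U), monoid.one = monoid.one (str X U),
     ring.zero = ring.zero (str X U), ring.add = ring.add (str X U),
     smult = (\<lambda>a f. scalar k X \<pi>s U a \<otimes>\<^bsub>str X U\<^esub> f)\<rparr>"


section \<open>Vector bundles\<close>

record ('p, 'r, 'm) mod_sheaf =
  msec :: "'p set \<Rightarrow> ('r, 'm) module"
  mres :: "'p set \<Rightarrow> 'p set \<Rightarrow> 'm \<Rightarrow> 'm"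

definition sheaf_of_modules :: "('p, 'r) ringed_space \<Rightarrow> ('p, 'r, 'm) mod_sheaf \<Rightarrow> bool" where
  "sheaf_of_modules X F \<longleftrightarrow>
     sheaf_on (base X) (\<lambda>U. carrier (msec F U)) (mres F) \<and>
     (\<forall>U. openin (base X) U \<longrightarrow> Module.module (str X U) (msec F U)) \<and>
     (\<forall>U V s t. openin (base X) U \<and> openin (base X) V \<and> V \<subseteq> U \<and>
        s \<in> carrier (msec F U) \<and> t \<in> carrier (msec F U)
        \<longrightarrow> mres F U V (s \<oplus>\<^bsub>msec F U\<^esub> t) = mres F U V s \<oplus>\<^bsub>msec F V\<^esub> mres F U V t) \<and>
     (\<forall>U V c s. openin (base X) U \<and> openin (base X) V \<and> V \<subseteq> U \<and>
        c \<in> carrier (str X U) \<and> s \<in> carrier (msec F U)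
        \<longrightarrow> mres F U V (c \<odot>\<^bsub>msec F U\<^esub> s) = res X U V c \<odot>\<^bsub>msec F V\<^esub> mres F U V s)"

definition sheaf_hom ::
    "('p, 'r) ringed_space \<Rightarrow> ('p, 'r, 'm) mod_sheaf \<Rightarrow> ('p, 'r, 'n) mod_sheaf \<Rightarrow>
     ('p set \<Rightarrow> 'm \<Rightarrow> 'n) \<Rightarrow> bool" where
  "sheaf_hom X F G \<phi> \<longleftrightarrow>
     (\<forall>U. openin (base X) U \<longrightarrow> \<phi> U \<in> module_hom (str X U) (msec F U) (msec G U)) \<and>
     (\<forall>U V s. openin (base X) U \<and> openin (base X) V \<and> V \<subseteq> U \<and> s \<in> carrier (msec F U)
        \<longrightarrow> mres G U V (\<phi> U s) = \<phi> V (mres F U V s))"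

definition sheaf_iso ::
    "('p, 'r) ringed_space \<Rightarrow> ('p, 'r, 'm) mod_sheaf \<Rightarrow> ('p, 'r, 'n) mod_sheaf \<Rightarrow>
     ('p set \<Rightarrow> 'm \<Rightarrow> 'n) \<Rightarrow> bool" where
  "sheaf_iso X F G \<phi> \<longleftrightarrow> sheaf_hom X F G \<phi> \<and>
     (\<forall>U. openin (base X) U \<longrightarrow> bij_betw (\<phi> U) (carrier (msec F U)) (carrier (msec G U)))"

definition sheaf_mono ::
    "('p, 'r) ringed_space \<Rightarrow> ('p, 'r, 'm) mod_sheaf \<Rightarrow> ('p, 'r, 'n) mod_sheaf \<Rightarrow>
     ('p set \<Rightarrow> 'm \<Rightarrow> 'n) \<Rightarrow> bool" where
  "sheaf_mono X F G \<phi> \<longleftrightarrow> sheaf_hom X F G \<phi> \<and>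
     (\<forall>U. openin (base X) U \<longrightarrow> inj_on (\<phi> U) (carrier (msec F U)))"

definition free_sheaf :: "('p, 'r) ringed_space \<Rightarrow> nat \<Rightarrow> ('p, 'r, nat \<Rightarrow> 'r) mod_sheaf" where
  "free_sheaf X n = \<lparr>
     msec = (\<lambda>U. ring.func_space (str X U) {..<n}),
     mres = (\<lambda>U V s. \<lambda>i\<in>{..<n}. res X U V (s i))\<rparr>"

definition free_on :: "('p, 'r) ringed_space \<Rightarrow> ('p, 'r, 'm) mod_sheaf \<Rightarrow> 'p set \<Rightarrow> nat \<Rightarrow> bool" where
  "free_on X E U n \<longleftrightarrow> openin (base X) U \<and> (\<exists>\<phi>. sheaf_iso (open_sub X U) (free_sheaf X n) E \<phi>)"

definition vector_bundle :: "('p, 'r) ringed_space \<Rightarrow> ('p, 'r, 'm) mod_sheaf \<Rightarrow> bool" where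
  "vector_bundle X E \<longleftrightarrow> sheaf_of_modules X E \<and> (\<forall>x \<in> points X. \<exists>U n. x \<in> U \<and> free_on X E U n)"

text \<open>On an irreducible scheme any two nonempty open sets meet, so the rank of a vector bundle is
  the same on all nonempty open sets where the bundle is free.\<close>

definition rk :: "('p, 'r) ringed_space \<Rightarrow> ('p, 'r, 'm) mod_sheaf \<Rightarrow> nat" where
  "rk X E = (SOME n. \<exists>U. U \<noteq> {} \<and> free_on X E U n)"

text \<open>Every germ of \<open>E\<close> is a linear combination of germs of global sections, with coefficients in
  the stalk of \<open>O_X\<close>.\<close>

definition globally_generated :: "('p, 'r) ringed_space \<Rightarrow> ('p, 'r, 'm) mod_sheaf \<Rightarrow> bool" where
  "globally_generated X E \<longleftrightarrow>
     (\<forall>x U e. openin (base X) U \<and> x \<in> U \<and> e \<in> carrier (msec E U) \<longrightarrow>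
        (\<exists>W S c. openin (base X) W \<and> x \<in> W \<and> W \<subseteq> U \<and>
           finite S \<and> S \<subseteq> carrier (msec E (points X)) \<and> c \<in> S \<rightarrow> carrier (str X W) \<and>
           mres E U W e = (\<Oplus>\<^bsub>msec E W\<^esub> s\<in>S. c s \<odot>\<^bsub>msec E W\<^esub> mres E (points X) W s)))"

text \<open>\<open>H^0(X, E)\<close> as a \<open>k\<close>-vector space.\<close>

definition global_sections ::
    "'k ring \<Rightarrow> ('p, 'r) ringed_space \<Rightarrow>
     ('k set set \<Rightarrow> ('k set \<Rightarrow> ('k \<times> 'k) set) \<Rightarrow> 'r) \<Rightarrow> ('p, 'r, 'm) mod_sheaf \<Rightarrow> ('k, 'm) module" where
  "global_sections k X \<pi>s E = (let M = msec E (points X) in \<lparr>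
     carrier = carrier M, monoid.mult = monoid.mult M, monoid.one = monoid.one M,
     ring.zero = ring.zero M, ring.add = ring.add M,
     smult = (\<lambda>a s. scalar k X \<pi>s (points X) a \<odot>\<^bsub>M\<^esub> s)\<rparr>)"


section \<open>Tensor products over \<open>k\<close>\<close>

definition tensor_relations ::
    "'k ring \<Rightarrow> ('k, 'v) module \<Rightarrow> ('k, 'w) module \<Rightarrow> (('v \<times> 'w) \<Rightarrow>\<^sub>0 int) set" where
  "tensor_relations k V M =
     {frag_of (v \<oplus>\<^bsub>V\<^esub> v', m) - frag_of (v, m) - frag_of (v', m) | v v' m.
        v \<in> carrier V \<and> v' \<in> carrier V \<and> m \<in> carrier M} \<union>
     {frag_of (v, m \<oplus>\<^bsub>M\<^esub> m') - frag_of (v, m) - frag_of (v, m') | v m m'.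
        v \<in> carrier V \<and> m \<in> carrier M \<and> m' \<in> carrier M} \<union>
     {frag_of (a \<odot>\<^bsub>V\<^esub> v, m) - frag_of (v, a \<odot>\<^bsub>M\<^esub> m) | a v m.
        a \<in> carrier k \<and> v \<in> carrier V \<and> m \<in> carrier M}"

definition tensor_kernel ::
    "'k ring \<Rightarrow> ('k, 'v) module \<Rightarrow> ('k, 'w) module \<Rightarrow> (('v \<times> 'w) \<Rightarrow>\<^sub>0 int) set" where
  "tensor_kernel k V M =
     generate (free_Abelian_group (carrier V \<times> carrier M)) (tensor_relations k V M)"

definition tensor_group ::
    "'k ring \<Rightarrow> ('k, 'v) module \<Rightarrow> ('k, 'w) module \<Rightarrow> (('v \<times> 'w) \<Rightarrow>\<^sub>0 int) set monoid" where
  "tensor_group k V M = free_Abelian_group (carrier V \<times> carrier M) Mod tensor_kernel k V M"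

definition pure_tensor ::
    "'k ring \<Rightarrow> ('k, 'v) module \<Rightarrow> ('k, 'w) module \<Rightarrow> 'v \<Rightarrow> 'w \<Rightarrow> (('v \<times> 'w) \<Rightarrow>\<^sub>0 int) set" where
  "pure_tensor k V M v m =
     tensor_kernel k V M #>\<^bsub>free_Abelian_group (carrier V \<times> carrier M)\<^esub> frag_of (v, m)"

text \<open>The homomorphism from the tensor product to the commutative group \<open>G\<close> with
  \<open>v \<otimes> m \<mapsto> h v m\<close>, for \<open>h\<close> biadditive and \<open>k\<close>-balanced: a tensor is a coset \<open>C\<close>, and the
  extension of \<open>h\<close> to the free abelian group is constant on \<open>C\<close>.\<close>

definition tensor_lift :: "('g, 'x) monoid_scheme \<Rightarrow> ('v \<Rightarrow> 'w \<Rightarrow> 'g) \<Rightarrow> (('v \<times> 'w) \<Rightarrow>\<^sub>0 int) set \<Rightarrow> 'g" where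
  "tensor_lift G h C =
     the_elem ((\<lambda>c. \<Otimes>\<^bsub>G\<^esub>z\<in>Poly_Mapping.keys c. h (fst z) (snd z) [^]\<^bsub>G\<^esub> Poly_Mapping.lookup c z) ` C)"

text \<open>The sheaf \<open>V \<otimes>\<^sub>k O_X\<close>, with sections \<open>V \<otimes>\<^sub>k O_X(U)\<close> over \<open>U\<close>.  For finite-dimensional \<open>V\<close>
  this presheaf is isomorphic to a finite direct sum of copies of \<open>O_X\<close>, so it needs no
  sheafification.\<close>

definition tensor_sheaf ::
    "'k ring \<Rightarrow> ('p, 'r) ringed_space \<Rightarrow> ('k set set \<Rightarrow> ('k set \<Rightarrow> ('k \<times> 'k) set) \<Rightarrow> 'r) \<Rightarrow>
     ('k, 'm) module \<Rightarrow> ('p, 'r, (('m \<times> 'r) \<Rightarrow>\<^sub>0 int) set) mod_sheaf" where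
  "tensor_sheaf k X \<pi>s V = \<lparr>
     msec = (\<lambda>U. let M = str_module k X \<pi>s U; T = tensor_group k V M in \<lparr>
       carrier = carrier T, monoid.mult = undefined, monoid.one = undefined,
       ring.zero = monoid.one T, ring.add = monoid.mult T,
       smult = (\<lambda>g. tensor_lift T (\<lambda>v f. pure_tensor k V M v (g \<otimes>\<^bsub>str X U\<^esub> f)))\<rparr>),
     mres = (\<lambda>U W. let M = str_module k X \<pi>s W in
       tensor_lift (tensor_group k V M) (\<lambda>v f. pure_tensor k V M v (res X U W f)))\<rparr>"

definition evaluation ::
    "('p, 'r) ringed_space \<Rightarrow> ('p, 'r, 'm) mod_sheaf \<Rightarrow> 'p set \<Rightarrow> (('m \<times> 'r) \<Rightarrow>\<^sub>0 int) set \<Rightarrow> 'm" where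
  "evaluation X E U =
     tensor_lift (add_monoid (msec E U)) (\<lambda>v f. f \<odot>\<^bsub>msec E U\<^esub> mres E (points X) U v)"


section \<open>Grassmannians\<close>

definition sub_module :: "('k, 'v) module \<Rightarrow> 'v set \<Rightarrow> ('k, 'v) module" where
  "sub_module H V = H\<lparr>carrier := V\<rparr>"

definition Grass :: "'k ring \<Rightarrow> nat \<Rightarrow> ('k, 'v) module \<Rightarrow> 'v set set" where
  "Grass k l H = {V. VectorSpace.subspace k V H \<and> vectorspace.dim k (sub_module H V) = l}"

definition ordered_basis :: "'k ring \<Rightarrow> ('k, 'v) module \<Rightarrow> nat \<Rightarrow> (nat \<Rightarrow> 'v) \<Rightarrow> bool" where
  "ordered_basis k H n b \<longleftrightarrow> inj_on b {..<n} \<and> vectorspace.basis k H (b ` {..<n})"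

text \<open>The rows of the \<open>l \<times> n\<close> matrix \<open>a\<close>, read as coordinates with respect to the basis \<open>b\<close> of
  \<open>H\<close>, form a basis of \<open>V\<close>.\<close>

definition represents ::
    "'k ring \<Rightarrow> ('k, 'v) module \<Rightarrow> nat \<Rightarrow> (nat \<Rightarrow> 'v) \<Rightarrow> nat \<Rightarrow> (nat \<Rightarrow> nat \<Rightarrow> 'k) \<Rightarrow> 'v set \<Rightarrow> bool" where
  "represents k H n b l a V \<longleftrightarrow>
     (\<forall>i<l. \<forall>j<n. a i j \<in> carrier k) \<and>
     ordered_basis k (sub_module H V) l (\<lambda>i. \<Oplus>\<^bsub>H\<^esub>j\<in>{..<n}. a i j \<odot>\<^bsub>H\<^esub> b j)"

definition det_ring :: "'k ring \<Rightarrow> nat \<Rightarrow> (nat \<Rightarrow> nat \<Rightarrow> 'k) \<Rightarrow> 'k" where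
  "det_ring k l a = (\<Oplus>\<^bsub>k\<^esub>\<sigma>\<in>{\<sigma>. \<sigma> permutes {..<l}}.
     (let p = (\<Otimes>\<^bsub>k\<^esub>i\<in>{..<l}. a i (\<sigma> i)) in if evenperm \<sigma> then p else \<ominus>\<^bsub>k\<^esub> p))"

text \<open>The Plucker coordinate of index \<open>\<phi>\<close> is the minor on the columns \<open>\<phi> 0, \<dots>, \<phi> (l - 1)\<close>.  All
  \<open>l\<close>-tuples of columns are allowed as indices; compared with increasing tuples this only adds
  coordinates that are zero or equal up to sign to others.\<close>

definition plucker :: "'k ring \<Rightarrow> nat \<Rightarrow> (nat \<Rightarrow> nat \<Rightarrow> 'k) \<Rightarrow> (nat \<Rightarrow> nat) \<Rightarrow> 'k" where
  "plucker k l a \<phi> = det_ring k l (\<lambda>i j. a i (\<phi> j))"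

inductive homogeneous_poly ::
    "'k ring \<Rightarrow> 'i set \<Rightarrow> nat \<Rightarrow> (('i \<Rightarrow> 'k) \<Rightarrow> 'k) \<Rightarrow> bool"
  for k :: "'k ring" and I :: "'i set" where
  const: "c \<in> carrier k \<Longrightarrow> homogeneous_poly k I 0 (\<lambda>_. c)"
| coord: "i \<in> I \<Longrightarrow> homogeneous_poly k I 1 (\<lambda>x. x i)"
| add: "homogeneous_poly k I d f \<Longrightarrow> homogeneous_poly k I d g
        \<Longrightarrow> homogeneous_poly k I d (\<lambda>x. f x \<oplus>\<^bsub>k\<^esub> g x)"
| mult: "homogeneous_poly k I d f \<Longrightarrow> homogeneous_poly k I e g
        \<Longrightarrow> homogeneous_poly k I (d + e) (\<lambda>x. f x \<otimes>\<^bsub>k\<^esub> g x)"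

text \<open>The Zariski topology on the set of \<open>l\<close>-dimensional subspaces, as a subset of projective space
  under the Plucker embedding: the complement of \<open>\<U>\<close> is the common zero locus of a set \<open>F\<close> of
  homogeneous polynomials in the Plucker coordinates.  The choice of \<open>b\<close> is immaterial because
  another basis changes the coordinates linearly; the choice of \<open>a\<close> because it only rescales
  them.  The points here are the \<open>k\<close>-rational ones; a nonempty open set in this sense is the trace of
  an open subset of the Grassmannian variety that has a \<open>k\<close>-rational point.\<close>

definition zariski_open :: "'k ring \<Rightarrow> nat \<Rightarrow> ('k, 'v) module \<Rightarrow> 'v set set \<Rightarrow> bool" where
  "zariski_open k l H \<U> \<longleftrightarrow>
     (let n = vectorspace.dim k H in
      \<exists>b F. ordered_basis k H n b \<and>
        F \<subseteq> {f. \<exists>d. homogeneous_poly k ({..<l} \<rightarrow>\<^sub>E {..<n}) d f} \<and>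
        \<U> = {V \<in> Grass k l H. \<exists>a. represents k H n b l a V \<and>
               (\<exists>f\<in>F. f (plucker k l a) \<noteq> \<zero>\<^bsub>k\<^esub>)})"

end

theory Submission
  imports Defs
begin

text \<open>
  Fix a nonempty open set \<open>U0\<close> on which \<open>E\<close> is free.  The first \<open>l\<close> coordinates of \<open>l\<close> global
  sections form an \<open>l \<times> l\<close> matrix over \<open>O(U0)\<close>; let \<open>D\<close> be its determinant.  An integral scheme has
  no zero divisors and injective restriction maps, so by Cramer's rule \<open>D \<noteq> 0\<close> makes the sections
  linearly independent over \<open>O(U)\<close> for every open \<open>U\<close>, which is injectivity of the evaluation map.

  Global generation near a point of \<open>U0\<close> factors the identity matrix through the coordinates of
  finitely many global sections, and expanding the determinant of this product shows that \<open>D \<noteq> 0\<close>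
  for some \<open>l\<close> of them.  As they are found among the generators, and not by a general-position
  argument, this also works over a finite field.

  In terms of a basis of \<open>H^0(X, E)\<close>, \<open>D\<close> is a linear form in the Plucker coordinates with coefficients
  in \<open>O(U0)\<close>.  Composing it with a suitable \<open>k\<close>-linear functional on \<open>O(U0)\<close> gives a linear form over
  \<open>k\<close> whose non-vanishing locus is the required open set.
\<close>

section \<open>Nilpotent elements and localization\<close>

text \<open>The absence of zero divisors and the injectivity of restriction rest on one fact: on a
  reduced scheme a section with no invertible germ is zero. In an affine chart this comes from the
  nilpotency of elements lying in all primes. Hence the locus where a nonzero section is invertible
  is open and nonempty, and irreducibility makes any two such loci meet; a common point plays the
  part that the generic point plays in the usual argument.

  The functional is there because of a mismatch of coefficients. The determinant takes values in
  \<open>O(U0)\<close>, which may be infinite-dimensional over \<open>k\<close>, while the open set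
  must be cut out by polynomials over \<open>k\<close>. Only finitely many elements of
  \<open>O(U0)\<close> occur as coefficients, so a functional on their span is enough, and the
  coordinate along the one determinant known to be nonzero is suitable. A nonzero value of the
  functional forces a nonzero determinant, but not conversely, so the open set may be smaller than
  the full locus where \<open>D\<close> is nonzero.\<close>

lemma (in cring) nilpotent_if_in_all_primes:
  assumes a: "a \<in> carrier R" and prime: "\<And>P. primeideal P R \<Longrightarrow> a \<in> P"
  shows "\<exists>n::nat. a [^] n = \<zero>"
proof (rule ccontr)
  assume neg: "\<not> ?thesis"
  \<comment> \<open>The ideals that contain no power of \<open>a\<close>. A maximal one turns out to
    be prime and misses \<open>a\<close>, against the hypothesis. That \<open>a\<close> is not
    nilpotent puts the zero ideal into the family.\<close>
  let ?\<I> = "{I. ideal I R \<and> (\<forall>n::nat. a [^] n \<notin> I)}"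
  have zero: "{\<zero>} \<in> ?\<I>" using neg zeroideal by auto
  have "\<exists>M\<in>?\<I>. \<forall>X\<in>?\<I>. M \<subseteq> X \<longrightarrow> X = M"
  proof (rule subset_Zorn_nonempty)
    show "?\<I> \<noteq> {}" using zero by blast
    fix C assume C: "C \<noteq> {}" "subset.chain ?\<I> C"
    have id: "ideal I R" if "I \<in> C" for I using C(2) that by (auto simp: subset.chain_def)
    have "ideal (\<Union>C) R"
    proof (rule idealI)
      show "ring R" by (rule ring_axioms)
      show "subgroup (\<Union>C) (add_monoid R)"
      proof (rule add.subgroupI)
        show "\<Union>C \<subseteq> carrier R" using id by (auto dest: ideal.Icarr)
        show "\<Union>C \<noteq> {}" using C(1) id
          by (metis Union_iff additive_subgroup.zero_closed empty_iff ex_in_conv ideal.axioms(1))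
        fix x assume "x \<in> \<Union>C"
        then show "\<ominus> x \<in> \<Union>C" using id
          by (metis Union_iff additive_subgroup.a_inv_closed ideal.axioms(1))
        fix y assume "y \<in> \<Union>C"
        with \<open>x \<in> \<Union>C\<close> obtain I J where IJ: "I \<in> C" "J \<in> C" "x \<in> I" "y \<in> J" by blast
        then have "I \<subseteq> J \<or> J \<subseteq> I" using C(2) by (auto simp: subset.chain_def)
        then show "x \<oplus> y \<in> \<Union>C" using IJ id
          by (metis UnionI additive_subgroup.a_closed ideal.axioms(1) subsetD)
      qed
    qed (use id in \<open>auto dest: ideal.I_l_closed ideal.I_r_closed\<close>)
    moreover have "\<forall>n::nat. a [^] n \<notin> \<Union>C" using C(2) by (auto simp: subset.chain_def)
    ultimately show "\<Union>C \<in> ?\<I>" by blast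
  qed
  then obtain M where M: "ideal M R" "\<And>n::nat. a [^] n \<notin> M"
    and max: "\<And>X. ideal X R \<Longrightarrow> (\<And>n::nat. a [^] n \<notin> X) \<Longrightarrow> M \<subseteq> X \<Longrightarrow> X = M"
    by auto
  interpret M: ideal M R by (rule M(1))
  \<comment> \<open>For \<open>x\<close> outside \<open>M\<close> the ideal generated by
    \<open>M\<close> and \<open>x\<close> is strictly larger than \<open>M\<close>, so by maximality
    it contains a power of \<open>a\<close>.\<close>
  have pw: "\<exists>(n::nat) i r. a [^] n = i \<oplus> r \<otimes> x \<and> i \<in> M \<and> r \<in> carrier R"
    if x: "x \<in> carrier R" "x \<notin> M" for x
  proof -
    let ?X = "M <+>\<^bsub>R\<^esub> PIdl x"
    have id: "ideal ?X R" using add_ideals[OF M(1) cgenideal_ideal[OF x(1)]] .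
    have mem: "z \<in> ?X \<longleftrightarrow> (\<exists>i\<in>M. \<exists>r\<in>carrier R. z = i \<oplus> r \<otimes> x)" for z
      by (auto simp: set_add_def' cgenideal_def)
    have "M \<subseteq> ?X"
    proof
      fix i assume "i \<in> M"
      then show "i \<in> ?X" unfolding mem using x(1) by (intro bexI[of _ i] bexI[of _ \<zero>]) (auto dest: M.Icarr)
    qed
    moreover have "x \<in> ?X" unfolding mem using x(1) M.zero_closed
      by (intro bexI[of _ \<zero>] bexI[of _ \<one>]) auto
    ultimately have "\<exists>n::nat. a [^] n \<in> ?X" using max[OF id] x(2) by blast
    then show ?thesis unfolding mem by blast
  qed
  have "primeideal M R"
  proof (rule primeidealI)
    show "ideal M R" "cring R" by (fact M(1), fact is_cring)
    show "carrier R \<noteq> M" using M(2)[of 0] by auto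
    fix x y assume xy: "x \<in> carrier R" "y \<in> carrier R" "x \<otimes> y \<in> M"
    show "x \<in> M \<or> y \<in> M"
    proof (rule ccontr)
      assume "\<not> (x \<in> M \<or> y \<in> M)"
      then obtain n m :: nat and i j r s where
        *: "a [^] n = i \<oplus> r \<otimes> x" "i \<in> M" "r \<in> carrier R"
           "a [^] m = j \<oplus> s \<otimes> y" "j \<in> M" "s \<in> carrier R"
        using pw[of x] pw[of y] xy by blast
      have car: "i \<in> carrier R" "j \<in> carrier R" using * M.Icarr by auto
      \<comment> \<open>Multiplying the two representations gives terms with a factor
        \<open>i\<close>, \<open>j\<close> or \<open>x \<otimes> y\<close>, each of which lies in
        \<open>M\<close>.\<close>
      have "a [^] (n + m) = (i \<oplus> r \<otimes> x) \<otimes> (j \<oplus> s \<otimes> y)"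
        using a by (simp flip: nat_pow_mult *(1,4))
      also have "\<dots> = i \<otimes> (j \<oplus> s \<otimes> y) \<oplus> (r \<otimes> x) \<otimes> j \<oplus> (r \<otimes> s) \<otimes> (x \<otimes> y)"
        using * car xy by (simp add: l_distr r_distr m_ac a_ac)
      also have "\<dots> \<in> M"
        using M.I_r_closed[OF *(2), of "j \<oplus> s \<otimes> y"] M.I_l_closed[OF *(5), of "r \<otimes> x"]
          M.I_l_closed[OF xy(3), of "r \<otimes> s"] * car xy by (intro M.a_closed) auto
      finally show False using M(2) by blast
    qed
  qed
  then have "a [^] (1::nat) \<in> M" using prime a by simp
  then show False using M(2) by blast
qed

section \<open>Localization of a commutative ring at a prime ideal\<close>

locale localization_at = primeideal P A for P and A :: "'a ring" (structure)
begin

abbreviation "denoms \<equiv> carrier A - P"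

lemma one_denom: "\<one> \<in> denoms"
  using I_notcarr one_imp_carrier by blast

lemma mult_denom: "s \<in> denoms \<Longrightarrow> t \<in> denoms \<Longrightarrow> s \<otimes> t \<in> denoms"
  using I_prime by auto

text \<open>Removing the subtraction leaves an equation between products, which can be manipulated
  by commutativity and associativity alone.\<close>

lemma mem_frac_rel:
  "((a, s), (b, t)) \<in> frac_rel A P \<longleftrightarrow>
     a \<in> carrier A \<and> b \<in> carrier A \<and> s \<in> denoms \<and> t \<in> denoms \<and>
     (\<exists>u \<in> denoms. u \<otimes> (a \<otimes> t) = u \<otimes> (b \<otimes> s))"
proof -
  have "u \<otimes> (x \<ominus> y) = \<zero> \<longleftrightarrow> u \<otimes> x = u \<otimes> y"
    if "u \<in> carrier A" "x \<in> carrier A" "y \<in> carrier A" for u x y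
  proof -
    have "u \<otimes> (x \<ominus> y) = u \<otimes> x \<ominus> u \<otimes> y" using that by (simp add: a_minus_def r_distr r_minus)
    then show ?thesis using that by simp
  qed
  then show ?thesis by (auto simp: frac_rel_def)
qed

lemma equiv_frac_rel: "equiv (carrier A \<times> denoms) (frac_rel A P)"
proof (rule equivI)
  show "frac_rel A P \<subseteq> (carrier A \<times> denoms) \<times> carrier A \<times> denoms"
    by (auto simp: frac_rel_def)
  show "refl_on (carrier A \<times> denoms) (frac_rel A P)"
    using one_denom by (auto simp: refl_on_def mem_frac_rel)
  show "sym (frac_rel A P)"
    by (rule symI) (force simp: mem_frac_rel)
  show "trans (frac_rel A P)"
  proof (rule transI)
    fix x y z assume *: "(x, y) \<in> frac_rel A P" "(y, z) \<in> frac_rel A P"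
    obtain a s b t c w where xyz: "x = (a, s)" "y = (b, t)" "z = (c, w)" by (metis surj_pair)
    from * obtain u v where
      u: "u \<in> denoms" "u \<otimes> (a \<otimes> t) = u \<otimes> (b \<otimes> s)" and v: "v \<in> denoms" "v \<otimes> (b \<otimes> w) = v \<otimes> (c \<otimes> t)"
      and [simp]: "a \<in> carrier A" "b \<in> carrier A" "c \<in> carrier A"
        "s \<in> denoms" "t \<in> denoms" "w \<in> denoms"
      by (auto simp: xyz mem_frac_rel)
    have car: "s \<in> carrier A" "t \<in> carrier A" "w \<in> carrier A" "u \<in> carrier A" "v \<in> carrier A"
      using u v \<open>s \<in> denoms\<close> \<open>t \<in> denoms\<close> \<open>w \<in> denoms\<close> by auto
    \<comment> \<open>The middle denominator \<open>t\<close> has to join the witness because it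
      cannot be cancelled; the product \<open>u \<otimes> v \<otimes> t\<close> still avoids
      \<open>P\<close>.\<close>
    have "(u \<otimes> v \<otimes> t) \<otimes> (a \<otimes> w) = (v \<otimes> w) \<otimes> (u \<otimes> (a \<otimes> t))" using car by (simp add: m_ac)
    also have "\<dots> = (u \<otimes> s) \<otimes> (v \<otimes> (b \<otimes> w))" unfolding u(2) using car by (simp add: m_ac)
    also have "\<dots> = (u \<otimes> v \<otimes> t) \<otimes> (c \<otimes> s)" unfolding v(2) using car by (simp add: m_ac)
    finally have "(u \<otimes> v \<otimes> t) \<otimes> (a \<otimes> w) = (u \<otimes> v \<otimes> t) \<otimes> (c \<otimes> s)" .
    moreover have "u \<otimes> v \<otimes> t \<in> denoms" using u v \<open>t \<in> denoms\<close> by (intro mult_denom)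
    ultimately show "(x, z) \<in> frac_rel A P"
      using \<open>s \<in> denoms\<close> \<open>w \<in> denoms\<close> unfolding xyz mem_frac_rel by auto
  qed
qed

lemma fraction_eq_iff:
  assumes "a \<in> carrier A" "b \<in> carrier A" "s \<in> denoms" "t \<in> denoms"
  shows "fraction A P a s = fraction A P b t \<longleftrightarrow> (\<exists>u \<in> denoms. u \<otimes> (a \<otimes> t) = u \<otimes> (b \<otimes> s))"
  unfolding fraction_def
  using eq_equiv_class_iff[OF equiv_frac_rel, of "(a, s)" "(b, t)"] assms
  by (simp add: mem_frac_rel)

lemma mem_fraction:
  assumes "a \<in> carrier A" "s \<in> denoms"
  shows "(b, t) \<in> fraction A P a s \<longleftrightarrow>
    b \<in> carrier A \<and> t \<in> denoms \<and> fraction A P b t = fraction A P a s"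
proof -
  have "(b, t) \<in> fraction A P a s \<longleftrightarrow> ((a, s), (b, t)) \<in> frac_rel A P"
    by (simp add: fraction_def)
  also have "\<dots> \<longleftrightarrow> b \<in> carrier A \<and> t \<in> denoms \<and> fraction A P a s = fraction A P b t"
    using assms fraction_eq_iff[OF assms(1) _ assms(2), of b t] unfolding mem_frac_rel by blast
  finally show ?thesis by (simp only: eq_commute[of "fraction A P b t"])
qed

text \<open>The operations of \<open>localization\<close> are unions over all pairs of
  representatives. A union of equal sets over nonempty classes collapses to that set, so for each
  operation only independence of the representatives remains to be checked.\<close>

lemma fraction_binop:
  assumes "a \<in> carrier A" "s \<in> denoms" "b \<in> carrier A" "t \<in> denoms"
    and "\<And>a' s' b' t'. \<lbrakk>a' \<in> carrier A; s' \<in> denoms; b' \<in> carrier A; t' \<in> denoms;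
      fraction A P a' s' = fraction A P a s; fraction A P b' t' = fraction A P b t\<rbrakk>
      \<Longrightarrow> F a' s' b' t' = F a s b t"
  shows "(\<Union>(a, s)\<in>fraction A P a s. \<Union>(b, t)\<in>fraction A P b t. F a s b t) = F a s b t"
proof -
  let ?x = "fraction A P a s" and ?y = "fraction A P b t"
  have mem: "(a, s) \<in> ?x" "(b, t) \<in> ?y"
    using mem_fraction assms(1-4) by blast+
  have eq: "F a' s' b' t' = F a s b t" if "(a', s') \<in> ?x" "(b', t') \<in> ?y" for a' s' b' t'
    using assms(5)[of a' s' b' t'] that
    by (simp add: mem_fraction[OF assms(1,2)] mem_fraction[OF assms(3,4)])
  have "(\<Union>(b', t')\<in>?y. F a' s' b' t') = F a s b t" if "(a', s') \<in> ?x" for a' s'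
    by (rule SUP_eq_const) (use eq[OF that] mem(2) in auto)
  then show ?thesis
    by (intro SUP_eq_const) (use mem(1) in auto)
qed

lemma fraction_mult:
  assumes "a \<in> carrier A" "s \<in> denoms" "b \<in> carrier A" "t \<in> denoms"
  shows "fraction A P a s \<otimes>\<^bsub>localization A P\<^esub> fraction A P b t = fraction A P (a \<otimes> b) (s \<otimes> t)"
proof -
  have "fraction A P (a' \<otimes> b') (s' \<otimes> t') = fraction A P (a \<otimes> b) (s \<otimes> t)"
    if *: "a' \<in> carrier A" "s' \<in> denoms" "b' \<in> carrier A" "t' \<in> denoms"
      "fraction A P a' s' = fraction A P a s" "fraction A P b' t' = fraction A P b t" for a' s' b' t'
  proof -
    obtain u where u: "u \<in> denoms" "u \<otimes> (a' \<otimes> s) = u \<otimes> (a \<otimes> s')"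
      using *(5) fraction_eq_iff[OF *(1) assms(1) *(2) assms(2)] by blast
    obtain v where v: "v \<in> denoms" "v \<otimes> (b' \<otimes> t) = v \<otimes> (b \<otimes> t')"
      using *(6) fraction_eq_iff[OF *(3) assms(3) *(4) assms(4)] by blast
    have "(u \<otimes> v) \<otimes> ((a' \<otimes> b') \<otimes> (s \<otimes> t)) = (u \<otimes> (a' \<otimes> s)) \<otimes> (v \<otimes> (b' \<otimes> t))"
      using *(1-4) u(1) v(1) assms by (simp add: m_ac)
    also have "\<dots> = (u \<otimes> v) \<otimes> ((a \<otimes> b) \<otimes> (s' \<otimes> t'))"
      unfolding u(2) v(2) using *(1-4) u(1) v(1) assms by (simp add: m_ac)
    finally have "(u \<otimes> v) \<otimes> ((a' \<otimes> b') \<otimes> (s \<otimes> t)) = (u \<otimes> v) \<otimes> ((a \<otimes> b) \<otimes> (s' \<otimes> t'))" .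
    moreover have "a' \<otimes> b' \<in> carrier A" "a \<otimes> b \<in> carrier A" using *(1-4) assms by auto
    ultimately show ?thesis
      using fraction_eq_iff[OF _ _ mult_denom[OF *(2,4)] mult_denom[OF assms(2,4)]]
        mult_denom[OF u(1) v(1)] by metis
  qed
  then have "(\<Union>(a, s)\<in>fraction A P a s. \<Union>(b, t)\<in>fraction A P b t. fraction A P (a \<otimes> b) (s \<otimes> t)) = fraction A P (a \<otimes> b) (s \<otimes> t)"
    by - (rule fraction_binop[where F = "\<lambda>a s b t. fraction A P (a \<otimes> b) (s \<otimes> t)", OF assms], blast)
  then show ?thesis by (simp add: localization_def)
qed

lemma fraction_add:
  assumes "a \<in> carrier A" "s \<in> denoms" "b \<in> carrier A" "t \<in> denoms"
  shows "fraction A P a s \<oplus>\<^bsub>localization A P\<^esub> fraction A P b t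
    = fraction A P (a \<otimes> t \<oplus> b \<otimes> s) (s \<otimes> t)"
proof -
  have "fraction A P (a' \<otimes> t' \<oplus> b' \<otimes> s') (s' \<otimes> t') = fraction A P (a \<otimes> t \<oplus> b \<otimes> s) (s \<otimes> t)"
    if *: "a' \<in> carrier A" "s' \<in> denoms" "b' \<in> carrier A" "t' \<in> denoms"
      "fraction A P a' s' = fraction A P a s" "fraction A P b' t' = fraction A P b t" for a' s' b' t'
  proof -
    obtain u where u: "u \<in> denoms" "u \<otimes> (a' \<otimes> s) = u \<otimes> (a \<otimes> s')"
      using *(5) fraction_eq_iff[OF *(1) assms(1) *(2) assms(2)] by blast
    obtain v where v: "v \<in> denoms" "v \<otimes> (b' \<otimes> t) = v \<otimes> (b \<otimes> t')"
      using *(6) fraction_eq_iff[OF *(3) assms(3) *(4) assms(4)] by blast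
    have "(u \<otimes> v) \<otimes> ((a' \<otimes> t' \<oplus> b' \<otimes> s') \<otimes> (s \<otimes> t))
        = (u \<otimes> (a' \<otimes> s)) \<otimes> (v \<otimes> t \<otimes> t') \<oplus> (v \<otimes> (b' \<otimes> t)) \<otimes> (u \<otimes> s \<otimes> s')"
      using *(1-4) u(1) v(1) assms by (simp add: m_ac l_distr r_distr)
    also have "\<dots> = (u \<otimes> v) \<otimes> ((a \<otimes> t \<oplus> b \<otimes> s) \<otimes> (s' \<otimes> t'))"
      unfolding u(2) v(2) using *(1-4) u(1) v(1) assms by (simp add: m_ac l_distr r_distr)
    finally have "(u \<otimes> v) \<otimes> ((a' \<otimes> t' \<oplus> b' \<otimes> s') \<otimes> (s \<otimes> t))
       = (u \<otimes> v) \<otimes> ((a \<otimes> t \<oplus> b \<otimes> s) \<otimes> (s' \<otimes> t'))" .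
    moreover have "a' \<otimes> t' \<oplus> b' \<otimes> s' \<in> carrier A" "a \<otimes> t \<oplus> b \<otimes> s \<in> carrier A" using *(1-4) assms by auto
    ultimately show ?thesis
      using fraction_eq_iff[OF _ _ mult_denom[OF *(2,4)] mult_denom[OF assms(2,4)]]
        mult_denom[OF u(1) v(1)] by metis
  qed
  then have "(\<Union>(a, s)\<in>fraction A P a s. \<Union>(b, t)\<in>fraction A P b t. fraction A P (a \<otimes> t \<oplus> b \<otimes> s) (s \<otimes> t)) = fraction A P (a \<otimes> t \<oplus> b \<otimes> s) (s \<otimes> t)"
    by - (rule fraction_binop[where F = "\<lambda>a s b t. fraction A P (a \<otimes> t \<oplus> b \<otimes> s) (s \<otimes> t)", OF assms], blast)
  then show ?thesis by (simp add: localization_def)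
qed

lemma fraction_one: "\<one>\<^bsub>localization A P\<^esub> = fraction A P \<one> \<one>"
  by (simp add: localization_def)

end

section \<open>Determinants over commutative rings\<close>

abbreviation perms :: "nat \<Rightarrow> (nat \<Rightarrow> nat) set" where
  "perms l \<equiv> {\<sigma>. \<sigma> permutes {..<l}}"

lemma finite_perms: "finite (perms l)"
  by (simp add: finite_permutations)

lemma perm_lt: "\<sigma> permutes {..<l :: nat} \<Longrightarrow> i < l \<Longrightarrow> \<sigma> i < l"
  using permutes_in_image by fastforce

section \<open>Iterated sums and products of sums\<close>

lemma (in abelian_monoid) finsum_Times:
  assumes "finite S" "finite T" "\<And>s t. s \<in> S \<Longrightarrow> t \<in> T \<Longrightarrow> f s t \<in> carrier G"
  shows "(\<Oplus>s\<in>S. \<Oplus>t\<in>T. f s t) = (\<Oplus>p\<in>S \<times> T. f (fst p) (snd p))"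
  using assms(1,3)
proof (induction S rule: finite_induct)
  case (insert s S)
  have "insert s S \<times> T = Pair s ` T \<union> S \<times> T" by auto
  then have "(\<Oplus>p\<in>insert s S \<times> T. f (fst p) (snd p))
      = (\<Oplus>p\<in>Pair s ` T. f (fst p) (snd p)) \<oplus> (\<Oplus>p\<in>S \<times> T. f (fst p) (snd p))"
    using insert.prems insert.hyps assms(2) by (simp, intro finsum_Un_disjoint) auto
  also have "(\<Oplus>p\<in>Pair s ` T. f (fst p) (snd p)) = (\<Oplus>t\<in>T. f s t)"
    using insert.prems by (subst finsum_reindex) (auto simp: inj_on_def)
  also have "(\<Oplus>p\<in>S \<times> T. f (fst p) (snd p)) = (\<Oplus>s\<in>S. \<Oplus>t\<in>T. f s t)"
    using insert by auto
  finally show ?case using insert by (auto simp: Pi_def)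
qed simp

lemma (in abelian_monoid) finsum_swap:
  assumes "finite S" "finite T" "\<And>s t. s \<in> S \<Longrightarrow> t \<in> T \<Longrightarrow> f s t \<in> carrier G"
  shows "(\<Oplus>s\<in>S. \<Oplus>t\<in>T. f s t) = (\<Oplus>t\<in>T. \<Oplus>s\<in>S. f s t)"
proof -
  have "T \<times> S = prod.swap ` (S \<times> T)" by auto
  then have "(\<Oplus>p\<in>T \<times> S. f (snd p) (fst p)) = (\<Oplus>p\<in>prod.swap ` (S \<times> T). f (snd p) (fst p))"
    by simp
  also have "\<dots> = (\<Oplus>p\<in>S \<times> T. f (fst p) (snd p))"
    using assms(3) by (subst finsum_reindex) auto
  finally show ?thesis
    using finsum_Times[OF assms] finsum_Times[OF assms(2,1), of "\<lambda>t s. f s t"] assms(3) by simp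
qed

lemma (in abelian_monoid) finsum_single:
  assumes "finite S" "i \<in> S" "f i \<in> carrier G" "\<And>j. j \<in> S \<Longrightarrow> j \<noteq> i \<Longrightarrow> f j = \<zero>"
  shows "(\<Oplus>j\<in>S. f j) = f i"
proof -
  have "(\<Oplus>j\<in>S. f j) = (\<Oplus>j\<in>S. if i = j then f j else \<zero>)"
    using assms by (intro finsum_cong') auto
  also have "\<dots> = f i"
    using assms by (intro add.finprod_singleton) (auto simp: Pi_def, metis zero_closed)
  finally show ?thesis .
qed

context cring
begin

lemma finprod_zero_factor:
  assumes "finite I" "i \<in> I" "f \<in> I \<rightarrow> carrier R" "f i = \<zero>"
  shows "(\<Otimes>i\<in>I. f i) = \<zero>"
proof -
  have "(\<Otimes>i\<in>insert i (I - {i}). f i) = f i \<otimes> (\<Otimes>i\<in>I - {i}. f i)"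
    using assms by (intro finprod_insert) auto
  moreover have "(\<Otimes>i\<in>I - {i}. f i) \<in> carrier R" using assms by (intro finprod_closed) auto
  ultimately show ?thesis using assms by (simp add: insert_absorb)
qed

text \<open>Generalized distributivity: expanding the product picks one summand from each factor,
  and \<open>\<psi>\<close> records the picks. Extensional functions make a choice over
  \<open>insert i I\<close> the same thing as a value at \<open>i\<close> together with a choice
  over \<open>I\<close>.\<close>

lemma finprod_finsum:
  assumes "finite I" "finite S" "\<And>i s. i \<in> I \<Longrightarrow> s \<in> S \<Longrightarrow> g i s \<in> carrier R"
  shows "(\<Otimes>i\<in>I. \<Oplus>s\<in>S. g i s) = (\<Oplus>\<psi>\<in>I \<rightarrow>\<^sub>E S. \<Otimes>i\<in>I. g i (\<psi> i))"
  using assms(1,3)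
proof (induction I rule: finite_induct)
  case empty
  then show ?case by simp
next
  case (insert i I)
  let ?P = "\<lambda>\<psi>. \<Otimes>i\<in>I. g i (\<psi> i)"
  have P: "?P \<psi> \<in> carrier R" if "\<psi> \<in> I \<rightarrow>\<^sub>E S" for \<psi>
    using that insert.prems by (intro finprod_closed) auto
  have G: "g j (\<psi> j) \<in> carrier R" if "\<psi> \<in> I \<rightarrow>\<^sub>E S" "j \<in> I" for \<psi> j
    using insert.prems[of j "\<psi> j"] that by auto
  have fin: "finite (I \<rightarrow>\<^sub>E S)" using insert assms(2) by (intro finite_PiE) auto
  have "(\<Otimes>i\<in>insert i I. \<Oplus>s\<in>S. g i s) = (\<Oplus>s\<in>S. g i s) \<otimes> (\<Oplus>\<psi>\<in>I \<rightarrow>\<^sub>E S. ?P \<psi>)"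
    using insert by (subst finprod_insert) (auto simp: Pi_def)
  also have "\<dots> = (\<Oplus>s\<in>S. \<Oplus>\<psi>\<in>I \<rightarrow>\<^sub>E S. g i s \<otimes> ?P \<psi>)"
    using P insert.prems fin assms(2)
    by (subst finsum_ldistr) (auto intro!: finsum_cong' finsum_rdistr)
  also have "\<dots> = (\<Oplus>p\<in>S \<times> (I \<rightarrow>\<^sub>E S). g i (fst p) \<otimes> ?P (snd p))"
    using P insert.prems fin assms(2) by (intro finsum_Times[of S _ "\<lambda>s \<psi>. g i s \<otimes> ?P \<psi>"]) auto
  also have "\<dots> = (\<Oplus>p\<in>S \<times> (I \<rightarrow>\<^sub>E S). \<Otimes>j\<in>insert i I. g j (((\<lambda>(y, g). g(i := y)) p) j))"
  proof (rule finsum_cong')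
    fix p assume p: "p \<in> S \<times> (I \<rightarrow>\<^sub>E S)"
    obtain s \<psi> where p': "p = (s, \<psi>)" by force
    have "?P \<psi> = (\<Otimes>j\<in>I. g j ((\<psi>(i := s)) j))"
      using p p' insert G by (intro finprod_cong') auto
    moreover have "(\<Otimes>j\<in>insert i I. g j ((\<psi>(i := s)) j))
        = g i ((\<psi>(i := s)) i) \<otimes> (\<Otimes>j\<in>I. g j ((\<psi>(i := s)) j))"
      using p p' insert G by (intro finprod_insert) auto
    ultimately show "g i (fst p) \<otimes> ?P (snd p)
        = (\<Otimes>j\<in>insert i I. g j (((\<lambda>(y, g). g(i := y)) p) j))"
      by (simp add: p')
  qed (use insert.prems G in \<open>auto intro!: finprod_closed\<close>)
  also have "\<dots> = (\<Oplus>\<psi>\<in>(\<lambda>(y, g). g(i := y)) ` (S \<times> (I \<rightarrow>\<^sub>E S)). \<Otimes>j\<in>insert i I. g j (\<psi> j))"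
    using insert.prems G inj_combinator[OF insert.hyps(2), of "\<lambda>_. S"]
    by (intro finsum_reindex[symmetric]) (auto intro!: finprod_closed)
  also have "(\<lambda>(y, g). g(i := y)) ` (S \<times> (I \<rightarrow>\<^sub>E S)) = insert i I \<rightarrow>\<^sub>E S"
    by (simp add: PiE_insert_eq)
  finally show ?case .
qed

abbreviation sign_of :: "(nat \<Rightarrow> nat) \<Rightarrow> 'a" where
  "sign_of \<sigma> \<equiv> (if evenperm \<sigma> then \<one> else \<ominus> \<one>)"

end

lemma (in comm_monoid) finprod_permute:
  assumes "\<sigma> permutes I" "f \<in> I \<rightarrow> carrier G"
  shows "(\<Otimes>i\<in>I. f (\<sigma> i)) = (\<Otimes>i\<in>I. f i)"
  using finprod_reindex[of f \<sigma> I] assms by (simp add: permutes_image permutes_inj_on)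

locale cring_det = cring R for R :: "'a ring" (structure)
begin

text \<open>Turning the case distinction on the parity into a factor \<open>\<one>\<close> or
  \<open>\<ominus> \<one>\<close> makes every summand a product, so that distributivity applies
  uniformly.\<close>

lemma det_ring_alt:
  assumes "\<And>i j. i < l \<Longrightarrow> j < l \<Longrightarrow> a i j \<in> carrier R"
  shows "det_ring R l a = (\<Oplus>\<sigma>\<in>perms l. sign_of \<sigma> \<otimes> (\<Otimes>i\<in>{..<l}. a i (\<sigma> i)))"
proof -
  have "(\<Otimes>i\<in>{..<l}. a i (\<sigma> i)) \<in> carrier R" if "\<sigma> permutes {..<l}" for \<sigma>
    using that assms perm_lt by (intro finprod_closed) auto
  then show ?thesis unfolding det_ring_def
    by (intro finsum_cong') (auto simp: Let_def l_minus)
qed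

lemma det_closed:
  assumes "\<And>i j. i < l \<Longrightarrow> j < l \<Longrightarrow> a i j \<in> carrier R"
  shows "det_ring R l a \<in> carrier R"
proof -
  have "(\<Otimes>i\<in>{..<l}. a i (\<sigma> i)) \<in> carrier R" if "\<sigma> permutes {..<l}" for \<sigma>
    using that assms perm_lt by (intro finprod_closed) auto
  then show ?thesis using assms by (subst det_ring_alt) (auto intro!: finsum_closed m_closed)
qed

lemma det_cong:
  assumes "\<And>i j. i < l \<Longrightarrow> j < l \<Longrightarrow> a i j = b i j" "\<And>i j. i < l \<Longrightarrow> j < l \<Longrightarrow> b i j \<in> carrier R"
  shows "det_ring R l a = det_ring R l b"
proof -
  have "(\<Otimes>i\<in>{..<l}. a i (\<sigma> i)) = (\<Otimes>i\<in>{..<l}. b i (\<sigma> i))" if "\<sigma> permutes {..<l}" for \<sigma>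
    using that assms perm_lt by (intro finprod_cong') auto
  moreover have "(\<Otimes>i\<in>{..<l}. b i (\<sigma> i)) \<in> carrier R" if "\<sigma> permutes {..<l}" for \<sigma>
    using that assms perm_lt by (intro finprod_closed) auto
  ultimately show ?thesis using assms
    by (simp add: det_ring_alt) (intro finsum_cong', auto)
qed

text \<open>Each row contributes one sum over \<open>S\<close>; after distributing,
  \<open>\<psi> i\<close> is the summand picked in row \<open>i\<close>. Both results on
  determinants of products start from this double sum.\<close>

lemma det_expand:
  assumes fin: "finite S"
    and a: "\<And>i s. i < l \<Longrightarrow> s \<in> S \<Longrightarrow> a i s \<in> carrier R"
    and b: "\<And>s j. s \<in> S \<Longrightarrow> j < l \<Longrightarrow> b s j \<in> carrier R"
  shows "det_ring R l (\<lambda>i j. \<Oplus>s\<in>S. a i s \<otimes> b s j)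
    = (\<Oplus>\<sigma>\<in>perms l. \<Oplus>\<psi>\<in>{..<l} \<rightarrow>\<^sub>E S.
         sign_of \<sigma> \<otimes> ((\<Otimes>i\<in>{..<l}. a i (\<psi> i)) \<otimes> (\<Otimes>i\<in>{..<l}. b (\<psi> i) (\<sigma> i))))"
proof -
  have a1: "a i (\<psi> i) \<in> carrier R" if "\<psi> \<in> {..<l} \<rightarrow>\<^sub>E S" "i < l" for \<psi> i
    using a[of i "\<psi> i"] that by auto
  have b1: "b (\<psi> i) j \<in> carrier R" if "\<psi> \<in> {..<l} \<rightarrow>\<^sub>E S" "i < l" "j < l" for \<psi> i j
    using b[of "\<psi> i" j] that by auto
  have finE: "finite ({..<l} \<rightarrow>\<^sub>E S)" using fin by (intro finite_PiE) auto
  have "sign_of \<sigma> \<otimes> (\<Otimes>i\<in>{..<l}. \<Oplus>s\<in>S. a i s \<otimes> b s (\<sigma> i)) = (\<Oplus>\<psi>\<in>{..<l} \<rightarrow>\<^sub>E S.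
         sign_of \<sigma> \<otimes> ((\<Otimes>i\<in>{..<l}. a i (\<psi> i)) \<otimes> (\<Otimes>i\<in>{..<l}. b (\<psi> i) (\<sigma> i))))"
    if \<sigma>: "\<sigma> permutes {..<l}" for \<sigma>
  proof -
    have "(\<Otimes>i\<in>{..<l}. \<Oplus>s\<in>S. a i s \<otimes> b s (\<sigma> i))
        = (\<Oplus>\<psi>\<in>{..<l} \<rightarrow>\<^sub>E S. \<Otimes>i\<in>{..<l}. a i (\<psi> i) \<otimes> b (\<psi> i) (\<sigma> i))"
      using a b fin perm_lt[OF \<sigma>] by (intro finprod_finsum) auto
    also have "\<dots> = (\<Oplus>\<psi>\<in>{..<l} \<rightarrow>\<^sub>E S. (\<Otimes>i\<in>{..<l}. a i (\<psi> i)) \<otimes> (\<Otimes>i\<in>{..<l}. b (\<psi> i) (\<sigma> i)))"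
      using a1 b1 perm_lt[OF \<sigma>]
      by (intro finsum_cong') (auto intro!: finprod_multf finprod_closed m_closed)
    finally show ?thesis
      using a1 b1 perm_lt[OF \<sigma>] finE by (simp only:)
        (intro finsum_rdistr, auto intro!: finprod_closed m_closed)
  qed
  moreover have "(\<Oplus>s\<in>S. a i s \<otimes> b s j) \<in> carrier R" if "i < l" "j < l" for i j
    using a b that by (intro finsum_closed) auto
  ultimately show ?thesis
    using a1 b1 perm_lt
    by (subst det_ring_alt) (auto intro!: finsum_cong' finsum_closed m_closed finprod_closed)
qed

text \<open>Summing over the permutations before the choices lets the factors
  \<open>a i (\<psi> i)\<close> leave the determinant. This is the Cauchy-Binet expansion before
  terms are grouped: \<open>\<psi>\<close> ranges over all maps, including those that repeat a row
  of \<open>b\<close>.\<close>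

lemma det_mult_rows:
  assumes fin: "finite S"
    and a: "\<And>i s. i < l \<Longrightarrow> s \<in> S \<Longrightarrow> a i s \<in> carrier R"
    and b: "\<And>s j. s \<in> S \<Longrightarrow> j < l \<Longrightarrow> b s j \<in> carrier R"
  shows "det_ring R l (\<lambda>i j. \<Oplus>s\<in>S. a i s \<otimes> b s j)
    = (\<Oplus>\<psi>\<in>{..<l} \<rightarrow>\<^sub>E S. (\<Otimes>i\<in>{..<l}. a i (\<psi> i)) \<otimes> det_ring R l (\<lambda>i j. b (\<psi> i) j))"
proof -
  let ?t = "\<lambda>\<sigma> \<psi>. sign_of \<sigma> \<otimes> ((\<Otimes>i\<in>{..<l}. a i (\<psi> i)) \<otimes> (\<Otimes>i\<in>{..<l}. b (\<psi> i) (\<sigma> i)))"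
  have finE: "finite ({..<l} \<rightarrow>\<^sub>E S)" using fin by (intro finite_PiE) auto
  have A: "(\<Otimes>i\<in>{..<l}. a i (\<psi> i)) \<in> carrier R" if "\<psi> \<in> {..<l} \<rightarrow>\<^sub>E S" for \<psi>
    using that a by (intro finprod_closed) auto
  have B: "(\<Otimes>i\<in>{..<l}. b (\<psi> i) (\<sigma> i)) \<in> carrier R" if "\<psi> \<in> {..<l} \<rightarrow>\<^sub>E S" "\<sigma> permutes {..<l}" for \<psi> \<sigma>
    using that b perm_lt[OF that(2)] by (intro finprod_closed) auto
  have fac: "(\<Oplus>\<sigma>\<in>perms l. ?t \<sigma> \<psi>)
    = (\<Otimes>i\<in>{..<l}. a i (\<psi> i)) \<otimes> det_ring R l (\<lambda>i j. b (\<psi> i) j)"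
    if \<psi>: "\<psi> \<in> {..<l} \<rightarrow>\<^sub>E S" for \<psi>
  proof -
    have "det_ring R l (\<lambda>i j. b (\<psi> i) j)
        = (\<Oplus>\<sigma>\<in>perms l. sign_of \<sigma> \<otimes> (\<Otimes>i\<in>{..<l}. b (\<psi> i) (\<sigma> i)))"
      using \<psi> b by (intro det_ring_alt) auto
    then have "(\<Otimes>i\<in>{..<l}. a i (\<psi> i)) \<otimes> det_ring R l (\<lambda>i j. b (\<psi> i) j)
       = (\<Oplus>\<sigma>\<in>perms l.
            (\<Otimes>i\<in>{..<l}. a i (\<psi> i)) \<otimes> (sign_of \<sigma> \<otimes> (\<Otimes>i\<in>{..<l}. b (\<psi> i) (\<sigma> i))))"
      using A[OF \<psi>] B[OF \<psi>] finite_perms by (simp only:) (intro finsum_rdistr, auto)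
    also have "\<dots> = (\<Oplus>\<sigma>\<in>perms l. ?t \<sigma> \<psi>)"
      using A[OF \<psi>] B[OF \<psi>] by (intro finsum_cong' m_lcomm) auto
    finally show ?thesis ..
  qed
  have "det_ring R l (\<lambda>i j. \<Oplus>s\<in>S. a i s \<otimes> b s j) = (\<Oplus>\<sigma>\<in>perms l. \<Oplus>\<psi>\<in>{..<l} \<rightarrow>\<^sub>E S. ?t \<sigma> \<psi>)"
    using assms by (rule det_expand)
  also have "\<dots> = (\<Oplus>\<psi>\<in>{..<l} \<rightarrow>\<^sub>E S. \<Oplus>\<sigma>\<in>perms l. ?t \<sigma> \<psi>)"
    using A B finE finite_perms by (intro finsum_swap) auto
  also have "\<dots> = (\<Oplus>\<psi>\<in>{..<l} \<rightarrow>\<^sub>E S. (\<Otimes>i\<in>{..<l}. a i (\<psi> i)) \<otimes> det_ring R l (\<lambda>i j. b (\<psi> i) j))"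
  proof (rule finsum_cong')
    have "det_ring R l (\<lambda>i j. b (\<psi> i) j) \<in> carrier R" if "\<psi> \<in> {..<l} \<rightarrow>\<^sub>E S" for \<psi>
      using that b by (intro det_closed) auto
    then show "(\<lambda>\<psi>. (\<Otimes>i\<in>{..<l}. a i (\<psi> i)) \<otimes> det_ring R l (\<lambda>i j. b (\<psi> i) j))
        \<in> ({..<l} \<rightarrow>\<^sub>E S) \<rightarrow> carrier R"
      using A by auto
  qed (simp_all add: fac)
  finally show ?thesis .
qed

text \<open>Reindex by the inverse permutation: it has the same parity, and its product consists of
  the same factors in another order.\<close>

lemma det_transpose:
  assumes a: "\<And>i j. i < l \<Longrightarrow> j < l \<Longrightarrow> a i j \<in> carrier R"
  shows "det_ring R l (\<lambda>i j. a j i) = det_ring R l a"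
proof -
  let ?inv = "inv_into UNIV :: (nat \<Rightarrow> nat) \<Rightarrow> _"
  have eq: "sign_of \<sigma> \<otimes> (\<Otimes>i\<in>{..<l}. a (\<sigma> i) i)
      = sign_of (?inv \<sigma>) \<otimes> (\<Otimes>i\<in>{..<l}. a i (?inv \<sigma> i))" if \<sigma>: "\<sigma> permutes {..<l}" for \<sigma>
  proof -
    have "(\<Otimes>i\<in>{..<l}. a (\<sigma> i) i) = (\<Otimes>i\<in>{..<l}. a (\<sigma> i) (?inv \<sigma> (\<sigma> i)))"
      using permutes_inverses(2)[OF \<sigma>] by simp
    also have "\<dots> = (\<Otimes>i\<in>{..<l}. a i (?inv \<sigma> i))"
      by (rule finprod_permute[OF \<sigma>, of "\<lambda>i. a i (?inv \<sigma> i)"])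
        (use a perm_lt[OF permutes_inv[OF \<sigma>]] in auto)
    finally show ?thesis
      using evenperm_inv[of \<sigma>] \<sigma> permutation_permutes[of \<sigma>] by auto
  qed
  have P: "(\<Otimes>i\<in>{..<l}. a i (\<sigma> i)) \<in> carrier R" if "\<sigma> permutes {..<l}" for \<sigma>
    using a perm_lt[OF that] by (intro finprod_closed) auto
  have inj: "inj_on ?inv (perms l)"
    by (rule inj_on_inverseI[of _ ?inv]) (auto simp: permutes_bij inv_inv_eq)
  have "det_ring R l (\<lambda>i j. a j i)
      = (\<Oplus>\<sigma>\<in>perms l. sign_of (?inv \<sigma>) \<otimes> (\<Otimes>i\<in>{..<l}. a i (?inv \<sigma> i)))"
    using a by (subst det_ring_alt) (auto simp: eq P permutes_inv intro!: finsum_cong')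
  also have "\<dots> = (\<Oplus>\<sigma>\<in>?inv ` perms l. sign_of \<sigma> \<otimes> (\<Otimes>i\<in>{..<l}. a i (\<sigma> i)))"
    by (rule finsum_reindex[OF _ inj, symmetric]) (auto simp: P permutes_inv)
  also have "?inv ` perms l = perms l"
    by (rule card_subset_eq[OF finite_perms _ card_image[OF inj]]) (auto simp: permutes_inv)
  finally show ?thesis using a by (simp add: det_ring_alt)
qed

text \<open>The transposed form of the row expansion. It leaves minors on columns of
  \<open>a\<close>, which is the shape of a Plucker coordinate.\<close>

lemma det_mult_cols:
  assumes fin: "finite S"
    and a: "\<And>i s. i < l \<Longrightarrow> s \<in> S \<Longrightarrow> a i s \<in> carrier R"
    and b: "\<And>s j. s \<in> S \<Longrightarrow> j < l \<Longrightarrow> b s j \<in> carrier R"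
  shows "det_ring R l (\<lambda>i j. \<Oplus>s\<in>S. a i s \<otimes> b s j)
    = (\<Oplus>\<phi>\<in>{..<l} \<rightarrow>\<^sub>E S. (\<Otimes>j\<in>{..<l}. b (\<phi> j) j) \<otimes> det_ring R l (\<lambda>i j. a i (\<phi> j)))"
proof -
  have "det_ring R l (\<lambda>i j. \<Oplus>s\<in>S. a i s \<otimes> b s j) = det_ring R l (\<lambda>j i. \<Oplus>s\<in>S. a i s \<otimes> b s j)"
    using a b by (intro det_transpose[symmetric] finsum_closed) auto
  also have "\<dots> = det_ring R l (\<lambda>j i. \<Oplus>s\<in>S. b s j \<otimes> a i s)"
    using a b by (intro det_cong finsum_cong' finsum_closed) (auto simp: m_comm)
  also have "\<dots> = (\<Oplus>\<phi>\<in>{..<l} \<rightarrow>\<^sub>E S. (\<Otimes>j\<in>{..<l}. b (\<phi> j) j) \<otimes> det_ring R l (\<lambda>j i. a i (\<phi> j)))"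
    using fin by (rule det_mult_rows[where a = "\<lambda>j s. b s j" and b = "\<lambda>s i. a i s"]) (use a b in auto)
  also have "\<dots> = (\<Oplus>\<phi>\<in>{..<l} \<rightarrow>\<^sub>E S. (\<Otimes>j\<in>{..<l}. b (\<phi> j) j) \<otimes> det_ring R l (\<lambda>i j. a i (\<phi> j)))"
  proof (rule finsum_cong')
    fix \<phi> assume \<phi>: "\<phi> \<in> {..<l} \<rightarrow>\<^sub>E S"
    have "a i (\<phi> j) \<in> carrier R" if "i < l" "j < l" for i j using \<phi> that a by auto
    from det_transpose[of l "\<lambda>i j. a i (\<phi> j)", OF this]
    show "(\<Otimes>j\<in>{..<l}. b (\<phi> j) j) \<otimes> det_ring R l (\<lambda>j i. a i (\<phi> j))
        = (\<Otimes>j\<in>{..<l}. b (\<phi> j) j) \<otimes> det_ring R l (\<lambda>i j. a i (\<phi> j))" by simp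
  next
    have "(\<Otimes>j\<in>{..<l}. b (\<phi> j) j) \<in> carrier R" "det_ring R l (\<lambda>i j. a i (\<phi> j)) \<in> carrier R"
      if "\<phi> \<in> {..<l} \<rightarrow>\<^sub>E S" for \<phi>
      by (intro finprod_closed det_closed; use PiE_mem[OF that] a b in auto)+
    then show "(\<lambda>\<phi>. (\<Otimes>j\<in>{..<l}. b (\<phi> j) j) \<otimes> det_ring R l (\<lambda>i j. a i (\<phi> j)))
        \<in> ({..<l} \<rightarrow>\<^sub>E S) \<rightarrow> carrier R" by auto
  qed simp
  finally show ?thesis .
qed

text \<open>Composition with the transposition of \<open>p\<close> and \<open>q\<close> pairs even
  with odd permutations; paired terms have equal products and opposite signs. Cancelling in pairs,
  rather than showing that the determinant equals its negative, keeps the argument valid in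
  characteristic 2.\<close>

lemma det_equal_rows:
  assumes a: "\<And>i j. i < l \<Longrightarrow> j < l \<Longrightarrow> a i j \<in> carrier R"
    and pq: "p < l" "q < l" "p \<noteq> q" "\<And>j. j < l \<Longrightarrow> a p j = a q j"
  shows "det_ring R l a = \<zero>"
proof -
  let ?t = "transpose p q"
  let ?P = "\<lambda>\<sigma>. \<Otimes>i\<in>{..<l}. a i (\<sigma> i)"
  let ?ev = "{\<sigma>. \<sigma> permutes {..<l} \<and> evenperm \<sigma>}"
  let ?od = "{\<sigma>. \<sigma> permutes {..<l} \<and> \<not> evenperm \<sigma>}"
  have t: "?t permutes {..<l}" using pq by (intro permutes_swap_id) auto
  have P: "?P \<sigma> \<in> carrier R" if "\<sigma> permutes {..<l}" for \<sigma>
    using that a perm_lt[OF that] by (intro finprod_closed) auto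
  have flip: "evenperm (\<sigma> \<circ> ?t) \<longleftrightarrow> \<not> evenperm \<sigma>" if "\<sigma> permutes {..<l}" for \<sigma>
  proof -
    have "permutation \<sigma>" using that by (auto simp: permutation_permutes)
    then show ?thesis using pq(3) by (simp add: evenperm_comp permutation_swap_id evenperm_swap)
  qed
  have img: "?od = (\<lambda>\<sigma>. \<sigma> \<circ> ?t) ` ?ev"
  proof (intro equalityI subsetI)
    fix \<sigma> assume "\<sigma> \<in> ?od"
    moreover have "\<sigma> = (\<sigma> \<circ> ?t) \<circ> ?t" by (simp add: comp_assoc)
    ultimately show "\<sigma> \<in> (\<lambda>\<sigma>. \<sigma> \<circ> ?t) ` ?ev"
      using t flip by (intro image_eqI[where x = "\<sigma> \<circ> ?t"]) (auto intro: permutes_compose)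
  qed (use t flip in \<open>auto intro: permutes_compose\<close>)
  have inj: "inj_on (\<lambda>\<sigma>. \<sigma> \<circ> ?t) ?ev"
  proof (rule inj_onI)
    fix \<sigma> \<tau> :: "nat \<Rightarrow> nat" assume "\<sigma> \<circ> ?t = \<tau> \<circ> ?t"
    then have "\<sigma> \<circ> ?t \<circ> ?t = \<tau> \<circ> ?t \<circ> ?t" by simp
    then show "\<sigma> = \<tau>" by (simp add: comp_assoc)
  qed
  have same: "?P (\<sigma> \<circ> ?t) = ?P \<sigma>" if \<sigma>: "\<sigma> permutes {..<l}" for \<sigma>
  proof -
    \<comment> \<open>The entry in column \<open>\<sigma> (?t i)\<close> is read from row
      \<open>?t i\<close> instead of row \<open>i\<close>. Only the rows \<open>p\<close> and
      \<open>q\<close> are exchanged, and they agree.\<close>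
    have "?P (\<sigma> \<circ> ?t) = (\<Otimes>i\<in>{..<l}. a (?t i) (\<sigma> (?t i)))"
    proof (rule finprod_cong')
      fix i assume "i \<in> {..<l}"
      then show "a i ((\<sigma> \<circ> ?t) i) = a (?t i) (\<sigma> (?t i))"
        using pq perm_lt[OF \<sigma>] by (auto simp: transpose_def)
    qed (use a perm_lt[OF \<sigma>] perm_lt[OF t] in auto)
    also have "\<dots> = ?P \<sigma>"
      using a perm_lt[OF \<sigma>] by (intro finprod_permute[OF t, of "\<lambda>i. a i (\<sigma> i)"]) auto
    finally show ?thesis .
  qed
  have fin: "finite ?ev" "finite ?od"
    by (rule finite_subset[OF _ finite_perms[of l]], auto)+
  have split: "perms l = ?ev \<union> ?od" by auto
  have "det_ring R l a = (\<Oplus>\<sigma>\<in>?ev \<union> ?od. sign_of \<sigma> \<otimes> ?P \<sigma>)"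
    unfolding split[symmetric] using a by (rule det_ring_alt)
  also have "\<dots> = (\<Oplus>\<sigma>\<in>?ev. sign_of \<sigma> \<otimes> ?P \<sigma>) \<oplus> (\<Oplus>\<sigma>\<in>?od. sign_of \<sigma> \<otimes> ?P \<sigma>)"
    using P fin by (intro finsum_Un_disjoint) auto
  also have "(\<Oplus>\<sigma>\<in>?ev. sign_of \<sigma> \<otimes> ?P \<sigma>) = (\<Oplus>\<sigma>\<in>?ev. ?P \<sigma>)"
    by (rule finsum_cong') (use P in auto)
  also have "(\<Oplus>\<sigma>\<in>?od. sign_of \<sigma> \<otimes> ?P \<sigma>) = (\<Oplus>\<sigma>\<in>?od. \<ominus> \<one> \<otimes> ?P \<sigma>)"
    by (rule finsum_cong') (use P in auto)
  also have "\<dots> = \<ominus> \<one> \<otimes> (\<Oplus>\<sigma>\<in>?od. ?P \<sigma>)"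
    by (rule finsum_rdistr[symmetric]) (use P fin in auto)
  also have "(\<Oplus>\<sigma>\<in>?od. ?P \<sigma>) = (\<Oplus>\<sigma>\<in>?ev. ?P (\<sigma> \<circ> ?t))"
    unfolding img by (rule finsum_reindex[OF _ inj]) (use P t in \<open>auto intro: permutes_compose\<close>)
  also have "\<dots> = (\<Oplus>\<sigma>\<in>?ev. ?P \<sigma>)"
    by (rule finsum_cong') (use P same in auto)
  finally show ?thesis
    using P by (simp add: l_minus r_neg)
qed

lemma det_one: "det_ring R l (\<lambda>i j. if i = j then \<one> else \<zero>) = \<one>"
proof -
  let ?d = "\<lambda>i j :: nat. if i = j then \<one> else \<zero>"
  have "det_ring R l ?d = (\<Oplus>\<sigma>\<in>perms l. sign_of \<sigma> \<otimes> (\<Otimes>i\<in>{..<l}. ?d i (\<sigma> i)))"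
    by (rule det_ring_alt) auto
  also have "\<dots> = sign_of id \<otimes> (\<Otimes>i\<in>{..<l}. ?d i (id i))"
  proof (rule finsum_single)
    fix \<sigma> assume \<sigma>: "\<sigma> \<in> perms l" "\<sigma> \<noteq> id"
    then obtain i where i: "\<sigma> i \<noteq> i" by (auto simp: fun_eq_iff)
    then have "i < l" using \<sigma> by (metis lessThan_iff mem_Collect_eq permutes_not_in)
    then have "(\<Otimes>i\<in>{..<l}. ?d i (\<sigma> i)) = \<zero>"
      using i by (intro finprod_zero_factor[of _ i]) auto
    then show "sign_of \<sigma> \<otimes> (\<Otimes>i\<in>{..<l}. ?d i (\<sigma> i)) = \<zero>" by simp
  qed (auto simp: finite_perms permutes_id)
  finally show ?thesis by (simp add: evenperm_id)
qed

text \<open>Cramer's rule: replacing row \<open>p\<close> by the combination with coefficients \<open>f\<close>, which is zero,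
  multiplies the determinant by \<open>f p\<close>.\<close>

lemma row_combination_zero:
  assumes a: "\<And>i j. i < l \<Longrightarrow> j < l \<Longrightarrow> a i j \<in> carrier R"
    and f: "\<And>i. i < l \<Longrightarrow> f i \<in> carrier R"
    and zero: "\<And>j. j < l \<Longrightarrow> (\<Oplus>i\<in>{..<l}. f i \<otimes> a i j) = \<zero>"
    and p: "p < l"
  shows "f p \<otimes> det_ring R l a = \<zero>"
proof -
  let ?I = "{..<l}"
  \<comment> \<open>The identity matrix with row \<open>p\<close> replaced by \<open>f\<close>. Its
    product with \<open>a\<close> has a zero row \<open>p\<close>, while its own diagonal product is
    \<open>f p\<close>.\<close>
  define c where "c = (\<lambda>i s. if i = p then f s else if i = s then \<one> else \<zero>)"
  have c: "c i s \<in> carrier R" if "s < l" for i s using f that by (auto simp: c_def)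
  let ?t = "\<lambda>\<psi>. (\<Otimes>i\<in>?I. c i (\<psi> i)) \<otimes> det_ring R l (\<lambda>i j. a (\<psi> i) j)"
  let ?id = "\<lambda>i\<in>?I. i"
  have "det_ring R l (\<lambda>i j. \<Oplus>s\<in>?I. c i s \<otimes> a s j) = \<zero>"
  proof -
    have cl: "(\<Oplus>s\<in>?I. c i s \<otimes> a s j) \<in> carrier R" if "j < l" for i j
      using a c that by (intro finsum_closed) auto
    have zp: "(\<Oplus>s\<in>?I. c p s \<otimes> a s j) = \<zero>" if "j < l" for j
      using zero[OF that] by (simp add: c_def)
    have "(\<Otimes>i\<in>?I. \<Oplus>s\<in>?I. c i s \<otimes> a s (\<sigma> i)) = \<zero>" if "\<sigma> permutes ?I" for \<sigma>
      using cl perm_lt[OF that] p by (intro finprod_zero_factor[of _ p] zp) auto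
    then show ?thesis
      using cl by (subst det_ring_alt) (auto intro!: add.finprod_one_eqI)
  qed
  moreover have "det_ring R l (\<lambda>i j. \<Oplus>s\<in>?I. c i s \<otimes> a s j) = (\<Oplus>\<psi>\<in>?I \<rightarrow>\<^sub>E ?I. ?t \<psi>)"
    using a c by (intro det_mult_rows) auto
  \<comment> \<open>Only the identity choice survives. A choice that moves some \<open>i\<close>
    other than \<open>p\<close> meets a zero entry of \<open>c\<close>; one that moves
    \<open>p\<close> alone repeats a row of \<open>a\<close>.\<close>
  moreover have "(\<Oplus>\<psi>\<in>?I \<rightarrow>\<^sub>E ?I. ?t \<psi>) = ?t ?id"
  proof (rule finsum_single)
    show "finite (?I \<rightarrow>\<^sub>E ?I)" by (intro finite_PiE) auto
    show "?id \<in> ?I \<rightarrow>\<^sub>E ?I" by auto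
    show "?t ?id \<in> carrier R"
      using a c by (intro m_closed finprod_closed det_closed) auto
    fix \<psi> assume \<psi>: "\<psi> \<in> ?I \<rightarrow>\<^sub>E ?I" "\<psi> \<noteq> ?id"
    have lt: "\<psi> i < l" if "i < l" for i using \<psi>(1) that by auto
    have det: "det_ring R l (\<lambda>i j. a (\<psi> i) j) \<in> carrier R" using a lt by (intro det_closed) auto
    have prod: "(\<Otimes>i\<in>?I. c i (\<psi> i)) \<in> carrier R" using c lt by (intro finprod_closed) auto
    show "?t \<psi> = \<zero>"
    proof (cases "\<exists>i<l. i \<noteq> p \<and> \<psi> i \<noteq> i")
      case True
      then obtain i where i: "i < l" "i \<noteq> p" "\<psi> i \<noteq> i" by blast
      then have "(\<Otimes>i\<in>?I. c i (\<psi> i)) = \<zero>"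
        using c lt by (intro finprod_zero_factor[of _ i]) (auto simp: c_def)
      then show ?thesis using det by simp
    next
      case False
      then have fix_: "\<psi> i = i" if "i < l" "i \<noteq> p" for i using that by blast
      have "\<psi> p \<noteq> p"
      proof
        assume "\<psi> p = p"
        then have "\<psi> = ?id" using fix_ \<psi>(1) by (intro PiE_ext[of _ ?I "\<lambda>_. ?I"]) auto
        then show False using \<psi>(2) by simp
      qed
      then have "det_ring R l (\<lambda>i j. a (\<psi> i) j) = \<zero>"
        using a lt p fix_ by (intro det_equal_rows[of l _ p "\<psi> p"]) auto
      then show ?thesis using prod by simp
    qed
  qed
  moreover have "(\<Otimes>i\<in>?I. c i (?id i)) = f p"
  proof -
    have "(\<Otimes>i\<in>?I. c i (?id i)) = (\<Otimes>i\<in>?I. if p = i then f i else \<one>)"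
      using f by (intro finprod_cong') (auto simp: c_def)
    also have "\<dots> = f p" using f p by (intro finprod_singleton) auto
    finally show ?thesis .
  qed
  moreover have "det_ring R l (\<lambda>i j. a (?id i) j) = det_ring R l a"
    using a by (intro det_cong) auto
  ultimately show ?thesis by simp
qed

end

text \<open>Applied to restriction maps, to move determinants between open sets, and to the map from
  \<open>k\<close> to \<open>O(U0)\<close>, to recognize Plucker coordinates.\<close>

lemma ring_hom_det:
  fixes R :: "'a ring" and S :: "'b ring"
  assumes h: "h \<in> ring_hom R S" and RS: "cring R" "cring S"
    and a: "\<And>i j. i < l \<Longrightarrow> j < l \<Longrightarrow> a i j \<in> carrier R"
  shows "h (det_ring R l a) = det_ring S l (\<lambda>i j. h (a i j))"
proof -
  interpret ring_hom_cring R S h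
    using assms by (simp add: ring_hom_cring_def ring_hom_cring_axioms_def)
  interpret R: cring_det R by (simp add: cring_det_def RS)
  interpret S: cring_det S by (simp add: cring_det_def RS)
  have P: "(\<Otimes>\<^bsub>R\<^esub>i\<in>{..<l}. a i (\<sigma> i)) \<in> carrier R" if "\<sigma> permutes {..<l}" for \<sigma>
    using a perm_lt[OF that] by (intro R.finprod_closed) auto
  have hP: "h (\<Otimes>\<^bsub>R\<^esub>i\<in>{..<l}. a i (\<sigma> i)) = (\<Otimes>\<^bsub>S\<^esub>i\<in>{..<l}. h (a i (\<sigma> i)))"
    if "\<sigma> permutes {..<l}" for \<sigma>
    using a perm_lt[OF that] by (subst hom_finprod) (auto simp: comp_def)
  have "h (det_ring R l a)
      = h (\<Oplus>\<^bsub>R\<^esub>\<sigma>\<in>perms l. R.sign_of \<sigma> \<otimes>\<^bsub>R\<^esub> (\<Otimes>\<^bsub>R\<^esub>i\<in>{..<l}. a i (\<sigma> i)))"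
    using a by (subst R.det_ring_alt) auto
  also have "\<dots> = (\<Oplus>\<^bsub>S\<^esub>\<sigma>\<in>perms l.
      h (R.sign_of \<sigma> \<otimes>\<^bsub>R\<^esub> (\<Otimes>\<^bsub>R\<^esub>i\<in>{..<l}. a i (\<sigma> i))))"
    using P by (subst hom_finsum) (auto simp: comp_def)
  also have "\<dots> = (\<Oplus>\<^bsub>S\<^esub>\<sigma>\<in>perms l.
      S.sign_of \<sigma> \<otimes>\<^bsub>S\<^esub> (\<Otimes>\<^bsub>S\<^esub>i\<in>{..<l}. h (a i (\<sigma> i))))"
  proof (rule S.finsum_cong')
    show "(\<lambda>\<sigma>. S.sign_of \<sigma> \<otimes>\<^bsub>S\<^esub> (\<Otimes>\<^bsub>S\<^esub>i\<in>{..<l}. h (a i (\<sigma> i)))) \<in> perms l \<rightarrow> carrier S"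
      using P by (auto simp flip: hP)
  qed (use P hP in auto)
  also have "\<dots> = det_ring S l (\<lambda>i j. h (a i j))"
    using a by (subst S.det_ring_alt) auto
  finally show ?thesis .
qed

section \<open>Tensor products\<close>

text \<open>Expand \<open>c\<close> in the generators and apply \<open>h\<close>. The right-hand
  side has the shape in which \<open>tensor_lift\<close> evaluates a representative, so that formula
  can be identified with a homomorphism on the free group.\<close>

lemma (in comm_group) hom_free_Abelian_group_eq:
  assumes f: "h \<in> hom (free_Abelian_group S) G" and c: "Poly_Mapping.keys c \<subseteq> S"
  shows "h c = (\<Otimes>z\<in>Poly_Mapping.keys c. h (frag_of z) [^] Poly_Mapping.lookup c z)"
proof -
  let ?F = "free_Abelian_group S"
  interpret h: group_hom ?F G h
    by (simp add: group_hom_def group_hom_axioms_def f)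
  have "h (\<Sum>z\<in>A. frag_cmul (n z) (frag_of z)) = (\<Otimes>z\<in>A. h (frag_of z) [^] n z)
      \<and> Poly_Mapping.keys (\<Sum>z\<in>A. frag_cmul (n z) (frag_of z)) \<subseteq> S"
    if "finite A" "A \<subseteq> S" for A n
    using that
  proof (induction A rule: finite_induct)
    case empty
    show ?case using h.hom_one by simp
  next
    case (insert x A)
    let ?s = "\<Sum>z\<in>A. frag_cmul (n z) (frag_of z)"
    have x: "Poly_Mapping.keys (frag_of x) \<subseteq> S" using insert by simp
    have cm: "Poly_Mapping.keys (frag_cmul (n x) (frag_of x)) \<subseteq> S"
      by (rule order_trans[OF keys_cmul x])
    have hx: "h (frag_cmul (n x) (frag_of x)) = h (frag_of x) [^] n x"
      using h.hom_int_pow[of "frag_of x" "n x"] x by simp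
    have s: "h ?s = (\<Otimes>z\<in>A. h (frag_of z) [^] n z)" "Poly_Mapping.keys ?s \<subseteq> S"
      using insert by auto
    have "h (frag_cmul (n x) (frag_of x) + ?s) = h (frag_cmul (n x) (frag_of x)) \<otimes> h ?s"
      using h.hom_mult[of "frag_cmul (n x) (frag_of x)" ?s] cm s(2) by simp
    moreover have "h (frag_of z) \<in> carrier G" if "z \<in> S" for z
      using that by (intro h.hom_closed) simp
    moreover have "Poly_Mapping.keys (frag_cmul (n x) (frag_of x) + ?s) \<subseteq> S"
      by (rule order_trans[OF keys_add Un_least[OF cm s(2)]])
    moreover from this have "(\<Otimes>z\<in>insert x A. h (frag_of z) [^] n z)
        = h (frag_of x) [^] n x \<otimes> (\<Otimes>z\<in>A. h (frag_of z) [^] n z)"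
      using insert.hyps insert.prems by (intro finprod_insert) (auto simp: subset_iff)
    ultimately show ?case using insert.hyps hx s by simp
  qed
  note * = this
  have sum: "(\<Sum>z\<in>Poly_Mapping.keys c. frag_cmul (Poly_Mapping.lookup c z) (frag_of z)) = c"
    using frag_expansion[of c, symmetric] unfolding frag_extend_def .
  show ?thesis using *[of "Poly_Mapping.keys c" "Poly_Mapping.lookup c"] c unfolding sum by simp
qed

text \<open>Between monoids, preservation of the unit has to be a premise of its own. It settles the
  empty product and also products over infinite sets, which are the unit by convention.\<close>

lemma hom_finprod:
  assumes "comm_monoid G" "comm_monoid H" "h \<in> hom G H" "h \<one>\<^bsub>G\<^esub> = \<one>\<^bsub>H\<^esub>" "f \<in> A \<rightarrow> carrier G"
  shows "h (finprod G f A) = finprod H (\<lambda>i. h (f i)) A"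
proof -
  interpret G: comm_monoid G by fact
  interpret H: comm_monoid H by fact
  show ?thesis using assms(5)
  proof (induction A rule: infinite_finite_induct)
    case (insert x A)
    then have "h (finprod G f (insert x A)) = h (f x) \<otimes>\<^bsub>H\<^esub> h (finprod G f A)"
      using assms(3) by (simp add: Pi_def hom_mult)
    also have "\<dots> = finprod H (\<lambda>i. h (f i)) (insert x A)"
      using insert assms(3) by (subst H.finprod_insert) (auto simp: Pi_def hom_in_carrier)
    finally show ?case .
  qed (simp_all add: assms(4))
qed

text \<open>Meant for restriction maps, coordinate functions and maps
  \<open>a \<mapsto> a v\<close>, which are available as additive functions between records and not
  as group homomorphisms.\<close>

lemma finsum_additive:
  assumes "abelian_group G" "abelian_group H"
    and "\<And>x. x \<in> carrier G \<Longrightarrow> h x \<in> carrier H"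
    and "\<And>x y. x \<in> carrier G \<Longrightarrow> y \<in> carrier G \<Longrightarrow> h (x \<oplus>\<^bsub>G\<^esub> y) = h x \<oplus>\<^bsub>H\<^esub> h y"
    and "f \<in> A \<rightarrow> carrier G"
  shows "h (finsum G f A) = finsum H (\<lambda>i. h (f i)) A"
proof -
  interpret G: abelian_group G by fact
  interpret H: abelian_group H by fact
  have hom: "h \<in> hom (add_monoid G) (add_monoid H)"
    using assms(3,4) by (auto simp: hom_def)
  moreover have "h \<one>\<^bsub>add_monoid G\<^esub> = \<one>\<^bsub>add_monoid H\<^esub>"
    by (rule hom_one[OF hom G.a_group H.a_group])
  ultimately show ?thesis
    using hom_finprod[OF G.a_comm_monoid H.a_comm_monoid, of h f A] assms(5)
    by (simp add: finsum_def)
qed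

section \<open>The universal property of the tensor product\<close>

locale tensor_modules = V: Module.module k V + M: Module.module k M
  for k :: "'k ring" and V :: "('k, 'v) module" and M :: "('k, 'w) module"
begin

abbreviation "F \<equiv> free_Abelian_group (carrier V \<times> carrier M)"
abbreviation "K \<equiv> tensor_kernel k V M"
abbreviation "T \<equiv> tensor_group k V M"
abbreviation "pure \<equiv> pure_tensor k V M"

sublocale F: comm_group F by (rule abelian_free_Abelian_group)

lemma diff_F: "x \<in> carrier F \<Longrightarrow> y \<in> carrier F \<Longrightarrow> x - y \<in> carrier F"
  using keys_diff[of x y] by auto

lemma relations_subset: "tensor_relations k V M \<subseteq> carrier F"
  unfolding tensor_relations_def
  by (auto simp del: carrier_free_Abelian_group_iff intro!: diff_F simp: frag_of_in_free_Abelian_group)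

lemma kernel_subgroup: "subgroup K F"
  unfolding tensor_kernel_def by (rule F.generate_is_subgroup[OF relations_subset])

sublocale N: normal K F
  by (rule F.subgroup_imp_normal[OF kernel_subgroup])

lemma T_eq: "T = F Mod K"
  by (simp add: tensor_group_def)

sublocale T: comm_group T
  unfolding T_eq by (rule F.abelian_FactGroup[OF kernel_subgroup])

lemma coset_mult:
  "x \<in> carrier F \<Longrightarrow> y \<in> carrier F \<Longrightarrow> (K #>\<^bsub>F\<^esub> x) \<otimes>\<^bsub>T\<^esub> (K #>\<^bsub>F\<^esub> y) = K #>\<^bsub>F\<^esub> (x + y)"
  using N.rcos_sum[of x y] by (simp add: T_eq)

lemma coset_hom: "(\<lambda>x. K #>\<^bsub>F\<^esub> x) \<in> hom F T"
  using N.r_coset_hom_Mod by (simp add: T_eq)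

lemma coset_eq:
  assumes "x \<in> carrier F" "y \<in> carrier F" "x - y \<in> tensor_relations k V M"
  shows "K #>\<^bsub>F\<^esub> x = K #>\<^bsub>F\<^esub> y"
proof -
  have "x - y \<in> K" unfolding tensor_kernel_def by (rule generate.incl[OF assms(3)])
  then have "(x - y) + y \<in> K #>\<^bsub>F\<^esub> y"
    using r_coset_def[of F K y] by fastforce
  then show ?thesis
    using F.repr_independence[of x K y] kernel_subgroup assms by simp
qed

lemma pure_closed: "v \<in> carrier V \<Longrightarrow> m \<in> carrier M \<Longrightarrow> pure v m \<in> carrier T"
  unfolding pure_tensor_def by (rule hom_in_carrier[OF coset_hom]) simp

lemma pure_add_left:
  assumes "v \<in> carrier V" "v' \<in> carrier V" "m \<in> carrier M"
  shows "pure (v \<oplus>\<^bsub>V\<^esub> v') m = pure v m \<otimes>\<^bsub>T\<^esub> pure v' m"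
proof -
  have "K #>\<^bsub>F\<^esub> frag_of (v \<oplus>\<^bsub>V\<^esub> v', m) = K #>\<^bsub>F\<^esub> (frag_of (v, m) + frag_of (v', m))"
  proof (rule coset_eq)
    show "frag_of (v, m) + frag_of (v', m) \<in> carrier F"
      using F.m_closed[of "frag_of (v, m)" "frag_of (v', m)"] assms by simp
    show "frag_of (v \<oplus>\<^bsub>V\<^esub> v', m) - (frag_of (v, m) + frag_of (v', m)) \<in> tensor_relations k V M"
      using assms unfolding tensor_relations_def by (auto simp: diff_diff_eq)
  qed (use assms in simp)
  then show ?thesis using assms unfolding pure_tensor_def by (subst coset_mult) simp_all
qed

lemma pure_add_right:
  assumes "v \<in> carrier V" "m \<in> carrier M" "m' \<in> carrier M"
  shows "pure v (m \<oplus>\<^bsub>M\<^esub> m') = pure v m \<otimes>\<^bsub>T\<^esub> pure v m'"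
proof -
  have "K #>\<^bsub>F\<^esub> frag_of (v, m \<oplus>\<^bsub>M\<^esub> m') = K #>\<^bsub>F\<^esub> (frag_of (v, m) + frag_of (v, m'))"
  proof (rule coset_eq)
    show "frag_of (v, m) + frag_of (v, m') \<in> carrier F"
      using F.m_closed[of "frag_of (v, m)" "frag_of (v, m')"] assms by simp
    show "frag_of (v, m \<oplus>\<^bsub>M\<^esub> m') - (frag_of (v, m) + frag_of (v, m')) \<in> tensor_relations k V M"
      using assms unfolding tensor_relations_def by (auto simp: diff_diff_eq)
  qed (use assms in simp)
  then show ?thesis using assms unfolding pure_tensor_def by (subst coset_mult) simp_all
qed

lemma pure_balanced:
  assumes "a \<in> carrier k" "v \<in> carrier V" "m \<in> carrier M"
  shows "pure (a \<odot>\<^bsub>V\<^esub> v) m = pure v (a \<odot>\<^bsub>M\<^esub> m)"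
  using assms unfolding pure_tensor_def tensor_relations_def[of k V M]
  by (intro coset_eq) (auto simp: tensor_relations_def)

text \<open>Pure tensors generate the group. The single closure condition on \<open>x\<close> times
  the inverse of \<open>y\<close> covers products and inverses together and matches the induction by
  differences on the free abelian group.\<close>

lemma tensor_induct [consumes 1, case_names one pure mult_inv]:
  assumes x: "x \<in> carrier T"
    and one: "P \<one>\<^bsub>T\<^esub>"
    and pure: "\<And>v m. v \<in> carrier V \<Longrightarrow> m \<in> carrier M \<Longrightarrow> P (pure v m)"
    and mult_inv: "\<And>x y. x \<in> carrier T \<Longrightarrow> y \<in> carrier T \<Longrightarrow> P x \<Longrightarrow> P y \<Longrightarrow> P (x \<otimes>\<^bsub>T\<^esub> inv\<^bsub>T\<^esub> y)"
  shows "P x"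
proof -
  interpret q: group_hom F T "\<lambda>x. K #>\<^bsub>F\<^esub> x"
    by (simp add: group_hom_def group_hom_axioms_def coset_hom)
  obtain c where c: "Poly_Mapping.keys c \<subseteq> carrier V \<times> carrier M" "x = K #>\<^bsub>F\<^esub> c"
    using x by (auto simp: T_eq carrier_FactGroup)
  have "P (K #>\<^bsub>F\<^esub> c)"
  proof (rule free_Abelian_group_induct[OF c(1), of "\<lambda>c. P (K #>\<^bsub>F\<^esub> c)"])
    show "P (K #>\<^bsub>F\<^esub> 0)" using one q.hom_one by simp
  next
    fix x y :: "('v \<times> 'w) \<Rightarrow>\<^sub>0 int"
    assume *: "Poly_Mapping.keys x \<subseteq> carrier V \<times> carrier M" "Poly_Mapping.keys y \<subseteq> carrier V \<times> carrier M"
      "P (K #>\<^bsub>F\<^esub> x)" "P (K #>\<^bsub>F\<^esub> y)"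
    have "K #>\<^bsub>F\<^esub> (x - y) = (K #>\<^bsub>F\<^esub> x) \<otimes>\<^bsub>T\<^esub> inv\<^bsub>T\<^esub> (K #>\<^bsub>F\<^esub> y)"
      using *(1,2) coset_mult[of x "- y"] q.hom_inv[of y] by simp
    then show "P (K #>\<^bsub>F\<^esub> (x - y))" using mult_inv[OF _ _ *(3,4)] *(1,2) q.hom_closed by simp
  next
    fix z assume "z \<in> carrier V \<times> carrier M"
    then show "P (K #>\<^bsub>F\<^esub> frag_of z)" using pure[of "fst z" "snd z"] by (auto simp: pure_tensor_def)
  qed
  then show ?thesis using c by simp
qed

text \<open>The uniqueness half of the universal property. Linearity of the evaluation map and its
  compatibility with restriction are reduced to pure tensors in this way.\<close>

lemma hom_eqI:
  assumes "f \<in> hom T G" "g \<in> hom T G" "group G"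
    and "\<And>v m. v \<in> carrier V \<Longrightarrow> m \<in> carrier M \<Longrightarrow> f (pure v m) = g (pure v m)"
    and "x \<in> carrier T"
  shows "f x = g x"
proof -
  interpret f: group_hom T G f using assms by (simp add: group_hom_def group_hom_axioms_def)
  interpret g: group_hom T G g using assms by (simp add: group_hom_def group_hom_axioms_def)
  show ?thesis using assms(5)
    by (induction rule: tensor_induct) (simp_all add: assms(4))
qed

context
  fixes G :: "('g, 'x) monoid_scheme" (structure) and h :: "'v \<Rightarrow> 'w \<Rightarrow> 'g"
  assumes G: "comm_group G"
    and h_closed: "\<And>v m. v \<in> carrier V \<Longrightarrow> m \<in> carrier M \<Longrightarrow> h v m \<in> carrier G"
    and h_left: "\<And>v v' m. v \<in> carrier V \<Longrightarrow> v' \<in> carrier V \<Longrightarrow> m \<in> carrier M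
      \<Longrightarrow> h (v \<oplus>\<^bsub>V\<^esub> v') m = h v m \<otimes> h v' m"
    and h_right: "\<And>v m m'. v \<in> carrier V \<Longrightarrow> m \<in> carrier M \<Longrightarrow> m' \<in> carrier M
      \<Longrightarrow> h v (m \<oplus>\<^bsub>M\<^esub> m') = h v m \<otimes> h v m'"
    and h_balanced: "\<And>a v m. a \<in> carrier k \<Longrightarrow> v \<in> carrier V \<Longrightarrow> m \<in> carrier M
      \<Longrightarrow> h (a \<odot>\<^bsub>V\<^esub> v) m = h v (a \<odot>\<^bsub>M\<^esub> m)"
begin

text \<open>The existence half of the universal property. The extension \<open>h'\<close> of
  \<open>h\<close> to the free group kills the three kinds of relations by biadditivity and
  balancedness, hence the subgroup they generate, so it is constant on each coset.\<close>

lemma lift_extends: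
  obtains h' where "h' \<in> hom F G"
    "\<And>v m. v \<in> carrier V \<Longrightarrow> m \<in> carrier M \<Longrightarrow> h' (frag_of (v, m)) = h v m"
    "\<And>c. c \<in> carrier F \<Longrightarrow> tensor_lift G h (K #>\<^bsub>F\<^esub> c) = h' c"
proof -
  interpret G: comm_group G by (rule G)
  have "(\<lambda>z. h (fst z) (snd z)) ` (carrier V \<times> carrier M) \<subseteq> carrier G"
    using h_closed by auto
  then obtain h' where h': "h' \<in> hom F G"
    "\<And>z. z \<in> carrier V \<times> carrier M \<Longrightarrow> h' (frag_of z) = h (fst z) (snd z)"
    by (rule G.free_Abelian_group_universal) iprover
  interpret h': group_hom F G h'
    by (simp add: group_hom_def group_hom_axioms_def h'(1))
  have diff: "h' (x - y) = h' x \<otimes> inv h' y" if "x \<in> carrier F" "y \<in> carrier F" for x y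
    using h'.hom_mult[of x "- y"] h'.hom_inv[of y] that by simp
  have fr: "frag_of (v, m) \<in> carrier F" if "v \<in> carrier V" "m \<in> carrier M" for v m
    using that by simp
  have cancel: "x \<otimes> y \<otimes> inv x \<otimes> inv y = \<one>"
    if "x \<in> carrier G" "y \<in> carrier G" for x y
  proof -
    have "x \<otimes> y \<otimes> inv x \<otimes> inv y = (x \<otimes> y) \<otimes> inv (x \<otimes> y)"
      using that by (simp add: G.inv_mult G.m_assoc)
    then show ?thesis using that by (simp add: G.r_inv)
  qed
  have rel: "h' r = \<one>" if r: "r \<in> tensor_relations k V M" for r
  proof -
    show ?thesis using r unfolding tensor_relations_def
    proof (elim UnE CollectE exE conjE)
      fix v v' m assume l: "v \<in> carrier V" "v' \<in> carrier V" "m \<in> carrier M"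
        "r = frag_of (v \<oplus>\<^bsub>V\<^esub> v', m) - frag_of (v, m) - frag_of (v', m)"
      have "h' r = (h (v \<oplus>\<^bsub>V\<^esub> v') m \<otimes> inv h v m) \<otimes> inv h v' m"
        unfolding l(4) using l(1-3) by (simp add: diff diff_F fr h'(2) del: carrier_free_Abelian_group_iff)
      also have "\<dots> = \<one>" using h_closed[OF l(1,3)] h_closed[OF l(2,3)] h_left[OF l(1-3)]
        by (simp add: cancel)
      finally show ?thesis .
    next
      fix v m m' assume l: "v \<in> carrier V" "m \<in> carrier M" "m' \<in> carrier M"
        "r = frag_of (v, m \<oplus>\<^bsub>M\<^esub> m') - frag_of (v, m) - frag_of (v, m')"
      have "h' r = (h v (m \<oplus>\<^bsub>M\<^esub> m') \<otimes> inv h v m) \<otimes> inv h v m'"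
        unfolding l(4) using l(1-3) by (simp add: diff diff_F fr h'(2) del: carrier_free_Abelian_group_iff)
      also have "\<dots> = \<one>" using h_closed[OF l(1,2)] h_closed[OF l(1,3)] h_right[OF l(1-3)]
        by (simp add: cancel)
      finally show ?thesis .
    next
      fix a v m assume l: "a \<in> carrier k" "v \<in> carrier V" "m \<in> carrier M"
        "r = frag_of (a \<odot>\<^bsub>V\<^esub> v, m) - frag_of (v, a \<odot>\<^bsub>M\<^esub> m)"
      have "h' r = h (a \<odot>\<^bsub>V\<^esub> v) m \<otimes> inv h v (a \<odot>\<^bsub>M\<^esub> m)"
        unfolding l(4) using l(1-3) by (simp add: diff fr h'(2) del: carrier_free_Abelian_group_iff)
      then show ?thesis using l(1-3) h_closed by (simp add: h_balanced)
    qed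
  qed
  have "tensor_relations k V M \<subseteq> kernel F G h'"
    using rel relations_subset unfolding kernel_def by blast
  then have ker: "h' r = \<one>" if "r \<in> K" for r
    using F.generate_subgroup_incl[OF _ h'.subgroup_kernel] that
    unfolding tensor_kernel_def by (auto simp: kernel_def)
  have "tensor_lift G h (K #>\<^bsub>F\<^esub> c) = h' c" if c: "c \<in> carrier F" for c
  proof -
    let ?\<Phi> = "\<lambda>c. \<Otimes>z\<in>Poly_Mapping.keys c. h (fst z) (snd z) [^] Poly_Mapping.lookup c z"
    have \<Phi>: "?\<Phi> c = h' c" if "c \<in> carrier F" for c
    proof -
      have "h' c = (\<Otimes>z\<in>Poly_Mapping.keys c. h' (frag_of z) [^] Poly_Mapping.lookup c z)"
        using that by (intro G.hom_free_Abelian_group_eq[OF h'(1)]) simp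
      also have "\<dots> = ?\<Phi> c"
        using that h'(2) h_closed by (intro G.finprod_cong') (auto simp: subset_iff)
      finally show ?thesis ..
    qed
    have mem: "r + c \<in> carrier F \<and> h' (r + c) = h' c" if "r \<in> K" for r
    proof -
      have r: "r \<in> carrier F" using that N.subset by blast
      then show ?thesis
        using F.m_closed[OF r c] h'.hom_mult[OF r c] ker[OF that] h'.hom_closed[OF c] by simp
    qed
    \<comment> \<open>All representatives give the same value, so the \<open>the_elem\<close> in
      \<open>tensor_lift\<close> is applied to a singleton.\<close>
    have "(?\<Phi> ` (K #>\<^bsub>F\<^esub> c)) = {h' c}"
    proof
      show "?\<Phi> ` (K #>\<^bsub>F\<^esub> c) \<subseteq> {h' c}"
        using mem \<Phi> by (auto simp: r_coset_def simp del: carrier_free_Abelian_group_iff)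
      have "c \<in> K #>\<^bsub>F\<^esub> c" by (rule F.rcos_self[OF c kernel_subgroup])
      then show "{h' c} \<subseteq> ?\<Phi> ` (K #>\<^bsub>F\<^esub> c)" using \<Phi>[OF c] by force
    qed
    then show ?thesis by (simp add: tensor_lift_def)
  qed
  moreover have "h' (frag_of (v, m)) = h v m" if "v \<in> carrier V" "m \<in> carrier M" for v m
    using h'(2)[of "(v, m)"] that by simp
  ultimately show thesis using that[OF h'(1)] by blast
qed

lemma lift_pure:
  assumes "v \<in> carrier V" "m \<in> carrier M"
  shows "tensor_lift G h (pure v m) = h v m"
  using lift_extends assms unfolding pure_tensor_def
  by (metis SigmaI frag_of_in_free_Abelian_group)

lemma lift_hom: "tensor_lift G h \<in> hom T G"
proof -
  obtain h' where h': "h' \<in> hom F G"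
    "\<And>c. c \<in> carrier F \<Longrightarrow> tensor_lift G h (K #>\<^bsub>F\<^esub> c) = h' c"
    using lift_extends by metis
  show ?thesis
  proof (rule homI)
    fix x assume "x \<in> carrier T"
    then obtain c where c: "c \<in> carrier F" "x = K #>\<^bsub>F\<^esub> c"
      by (auto simp: T_eq carrier_FactGroup simp del: carrier_free_Abelian_group_iff)
    then show "tensor_lift G h x \<in> carrier G" using h' hom_in_carrier by metis
    fix y assume "y \<in> carrier T"
    then obtain d where d: "d \<in> carrier F" "y = K #>\<^bsub>F\<^esub> d"
      by (auto simp: T_eq carrier_FactGroup simp del: carrier_free_Abelian_group_iff)
    have "tensor_lift G h (x \<otimes>\<^bsub>T\<^esub> y) = h' (c + d)"
      using h'(2)[of "c + d"] F.m_closed[OF c(1) d(1)] coset_mult[OF c(1) d(1)] c d by simp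
    also have "\<dots> = h' c \<otimes> h' d" using hom_mult[OF h'(1) c(1) d(1)] by simp
    finally show "tensor_lift G h (x \<otimes>\<^bsub>T\<^esub> y) = tensor_lift G h x \<otimes> tensor_lift G h y"
      using h'(2) c d by simp
  qed
qed

end

text \<open>Expand the left factor in the spanning family and move the scalars to the right factor.
  Every tensor then has one coefficient in \<open>M\<close> per spanning vector, which turns a
  statement about tensors into one about \<open>l\<close> coefficients.\<close>

lemma pure_sum_form:
  assumes b: "\<And>i. i < l \<Longrightarrow> b i \<in> carrier V"
    and span: "\<And>v. v \<in> carrier V \<Longrightarrow> \<exists>c. (\<forall>i<l. c i \<in> carrier k) \<and> v = (\<Oplus>\<^bsub>V\<^esub>i\<in>{..<l::nat}. c i \<odot>\<^bsub>V\<^esub> b i)"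
    and x: "x \<in> carrier T"
  shows "\<exists>f. (\<forall>i<l. f i \<in> carrier M) \<and> x = (\<Otimes>\<^bsub>T\<^esub>i\<in>{..<l}. pure (b i) (f i))"
  using x
proof (induction rule: tensor_induct)
  case one
  have "pure v \<zero>\<^bsub>M\<^esub> = \<one>\<^bsub>T\<^esub>" if "v \<in> carrier V" for v
  proof -
    have "pure v \<zero>\<^bsub>M\<^esub> \<otimes>\<^bsub>T\<^esub> pure v \<zero>\<^bsub>M\<^esub> = pure v \<zero>\<^bsub>M\<^esub>"
      using pure_add_right[OF that, of "\<zero>\<^bsub>M\<^esub>" "\<zero>\<^bsub>M\<^esub>"] by simp
    then show ?thesis using pure_closed[OF that] T.r_cancel_one' M.zero_closed by metis
  qed
  then show ?case using b
    by (intro exI[of _ "\<lambda>_. \<zero>\<^bsub>M\<^esub>"]) (auto intro!: T.finprod_one_eqI[symmetric])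
next
  case (pure v m)
  obtain c where c: "\<And>i. i < l \<Longrightarrow> c i \<in> carrier k" and v: "v = (\<Oplus>\<^bsub>V\<^esub>i\<in>{..<l}. c i \<odot>\<^bsub>V\<^esub> b i)"
    using span[OF pure(1)] by blast
  have hom: "(\<lambda>v. pure v m) \<in> hom (add_monoid V) T"
    using pure_add_left pure_closed pure(2) by (auto simp: hom_def)
  have "pure v m = (\<Otimes>\<^bsub>T\<^esub>i\<in>{..<l}. pure (c i \<odot>\<^bsub>V\<^esub> b i) m)"
    unfolding v finsum_def using b c
    by (intro hom_finprod[OF V.a_comm_monoid T.comm_monoid_axioms hom hom_one[OF hom V.a_group T.is_group]]) auto
  also have "\<dots> = (\<Otimes>\<^bsub>T\<^esub>i\<in>{..<l}. pure (b i) (c i \<odot>\<^bsub>M\<^esub> m))"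
    by (rule T.finprod_cong') (use b c pure(2) in \<open>auto simp: pure_balanced intro!: pure_closed\<close>)
  finally show ?case using c pure(2) by (intro exI[of _ "\<lambda>i. c i \<odot>\<^bsub>M\<^esub> m"]) auto
next
  case (mult_inv x y)
  then obtain f g where
    f: "\<And>i. i < l \<Longrightarrow> f i \<in> carrier M" "x = (\<Otimes>\<^bsub>T\<^esub>i\<in>{..<l}. pure (b i) (f i))" and
    g: "\<And>i. i < l \<Longrightarrow> g i \<in> carrier M" "y = (\<Otimes>\<^bsub>T\<^esub>i\<in>{..<l}. pure (b i) (g i))"
    by blast
  \<comment> \<open>The quotient is guessed from the differences of the coefficients and confirmed
    by multiplying with \<open>y\<close>, so inverses of pure tensors need not be computed.\<close>
  define d where "d i = f i \<ominus>\<^bsub>M\<^esub> g i" for i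
  have d: "d i \<in> carrier M" "d i \<oplus>\<^bsub>M\<^esub> g i = f i" if "i < l" for i
    using f(1) g(1) that by (auto simp: d_def a_minus_def M.a_assoc M.l_neg)
  let ?z = "\<Otimes>\<^bsub>T\<^esub>i\<in>{..<l}. pure (b i) (d i)"
  have "?z \<otimes>\<^bsub>T\<^esub> y = (\<Otimes>\<^bsub>T\<^esub>i\<in>{..<l}. pure (b i) (d i) \<otimes>\<^bsub>T\<^esub> pure (b i) (g i))"
    unfolding g(2) by (rule T.finprod_multf[symmetric]) (use b d g(1) in \<open>auto intro!: pure_closed\<close>)
  also have "\<dots> = x" unfolding f(2)
    by (rule T.finprod_cong') (use b d f(1) g(1) in \<open>auto intro!: pure_closed simp flip: pure_add_right\<close>)
  finally have "?z \<otimes>\<^bsub>T\<^esub> y = x" .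
  moreover have "?z \<in> carrier T" using b d by (auto intro!: T.finprod_closed pure_closed)
  ultimately have "x \<otimes>\<^bsub>T\<^esub> inv\<^bsub>T\<^esub> y = ?z"
    using mult_inv(1,2) T.inv_solve_right[of ?z x y] by simp
  then show ?case using d(1) by blast
qed

end

section \<open>Integral schemes\<close>

text \<open>The restrictions of \<open>s\<close> form a compatible family, and both \<open>s\<close>
  and \<open>t\<close> glue it. The empty cover is allowed and forces any two sections over the
  empty set to agree.\<close>

lemma sheaf_separated:
  assumes sh: "sheaf_on T C \<rho>" and op: "\<And>V. V \<in> \<C> \<Longrightarrow> openin T V" and U: "U = \<Union>\<C>"
    and st: "s \<in> C U" "t \<in> C U" and eq: "\<And>V. V \<in> \<C> \<Longrightarrow> \<rho> U V s = \<rho> U V t"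
  shows "s = t"
proof -
  have opU: "openin T U" using op unfolding U by (intro openin_Union) auto
  have sub: "V \<subseteq> U" if "V \<in> \<C>" for V using that U by blast
  note sh' = sh[unfolded sheaf_on_def]
  have c1: "\<forall>U V s. openin T U \<and> openin T V \<and> V \<subseteq> U \<and> s \<in> C U \<longrightarrow> \<rho> U V s \<in> C V"
    using sh' by (rule conjunct1)
  have c3: "\<forall>U V W s. openin T U \<and> openin T V \<and> openin T W \<and> W \<subseteq> V \<and> V \<subseteq> U \<and> s \<in> C U
        \<longrightarrow> \<rho> V W (\<rho> U V s) = \<rho> U W s"
    using sh'[THEN conjunct2, THEN conjunct2] by (rule conjunct1)
  have closed: "\<rho> U V s \<in> C V" if "V \<in> \<C>" for V
    using c1 opU op[OF that] sub[OF that] st(1) by blast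
  have comp: "\<rho> V W (\<rho> U V s) = \<rho> U W s" if "V \<in> \<C>" "openin T W" "W \<subseteq> V" for V W
    using c3 opU op[OF that(1)] sub[OF that(1)] that st(1) by blast
  have "\<exists>!t. t \<in> C U \<and> (\<forall>V\<in>\<C>. \<rho> U V t = \<rho> U V s)"
    unfolding U
  proof (rule sh'[THEN conjunct2, THEN conjunct2, THEN conjunct2, THEN spec, THEN spec, THEN mp], fold U,
      intro conjI ballI)
    fix V W assume VW: "V \<in> \<C>" "W \<in> \<C>"
    then have "openin T (V \<inter> W)" using op by (intro openin_Int)
    then show "\<rho> V (V \<inter> W) (\<rho> U V s) = \<rho> W (V \<inter> W) (\<rho> U W s)"
      using comp[OF VW(1), of "V \<inter> W"] comp[OF VW(2), of "V \<inter> W"] by simp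
  qed (use op closed in auto)
  then show ?thesis using st eq by (elim ex1E) (metis (no_types))
qed

section \<open>Fractions as sections over open sets of an affine scheme\<close>

lemma topspace_spec: "topspace (spec_topology A) = prime_spectrum A"
proof
  show "topspace (spec_topology A) \<subseteq> prime_spectrum A"
    by (auto simp: topspace_def openin_spec_topology)
  have "openin (spec_topology A) (prime_spectrum A)"
    unfolding openin_spec_topology
  proof (intro exI[of _ "carrier A"] conjI equalityI subsetI CollectI notI)
    fix P assume P: "P \<in> prime_spectrum A" and sub: "carrier A \<subseteq> P"
    then interpret primeideal P A by (simp add: prime_spectrum_def)
    show False using I_notcarr sub a_subset by blast
  qed auto
  then show "prime_spectrum A \<subseteq> topspace (spec_topology A)" by (rule openin_subset)
qed

lemma open_subset_spec: "openin (spec_topology A) W \<Longrightarrow> Q \<in> W \<Longrightarrow> primeideal Q A"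
  using openin_subset[of "spec_topology A" W] by (auto simp: topspace_spec prime_spectrum_def)

lemma open_localization_at: "openin (spec_topology A) W \<Longrightarrow> Q \<in> W \<Longrightarrow> localization_at Q A"
  by (simp add: localization_at_def open_subset_spec)

lemma openin_basic: "h \<in> carrier A \<Longrightarrow> openin (spec_topology A) {Q \<in> prime_spectrum A. h \<notin> Q}"
  unfolding openin_spec_topology by (intro exI[of _ "{h}"]) auto

definition frac_section :: "'a ring \<Rightarrow> 'a set set \<Rightarrow> 'a \<Rightarrow> 'a \<Rightarrow> ('a set \<Rightarrow> ('a \<times> 'a) set)" where
  "frac_section A W a t = (\<lambda>Q\<in>W. fraction A Q a t)"

context
  fixes A :: "'a ring" (structure) and W
  assumes W: "openin (spec_topology A) W"
begin

lemma frac_section_closed: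
  assumes "a \<in> carrier A" "t \<in> carrier A" "\<And>Q. Q \<in> W \<Longrightarrow> t \<notin> Q"
  shows "frac_section A W a t \<in> carrier (str (Spec A) W)"
proof -
  have "\<exists>V b u. openin (spec_topology A) V \<and> P \<in> V \<and> V \<subseteq> W \<and> b \<in> carrier A \<and> u \<in> carrier A \<and>
      (\<forall>Q\<in>V. u \<notin> Q \<and> frac_section A W a t Q = fraction A Q b u)" if "P \<in> W" for P
    using assms W that
    by (intro exI[of _ W] exI[of _ a] exI[of _ t]) (auto simp: frac_section_def)
  then show ?thesis unfolding Spec_def spec_sections_def by (simp add: frac_section_def)
qed

lemma frac_section_mult:
  assumes "a \<in> carrier A" "b \<in> carrier A" "t \<in> carrier A" "u \<in> carrier A"
    "\<And>Q. Q \<in> W \<Longrightarrow> t \<notin> Q" "\<And>Q. Q \<in> W \<Longrightarrow> u \<notin> Q"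
  shows "frac_section A W a t \<otimes>\<^bsub>str (Spec A) W\<^esub> frac_section A W b u
    = frac_section A W (a \<otimes> b) (t \<otimes> u)"
  unfolding Spec_def frac_section_def
  using localization_at.fraction_mult[OF open_localization_at[OF W]] assms
  by (auto intro!: restrict_ext)

lemma frac_section_add:
  assumes "a \<in> carrier A" "b \<in> carrier A" "t \<in> carrier A" "u \<in> carrier A"
    "\<And>Q. Q \<in> W \<Longrightarrow> t \<notin> Q" "\<And>Q. Q \<in> W \<Longrightarrow> u \<notin> Q"
  shows "frac_section A W a t \<oplus>\<^bsub>str (Spec A) W\<^esub> frac_section A W b u
    = frac_section A W (a \<otimes> u \<oplus> b \<otimes> t) (t \<otimes> u)"
  unfolding Spec_def frac_section_def
  using localization_at.fraction_add[OF open_localization_at[OF W]] assms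
  by (auto intro!: restrict_ext)

lemma frac_section_one: "\<one>\<^bsub>str (Spec A) W\<^esub> = frac_section A W \<one> \<one>"
  unfolding Spec_def frac_section_def
  using localization_at.fraction_one[OF open_localization_at[OF W]]
  by (auto intro!: restrict_ext)

text \<open>A single multiplier \<open>w\<close> that avoids every prime in \<open>W\<close>
  witnesses the equality of the two fractions in all localizations at once.\<close>

lemma frac_section_eqI:
  assumes "a \<in> carrier A" "b \<in> carrier A" "t \<in> carrier A" "u \<in> carrier A" "w \<in> carrier A"
    "\<And>Q. Q \<in> W \<Longrightarrow> t \<notin> Q" "\<And>Q. Q \<in> W \<Longrightarrow> u \<notin> Q" "\<And>Q. Q \<in> W \<Longrightarrow> w \<notin> Q"
    "w \<otimes> (a \<otimes> u) = w \<otimes> (b \<otimes> t)"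
  shows "frac_section A W a t = frac_section A W b u"
  unfolding frac_section_def
proof (rule restrict_ext)
  fix Q assume Q: "Q \<in> W"
  then interpret localization_at Q A using open_localization_at[OF W] by blast
  show "fraction A Q a t = fraction A Q b u"
    using assms Q by (subst fraction_eq_iff) auto
qed

end

lemma spec_res: "res (Spec A) U V \<sigma> = restrict \<sigma> V"
  by (simp add: Spec_def)

text \<open>Argues from \<open>0/1 + 0/1 = 0/1\<close> and cancellation in \<open>S\<close>, because
  the ring axioms of \<open>str (Spec A) W\<close> have not been established.\<close>

lemma hom_frac_section_zero:
  fixes A :: "'a ring"
  assumes W: "openin (spec_topology A) W" and A: "cring A" and S: "cring S"
    and h: "h \<in> ring_hom (str (Spec A) W) S"
  shows "h (frac_section A W \<zero>\<^bsub>A\<^esub> \<one>\<^bsub>A\<^esub>) = \<zero>\<^bsub>S\<^esub>"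
proof -
  interpret A: cring A by (rule A)
  interpret S: cring S by (rule S)
  let ?z = "frac_section A W \<zero>\<^bsub>A\<^esub> \<one>\<^bsub>A\<^esub>"
  have one: "\<one>\<^bsub>A\<^esub> \<notin> Q" if "Q \<in> W" for Q
    using localization_at.one_denom[OF open_localization_at[OF W that]] by simp
  have z: "?z \<in> carrier (str (Spec A) W)" by (rule frac_section_closed[OF W]) (use one in auto)
  have "?z \<oplus>\<^bsub>str (Spec A) W\<^esub> ?z = ?z"
    by (subst frac_section_add[OF W]) (use one in auto)
  then have "h ?z \<oplus>\<^bsub>S\<^esub> h ?z = h ?z" using ring_hom_add[OF h z z] by simp
  then show ?thesis using ring_hom_closed[OF h z] S.add.r_cancel_one' by simp
qed

section \<open>Invertible germs and integrality\<close>

lemma ringed_sheaf: "is_ringed_space X \<Longrightarrow> sheaf_on (base X) (\<lambda>U. carrier (str X U)) (res X)"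
  and ringed_cring: "is_ringed_space X \<Longrightarrow> openin (base X) U \<Longrightarrow> cring (str X U)"
  and ringed_res_hom: "is_ringed_space X \<Longrightarrow> openin (base X) U \<Longrightarrow> openin (base X) V \<Longrightarrow> V \<subseteq> U
    \<Longrightarrow> res X U V \<in> ring_hom (str X U) (str X V)"
  unfolding is_ringed_space_def by blast+

lemma ringed_res_res:
  assumes "is_ringed_space X" "openin (base X) U" "openin (base X) V" "openin (base X) W"
    "W \<subseteq> V" "V \<subseteq> U" "s \<in> carrier (str X U)"
  shows "res X V W (res X U V s) = res X U W s"
  using ringed_sheaf[OF assms(1)] assms(2-) unfolding sheaf_on_def by metis

lemma ring_hom_zero':
  assumes "h \<in> ring_hom R S" "cring R" "cring S"
  shows "h \<zero>\<^bsub>R\<^esub> = \<zero>\<^bsub>S\<^esub>"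
  by (rule ring_hom_zero[OF assms(1) cring.axioms(1)[OF assms(2)] cring.axioms(1)[OF assms(3)]])

text \<open>Near each prime the section is a fraction \<open>a/t\<close> on a basic open set given
  by some \<open>h\<close>. Without invertible germs \<open>a\<close> lies in every prime of that
  set, so \<open>a\<close> times \<open>h\<close> lies in all primes and is nilpotent. Then the
  fraction is nilpotent there, hence zero by reducedness, and these local zeros glue.\<close>

lemma no_unit_germ_in_affine:
  fixes X :: "('p, 'r) ringed_space"
  assumes X: "is_ringed_space X" "reduced X" and aff: "affine_open X U"
    and V: "openin (base X) V" "V \<subseteq> U" and s: "s \<in> carrier (str X V)"
    and no_unit: "\<And>x. x \<in> V \<Longrightarrow> \<not> germ_unit X x V s"
  shows "s = \<zero>\<^bsub>str X V\<^esub>"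
proof -
  obtain A :: "'r ring" and f fs where A: "cring A" and iso: "lrs_iso (open_sub X U) (Spec A) f fs"
    and U: "openin (base X) U"
    using aff unfolding affine_open_def by blast
  interpret A: cring A by (rule A)
  let ?Y = "open_sub X U" and ?T = "spec_topology A"
  have strY: "str ?Y = str X" "res ?Y = res X" and baseY: "base ?Y = subtopology (base X) U"
    and baseS: "base (Spec A) = ?T"
    by (simp_all add: open_sub_def Spec_def)
  have ptsY: "points ?Y = U" using openin_subset[OF U] by (auto simp: baseY)
  have homeo: "homeomorphic_map (base ?Y) ?T f" and mor: "lrs_morphism ?Y (Spec A) f fs"
    and bij: "\<And>N. openin ?T N \<Longrightarrow> bij_betw (fs N) (carrier (str (Spec A) N)) (carrier (str X (preim ?Y f N)))"
    using iso unfolding lrs_iso_def baseS strY by blast+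
  have inj: "inj_on f U" using homeomorphic_imp_injective_map[OF homeo] ptsY by simp
  have hom: "fs N \<in> ring_hom (str (Spec A) N) (str X (preim ?Y f N))" if "openin ?T N" for N
    using mor that unfolding lrs_morphism_def baseS strY by blast
  have nat: "res X (preim ?Y f N) (preim ?Y f M) (fs N \<sigma>) = fs M (restrict \<sigma> M)"
    if "openin ?T N" "openin ?T M" "M \<subseteq> N" "\<sigma> \<in> carrier (str (Spec A) N)" for N M \<sigma>
    using mor that unfolding lrs_morphism_def baseS strY spec_res by blast
  have open_pre: "openin (base X) (preim ?Y f N)" "preim ?Y f N \<subseteq> U" if "openin ?T N" for N
  proof -
    have "continuous_map (base ?Y) ?T f" using mor unfolding lrs_morphism_def baseS by blast
    then have "openin (base ?Y) {x \<in> points ?Y. f x \<in> N}"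
      using that by (rule openin_continuous_map_preimage)
    then have "openin (base ?Y) (preim ?Y f N)" by (simp add: preim_def)
    then show "openin (base X) (preim ?Y f N)" "preim ?Y f N \<subseteq> U"
      unfolding baseY using openin_open_subtopology[OF U] by blast+
  qed
  \<comment> \<open>The section is carried to \<open>Spec A\<close> over the image of
    \<open>V\<close>, where surjectivity of \<open>fs N\<close> provides a section
    \<open>\<sigma>\<close> mapped to \<open>s\<close>.\<close>
  define N where "N = f ` V"
  have N: "openin ?T N"
    unfolding N_def using homeomorphic_map_openness[OF homeo, of V] V U
    by (simp add: ptsY) (simp add: baseY openin_open_subtopology[OF U])
  have pN: "preim ?Y f N = V"
    using inj V(2) by (auto simp: preim_def ptsY N_def inj_on_def)
  have "s \<in> fs N ` carrier (str (Spec A) N)"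
    using s bij_betw_imp_surj_on[OF bij[OF N]] unfolding pN by simp
  then obtain \<sigma> where \<sigma>: "fs N \<sigma> = s" "\<sigma> \<in> carrier (str (Spec A) N)"
    by (auto elim: imageE)
  have loc: "\<exists>M. openin ?T M \<and> P \<in> M \<and> M \<subseteq> N \<and>
      res X V (preim ?Y f M) s = \<zero>\<^bsub>str X (preim ?Y f M)\<^esub>" if P: "P \<in> N" for P
  proof -
    have "\<sigma> \<in> spec_sections A N" using \<sigma>(2) by (simp add: Spec_def)
    then have "\<exists>M' a t. openin ?T M' \<and> P \<in> M' \<and> M' \<subseteq> N \<and> a \<in> carrier A \<and> t \<in> carrier A \<and>
        (\<forall>Q\<in>M'. t \<notin> Q \<and> \<sigma> Q = fraction A Q a t)"
      using P unfolding spec_sections_def by simp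
    then obtain M' a t where M': "openin ?T M'" "P \<in> M'" "M' \<subseteq> N" and at1: "a \<in> carrier A" "t \<in> carrier A"
      and at2: "\<forall>Q\<in>M'. t \<notin> Q \<and> \<sigma> Q = fraction A Q a t"
      by (elim exE conjE) (rule that)
    have at: "a \<in> carrier A" "t \<in> carrier A" "\<And>Q. Q \<in> M' \<Longrightarrow> t \<notin> Q" "\<And>Q. Q \<in> M' \<Longrightarrow> \<sigma> Q = fraction A Q a t"
      using at1 at2 by auto
    obtain S where S: "S \<subseteq> carrier A" "M' = {Q \<in> prime_spectrum A. \<not> S \<subseteq> Q}"
      using M'(1) unfolding openin_spec_topology by blast
    obtain h where h: "h \<in> S" "h \<notin> P" using M'(2) S(2) by blast
    \<comment> \<open>Shrinking to a basic open set keeps \<open>a/t\<close> as a formula for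
      \<open>\<sigma>\<close> and describes the primes outside by one condition,
      \<open>h \<in> Q\<close>.\<close>
    define M where "M = {Q \<in> prime_spectrum A. h \<notin> Q}"
    have hA: "h \<in> carrier A" using h S by blast
    have M: "openin ?T M" "P \<in> M" "M \<subseteq> M'"
      unfolding M_def using openin_basic[OF hA] M'(2) S(2) h by auto
    \<comment> \<open>If \<open>a\<close> avoided \<open>Q\<close>, the fraction \<open>t/a\<close>
      would invert \<open>a/t\<close> on a neighbourhood of \<open>Q\<close>, and \<open>s\<close>
      would have an invertible germ at the point over \<open>Q\<close>.\<close>
    have in_all: "a \<in> Q" if Q: "Q \<in> M" for Q
    proof (rule ccontr)
      assume aQ: "a \<notin> Q"
      define L where "L = M \<inter> {Q \<in> prime_spectrum A. a \<notin> Q}"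
      have L: "openin ?T L" "Q \<in> L" "L \<subseteq> M" "\<And>Q. Q \<in> L \<Longrightarrow> a \<notin> Q"
        unfolding L_def using openin_Int[OF M(1) openin_basic[OF at(1)]] aQ Q M_def by auto
      have tL: "t \<notin> Q" if "Q \<in> L" for Q using that L M at by blast
      have oneL: "\<one>\<^bsub>A\<^esub> \<notin> Q" if "Q \<in> L" for Q
        using localization_at.one_denom[OF open_localization_at[OF L(1) that]] by simp
      have res\<sigma>: "restrict \<sigma> L = frac_section A L a t"
        unfolding frac_section_def using at L M by (intro restrict_ext) blast
      have cl: "frac_section A L a t \<in> carrier (str (Spec A) L)" "frac_section A L t a \<in> carrier (str (Spec A) L)"
        using frac_section_closed[OF L(1)] at(1,2) tL L(4) by blast+
      interpret VL: cring "str X (preim ?Y f L)"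
        by (rule ringed_cring[OF X(1) open_pre(1)[OF L(1)]])
      have "frac_section A L a t \<otimes>\<^bsub>str (Spec A) L\<^esub> frac_section A L t a = \<one>\<^bsub>str (Spec A) L\<^esub>"
        unfolding frac_section_one[OF L(1)]
        by (subst frac_section_mult[OF L(1)])
          (use at(1,2) tL L(4) oneL in \<open>auto intro!: frac_section_eqI[OF L(1), where w = "\<one>\<^bsub>A\<^esub>"]
             simp: A.m_comm dest: primeideal.I_prime[OF open_subset_spec[OF L(1)]]\<close>)
      then have "fs L (frac_section A L a t) \<otimes>\<^bsub>str X (preim ?Y f L)\<^esub> fs L (frac_section A L t a) = \<one>\<^bsub>str X (preim ?Y f L)\<^esub>"
        using ring_hom_mult[OF hom[OF L(1)] cl] ring_hom_one[OF hom[OF L(1)]] by simp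
      moreover have "fs L (frac_section A L a t) = res X V (preim ?Y f L) s"
        using nat[OF N L(1) _ \<sigma>(2)] L M M' unfolding pN \<sigma>(1) res\<sigma> by auto
      ultimately have unit: "res X V (preim ?Y f L) s \<in> Units (str X (preim ?Y f L))"
        using ring_hom_closed[OF hom[OF L(1)] cl(1)] ring_hom_closed[OF hom[OF L(1)] cl(2)] unfolding Units_def
        by (intro CollectI conjI bexI[of _ "fs L (frac_section A L t a)"]) (simp_all add: VL.m_comm)
      obtain x where x: "x \<in> V" "f x = Q" using L M M' Q N_def by blast
      have "x \<in> preim ?Y f L" using x V(2) L(2) by (auto simp: preim_def ptsY)
      moreover have "preim ?Y f L \<subseteq> V"
        using L M M' pN by (auto simp: preim_def)
      ultimately have "germ_unit X x V s"
        unfolding germ_unit_def using unit open_pre(1)[OF L(1)] by blast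
      then show False using no_unit x by blast
    qed
    \<comment> \<open>Primes in \<open>M\<close> contain \<open>a\<close>, all others contain
      \<open>h\<close>.\<close>
    have "a \<otimes>\<^bsub>A\<^esub> h \<in> Q" if Q: "primeideal Q A" for Q
    proof -
      interpret Q: primeideal Q A by (rule Q)
      show ?thesis
      proof (cases "h \<in> Q")
        case False
        then have "a \<in> Q" using in_all Q by (simp add: M_def prime_spectrum_def)
        then show ?thesis using hA by (rule Q.I_r_closed)
      qed (use at(1) in \<open>auto intro: Q.I_l_closed\<close>)
    qed
    then obtain n :: nat where n: "(a \<otimes>\<^bsub>A\<^esub> h) [^]\<^bsub>A\<^esub> n = \<zero>\<^bsub>A\<^esub>"
      using A.nilpotent_if_in_all_primes[of "a \<otimes>\<^bsub>A\<^esub> h"] at(1) hA by blast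
    let ?VM = "preim ?Y f M"
    let ?s = "res X V ?VM s"
    have tM: "t \<notin> Q" if "Q \<in> M" for Q using that M at by blast
    have pow_notin: "u [^]\<^bsub>A\<^esub> (m::nat) \<notin> Q" if "Q \<in> M" "u \<in> carrier A" "u \<notin> Q" for Q u m
    proof -
      interpret localization_at Q A using open_localization_at[OF M(1) that(1)] .
      have "u [^]\<^bsub>A\<^esub> m \<in> denoms"
        by (induction m) (use that one_denom mult_denom in auto)
      then show ?thesis by simp
    qed
    have openVM: "openin (base X) ?VM" by (rule open_pre(1)[OF M(1)])
    interpret VM: cring "str X ?VM" by (rule ringed_cring[OF X(1) openVM])
    have res\<sigma>: "restrict \<sigma> M = frac_section A M a t"
      unfolding frac_section_def using at M by (intro restrict_ext) blast
    have s_eq: "?s = fs M (frac_section A M a t)"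
      using nat[OF N M(1) _ \<sigma>(2)] M M' unfolding pN \<sigma>(1) res\<sigma> by auto
    have cl: "frac_section A M (a [^]\<^bsub>A\<^esub> m) (t [^]\<^bsub>A\<^esub> m) \<in> carrier (str (Spec A) M)" for m :: nat
      using at(1,2) tM pow_notin by (intro frac_section_closed[OF M(1)]) auto
    have cl1: "frac_section A M a t \<in> carrier (str (Spec A) M)"
      using at(1,2) tM by (intro frac_section_closed[OF M(1)]) auto
    have s_car: "?s \<in> carrier (str X ?VM)" unfolding s_eq by (rule ring_hom_closed[OF hom[OF M(1)] cl1])
    have pow: "?s [^]\<^bsub>str X ?VM\<^esub> m = fs M (frac_section A M (a [^]\<^bsub>A\<^esub> m) (t [^]\<^bsub>A\<^esub> m))" for m :: nat
    proof (induction m)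
      case 0
      show ?case using ring_hom_one[OF hom[OF M(1)]] by (simp add: frac_section_one[OF M(1)])
    next
      case (Suc m)
      have "frac_section A M (a [^]\<^bsub>A\<^esub> m) (t [^]\<^bsub>A\<^esub> m) \<otimes>\<^bsub>str (Spec A) M\<^esub> frac_section A M a t
         = frac_section A M (a [^]\<^bsub>A\<^esub> Suc m) (t [^]\<^bsub>A\<^esub> Suc m)"
        using at(1,2) tM pow_notin by (subst frac_section_mult[OF M(1)]) auto
      then show ?case using ring_hom_mult[OF hom[OF M(1)] cl[of m] cl1] Suc by (simp add: s_eq)
    qed
    \<comment> \<open>The power of \<open>h\<close> avoids every prime in \<open>M\<close>, so it
      may serve as multiplier; with it, nilpotency of the product of \<open>a\<close> and
      \<open>h\<close> becomes the vanishing of the \<open>n\<close>-th power of \<open>a/t\<close>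
      on \<open>M\<close>.\<close>
    have "frac_section A M (a [^]\<^bsub>A\<^esub> n) (t [^]\<^bsub>A\<^esub> n) = frac_section A M \<zero>\<^bsub>A\<^esub> \<one>\<^bsub>A\<^esub>"
    proof (rule frac_section_eqI[OF M(1), where w = "h [^]\<^bsub>A\<^esub> n"])
      show "h [^]\<^bsub>A\<^esub> n \<otimes>\<^bsub>A\<^esub> (a [^]\<^bsub>A\<^esub> n \<otimes>\<^bsub>A\<^esub> \<one>\<^bsub>A\<^esub>) = h [^]\<^bsub>A\<^esub> n \<otimes>\<^bsub>A\<^esub> (\<zero>\<^bsub>A\<^esub> \<otimes>\<^bsub>A\<^esub> t [^]\<^bsub>A\<^esub> n)"
        using n at(1,2) hA by (simp add: A.nat_pow_distrib A.m_comm)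
      show "\<one>\<^bsub>A\<^esub> \<notin> Q" if "Q \<in> M" for Q
        using localization_at.one_denom[OF open_localization_at[OF M(1) that]] by simp
    qed (use at(1,2) hA tM pow_notin M_def in auto)
    then have "?s [^]\<^bsub>str X ?VM\<^esub> n = \<zero>\<^bsub>str X ?VM\<^esub>"
      using pow hom_frac_section_zero[OF M(1) A VM.is_cring hom[OF M(1)]] by simp
    then have "?s = \<zero>\<^bsub>str X ?VM\<^esub>"
      using X(2) openVM s_car unfolding reduced_def by blast
    then show ?thesis using M M' by blast
  qed
  let ?\<C> = "{preim ?Y f M | M. openin ?T M \<and> M \<subseteq> N \<and>
      res X V (preim ?Y f M) s = \<zero>\<^bsub>str X (preim ?Y f M)\<^esub>}"
  show ?thesis
  proof (rule sheaf_separated[OF ringed_sheaf[OF X(1)], of ?\<C>])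
    show "V = \<Union>?\<C>"
    proof
      show "V \<subseteq> \<Union>?\<C>"
      proof
        fix x assume x: "x \<in> V"
        then have "f x \<in> N" by (simp add: N_def)
        then obtain M where M: "openin ?T M" "f x \<in> M" "M \<subseteq> N"
          "res X V (preim ?Y f M) s = \<zero>\<^bsub>str X (preim ?Y f M)\<^esub>" using loc by blast
        moreover have "x \<in> preim ?Y f M" using x V(2) M(2) by (auto simp: preim_def ptsY)
        ultimately show "x \<in> \<Union>?\<C>" by blast
      qed
      show "\<Union>?\<C> \<subseteq> V" using pN by (auto simp: preim_def)
    qed
    show "s \<in> carrier (str X V)" by (rule s)
    show "\<zero>\<^bsub>str X V\<^esub> \<in> carrier (str X V)"
      using ringed_cring[OF X(1) V(1)] by (simp add: cring.cring_simprules)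
    fix W assume "W \<in> ?\<C>"
    then obtain M where M: "W = preim ?Y f M" "openin ?T M" "M \<subseteq> N"
      "res X V W s = \<zero>\<^bsub>str X W\<^esub>" by blast
    then show oW: "openin (base X) W" using open_pre by simp
    have "W \<subseteq> V" using M(1,3) pN by (auto simp: preim_def)
    then show "res X V W s = res X V W \<zero>\<^bsub>str X V\<^esub>"
      using ring_hom_zero'[OF ringed_res_hom[OF X(1) V(1) oW] ringed_cring[OF X(1) V(1)] ringed_cring[OF X(1) oW]] M(4)
      by simp
  qed
qed

text \<open>The intersections of \<open>V\<close> with affine open sets cover \<open>V\<close>, and
  an invertible germ of a restriction of \<open>s\<close> is an invertible germ of \<open>s\<close>,
  so the affine case applies to each piece.\<close>

lemma no_unit_germ_zero:
  fixes X :: "('p, 'r) ringed_space"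
  assumes X: "scheme X" "reduced X" and V: "openin (base X) V" and s: "s \<in> carrier (str X V)"
    and no_unit: "\<And>x. x \<in> V \<Longrightarrow> \<not> germ_unit X x V s"
  shows "s = \<zero>\<^bsub>str X V\<^esub>"
proof -
  have rs: "is_ringed_space X" using X(1) by (simp add: scheme_def locally_ringed_space_def)
  let ?\<C> = "{V \<inter> U | U. affine_open X U}"
  show ?thesis
  proof (rule sheaf_separated[OF ringed_sheaf[OF rs], of ?\<C>])
    have "V \<subseteq> points X" using V by (rule openin_subset)
    then show "V = \<Union>?\<C>" using X(1) unfolding scheme_def by blast
    show "s \<in> carrier (str X V)" by (rule s)
    show "\<zero>\<^bsub>str X V\<^esub> \<in> carrier (str X V)"
      using ringed_cring[OF rs V] by (simp add: cring.cring_simprules)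
    fix W assume "W \<in> ?\<C>"
    then obtain U where U: "affine_open X U" "W = V \<inter> U" by blast
    then show W: "openin (base X) W" using V by (simp add: affine_open_def openin_Int)
    have sub: "W \<subseteq> V" "W \<subseteq> U" using U by auto
    have "\<not> germ_unit X x W (res X V W s)" if "x \<in> W" for x
    proof
      assume "germ_unit X x W (res X V W s)"
      then obtain W' where "openin (base X) W'" "x \<in> W'" "W' \<subseteq> W" "res X W W' (res X V W s) \<in> Units (str X W')"
        unfolding germ_unit_def by blast
      moreover from this have "res X W W' (res X V W s) = res X V W' s"
        using ringed_res_res[OF rs V W _ _ sub(1) s] by blast
      ultimately have "germ_unit X x V s" unfolding germ_unit_def using sub(1) by (metis order_trans)
      then show False using no_unit that sub(1) by blast
    qed
    then have "res X V W s = \<zero>\<^bsub>str X W\<^esub>"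
      using no_unit_germ_in_affine[OF rs X(2) U(1) W sub(2) ring_hom_closed[OF ringed_res_hom[OF rs V W sub(1)] s]]
      by blast
    then show "res X V W s = res X V W \<zero>\<^bsub>str X V\<^esub>"
      using ring_hom_zero'[OF ringed_res_hom[OF rs V W sub(1)] ringed_cring[OF rs V] ringed_cring[OF rs W]]
      by simp
  qed
qed

text \<open>The interface between scheme theory and the algebra that follows: once these
  consequences are available, the affine charts of \<open>X\<close> no longer appear. Nonemptiness
  is required wherever the zero ring over the empty set would make the claim false.\<close>

locale integral_space =
  fixes X :: "('p, 'r) ringed_space"
  assumes ringed: "is_ringed_space X"
    and points_nonempty: "points X \<noteq> {}"
    and one_not_zero: "\<And>U. openin (base X) U \<Longrightarrow> U \<noteq> {} \<Longrightarrow> \<one>\<^bsub>str X U\<^esub> \<noteq> \<zero>\<^bsub>str X U\<^esub>"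
    and opens_meet: "\<And>U V. openin (base X) U \<Longrightarrow> openin (base X) V \<Longrightarrow> U \<noteq> {} \<Longrightarrow> V \<noteq> {} \<Longrightarrow> U \<inter> V \<noteq> {}"
    and no_zero_divisors: "\<And>U f g. openin (base X) U \<Longrightarrow> f \<in> carrier (str X U) \<Longrightarrow> g \<in> carrier (str X U)
      \<Longrightarrow> f \<otimes>\<^bsub>str X U\<^esub> g = \<zero>\<^bsub>str X U\<^esub> \<Longrightarrow> f = \<zero>\<^bsub>str X U\<^esub> \<or> g = \<zero>\<^bsub>str X U\<^esub>"
    and res_eq_zero: "\<And>U W f. openin (base X) U \<Longrightarrow> openin (base X) W \<Longrightarrow> W \<subseteq> U \<Longrightarrow> W \<noteq> {}
      \<Longrightarrow> f \<in> carrier (str X U) \<Longrightarrow> res X U W f = \<zero>\<^bsub>str X W\<^esub> \<Longrightarrow> f = \<zero>\<^bsub>str X U\<^esub>"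

lemma irreducible_space_opens_meet:
  assumes "irreducible_space T" "openin T U" "openin T V" "U \<noteq> {}" "V \<noteq> {}"
  shows "U \<inter> V \<noteq> {}"
proof
  assume disj: "U \<inter> V = {}"
  have sub: "U \<subseteq> topspace T" "V \<subseteq> topspace T" using assms by (auto dest: openin_subset)
  have "closedin T (topspace T - U)" "closedin T (topspace T - V)"
    using assms by auto
  moreover have "(topspace T - U) \<union> (topspace T - V) = topspace T" using disj by blast
  ultimately have "topspace T - U = topspace T \<or> topspace T - V = topspace T"
    using assms(1) unfolding irreducible_space_def by blast
  then show False using sub assms(4,5) by blast
qed

lemma integral_scheme:
  assumes X: "scheme X" "reduced X" and irr: "irreducible_space (base X)"
  shows "integral_space X"
proof -
  have rs: "is_ringed_space X" using X(1) by (simp add: scheme_def locally_ringed_space_def)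
  have one: "\<one>\<^bsub>str X U\<^esub> \<noteq> \<zero>\<^bsub>str X U\<^esub>" if "openin (base X) U" "U \<noteq> {}" for U
  proof -
    have "\<forall>x U. openin (base X) U \<and> x \<in> U \<longrightarrow> \<one>\<^bsub>str X U\<^esub> \<noteq> \<zero>\<^bsub>str X U\<^esub>"
      using X(1) unfolding scheme_def locally_ringed_space_def by (elim conjE)
    then show ?thesis using that by blast
  qed
  have meet: "U \<inter> V \<noteq> {}" if "openin (base X) U" "openin (base X) V" "U \<noteq> {}" "V \<noteq> {}" for U V
    using irreducible_space_opens_meet[OF irr that] .
  \<comment> \<open>The points where the germ of \<open>s\<close> is invertible.\<close>
  define D where "D U s = {x \<in> U. germ_unit X x U s}" for U s
  have openD: "openin (base X) (D U s)" if "openin (base X) U" for U s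
  proof (subst openin_subopen, intro ballI)
    fix x assume "x \<in> D U s"
    then obtain W where W: "openin (base X) W" "x \<in> W" "W \<subseteq> U" "res X U W s \<in> Units (str X W)"
      unfolding D_def germ_unit_def by blast
    then have "W \<subseteq> D U s" unfolding D_def germ_unit_def by blast
    then show "\<exists>W. openin (base X) W \<and> x \<in> W \<and> W \<subseteq> D U s" using W by blast
  qed
  have neD: "D U s \<noteq> {}" if "openin (base X) U" "s \<in> carrier (str X U)" "s \<noteq> \<zero>\<^bsub>str X U\<^esub>" for U s
    using no_unit_germ_zero[OF X that(1,2)] that(3) unfolding D_def by blast
  have inverse: "\<exists>W u. openin (base X) W \<and> x \<in> W \<and> W \<subseteq> U \<and> u \<in> carrier (str X W) \<and>
      res X U W s \<otimes>\<^bsub>str X W\<^esub> u = \<one>\<^bsub>str X W\<^esub>" if "x \<in> D U s" for x U s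
    using that unfolding D_def germ_unit_def Units_def by blast
  show ?thesis
  proof
    show "is_ringed_space X" by (rule rs)
    show "points X \<noteq> {}" using irr by (simp add: irreducible_space_def)
  next
    fix U assume "openin (base X) U" "U \<noteq> {}"
    then show "\<one>\<^bsub>str X U\<^esub> \<noteq> \<zero>\<^bsub>str X U\<^esub>" by (rule one)
  next
    fix U V assume "openin (base X) U" "openin (base X) V" "U \<noteq> {}" "V \<noteq> {}"
    then show "U \<inter> V \<noteq> {}" by (rule meet)
  next
    fix U f g
    assume U: "openin (base X) U" and f: "f \<in> carrier (str X U)" and g: "g \<in> carrier (str X U)"
      and fg: "f \<otimes>\<^bsub>str X U\<^esub> g = \<zero>\<^bsub>str X U\<^esub>"
    show "f = \<zero>\<^bsub>str X U\<^esub> \<or> g = \<zero>\<^bsub>str X U\<^esub>"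
    proof (rule ccontr)
      assume "\<not> ?thesis"
      \<comment> \<open>At a point of both loci \<open>f\<close> and \<open>g\<close> have inverses
        on a common neighbourhood, and multiplying \<open>f g = 0\<close> by them gives
        \<open>\<one> = \<zero>\<close> there.\<close>
      then have "D U f \<inter> D U g \<noteq> {}" using neD[OF U f] neD[OF U g] openD[OF U] meet by metis
      then obtain x where x: "x \<in> D U f" "x \<in> D U g" by blast
      obtain W1 u where 1: "openin (base X) W1" "x \<in> W1" "W1 \<subseteq> U" "u \<in> carrier (str X W1)"
        "res X U W1 f \<otimes>\<^bsub>str X W1\<^esub> u = \<one>\<^bsub>str X W1\<^esub>" using inverse[OF x(1)] by blast
      obtain W2 v where 2: "openin (base X) W2" "x \<in> W2" "W2 \<subseteq> U" "v \<in> carrier (str X W2)"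
        "res X U W2 g \<otimes>\<^bsub>str X W2\<^esub> v = \<one>\<^bsub>str X W2\<^esub>" using inverse[OF x(2)] by blast
      define W where "W = W1 \<inter> W2"
      have W: "openin (base X) W" "x \<in> W" "W \<subseteq> W1" "W \<subseteq> W2" "W \<subseteq> U"
        unfolding W_def using 1 2 by auto
      interpret W: cring "str X W" by (rule ringed_cring[OF rs W(1)])
      note h = ringed_res_hom[OF rs U W(1,5)] and h1 = ringed_res_hom[OF rs 1(1) W(1,3)]
        and h2 = ringed_res_hom[OF rs 2(1) W(1,4)]
      let ?f = "res X U W f" and ?g = "res X U W g" and ?u = "res X W1 W u" and ?v = "res X W2 W v"
      have car: "?f \<in> carrier (str X W)" "?g \<in> carrier (str X W)" "?u \<in> carrier (str X W)" "?v \<in> carrier (str X W)"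
        using ring_hom_closed[OF h] f g ring_hom_closed[OF h1] 1(4) ring_hom_closed[OF h2] 2(4) by auto
      have fu: "?f \<otimes>\<^bsub>str X W\<^esub> ?u = \<one>\<^bsub>str X W\<^esub>"
        using ring_hom_mult[OF h1 ring_hom_closed[OF ringed_res_hom[OF rs U 1(1,3)] f] 1(4)] 1(5)
          ring_hom_one[OF h1] ringed_res_res[OF rs U 1(1) W(1,3) 1(3) f] by simp
      have gv: "?g \<otimes>\<^bsub>str X W\<^esub> ?v = \<one>\<^bsub>str X W\<^esub>"
        using ring_hom_mult[OF h2 ring_hom_closed[OF ringed_res_hom[OF rs U 2(1,3)] g] 2(4)] 2(5)
          ring_hom_one[OF h2] ringed_res_res[OF rs U 2(1) W(1,4) 2(3) g] by simp
      have "?f \<otimes>\<^bsub>str X W\<^esub> ?g = \<zero>\<^bsub>str X W\<^esub>"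
        using ring_hom_mult[OF h f g] fg ring_hom_zero'[OF h ringed_cring[OF rs U] W.is_cring] by simp
      then have "(?f \<otimes>\<^bsub>str X W\<^esub> ?g) \<otimes>\<^bsub>str X W\<^esub> (?u \<otimes>\<^bsub>str X W\<^esub> ?v) = \<zero>\<^bsub>str X W\<^esub>"
        using car by simp
      moreover have "(?f \<otimes>\<^bsub>str X W\<^esub> ?g) \<otimes>\<^bsub>str X W\<^esub> (?u \<otimes>\<^bsub>str X W\<^esub> ?v)
          = (?f \<otimes>\<^bsub>str X W\<^esub> ?u) \<otimes>\<^bsub>str X W\<^esub> (?g \<otimes>\<^bsub>str X W\<^esub> ?v)"
        using car by (simp add: W.m_ac)
      ultimately show False using fu gv one[OF W(1)] W(2) by auto
    qed
  next
    fix U W f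
    assume U: "openin (base X) U" and W: "openin (base X) W" "W \<subseteq> U" "W \<noteq> {}"
      and f: "f \<in> carrier (str X U)" "res X U W f = \<zero>\<^bsub>str X W\<^esub>"
    show "f = \<zero>\<^bsub>str X U\<^esub>"
    proof (rule ccontr)
      assume "f \<noteq> \<zero>\<^bsub>str X U\<^esub>"
      \<comment> \<open>The invertibility locus of \<open>f\<close> meets \<open>W\<close>; near a
        common point the restriction of \<open>f\<close> is both zero and invertible.\<close>
      then have "D U f \<inter> W \<noteq> {}" using neD[OF U f(1)] openD[OF U] meet W by metis
      then obtain x where x: "x \<in> D U f" "x \<in> W" by blast
      obtain W1 u where 1: "openin (base X) W1" "x \<in> W1" "W1 \<subseteq> U" "u \<in> carrier (str X W1)"
        "res X U W1 f \<otimes>\<^bsub>str X W1\<^esub> u = \<one>\<^bsub>str X W1\<^esub>" using inverse[OF x(1)] by blast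
      define Y where "Y = W1 \<inter> W"
      have Y: "openin (base X) Y" "x \<in> Y" "Y \<subseteq> W1" "Y \<subseteq> W" "Y \<subseteq> U"
        unfolding Y_def using 1 W x by auto
      interpret Y: cring "str X Y" by (rule ringed_cring[OF rs Y(1)])
      note h1 = ringed_res_hom[OF rs 1(1) Y(1,3)] and h2 = ringed_res_hom[OF rs W(1) Y(1,4)]
      have "res X U Y f = \<zero>\<^bsub>str X Y\<^esub>"
        using ringed_res_res[OF rs U W(1) Y(1,4) W(2) f(1)] f(2)
          ring_hom_zero'[OF h2 ringed_cring[OF rs W(1)] Y.is_cring] by simp
      moreover have "res X U Y f \<otimes>\<^bsub>str X Y\<^esub> res X W1 Y u = \<one>\<^bsub>str X Y\<^esub>"
        using ring_hom_mult[OF h1 ring_hom_closed[OF ringed_res_hom[OF rs U 1(1,3)] f(1)] 1(4)] 1(5)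
          ring_hom_one[OF h1] ringed_res_res[OF rs U 1(1) Y(1,3) 1(3) f(1)] by simp
      ultimately show False using ring_hom_closed[OF h1 1(4)] one[OF Y(1)] Y(2) by auto
    qed
  qed
qed

section \<open>Evaluation of subspaces of sections\<close>

text \<open>The records for \<open>H\<close> and for \<open>O(U)\<close> over \<open>k\<close> copy
  the additive part of an existing structure and change only the scalars. This transfers the group
  axioms to them.\<close>

lemma abelian_group_cong:
  assumes "abelian_group M" and "carrier N = carrier M" "\<And>x y. x \<oplus>\<^bsub>N\<^esub> y = x \<oplus>\<^bsub>M\<^esub> y" "\<zero>\<^bsub>N\<^esub> = \<zero>\<^bsub>M\<^esub>"
  shows "abelian_group N"
proof -
  interpret M: abelian_group M by fact
  show ?thesis
    by (rule abelian_groupI) (auto simp: assms(2-4) M.a_ac intro: M.l_neg M.a_inv_closed)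
qed

lemma spec_const_hom:
  fixes k :: "'k ring"
  assumes k: "cring k"
  shows "spec_const k \<in> ring_hom k (str (Spec k) (prime_spectrum k))"
proof -
  interpret cring k by (rule k)
  let ?P = "prime_spectrum k"
  have P: "openin (spec_topology k) ?P" using openin_topspace[of "spec_topology k"] by (simp add: topspace_spec)
  have one: "\<one>\<^bsub>k\<^esub> \<notin> Q" if "Q \<in> ?P" for Q
    using localization_at.one_denom[OF open_localization_at[OF P that]] by simp
  have eq: "spec_const k = (\<lambda>a. frac_section k ?P a \<one>\<^bsub>k\<^esub>)"
    by (simp add: fun_eq_iff spec_const_def frac_section_def)
  show ?thesis
    unfolding eq
    by (rule ring_hom_memI)
      (use one in \<open>simp_all add: frac_section_closed[OF P] frac_section_mult[OF P] frac_section_add[OF P] frac_section_one[OF P]\<close>)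
qed

text \<open>The part of the setting in which \<open>E\<close> is any sheaf of modules; local
  triviality enters later, through \<open>framed_sheaf\<close>.\<close>

locale sheaf_over_field = integral_space X for X :: "('p, 'r) ringed_space" +
  fixes k :: "'k ring" and \<pi> :: "'p \<Rightarrow> 'k set"
    and \<pi>s :: "'k set set \<Rightarrow> ('k set \<Rightarrow> ('k \<times> 'k) set) \<Rightarrow> 'r"
    and E :: "('p, 'r, 'm) mod_sheaf"
  assumes field_k: "field k" and structure_map: "lrs_morphism X (Spec k) \<pi> \<pi>s"
    and modules: "sheaf_of_modules X E"
begin

abbreviation "H \<equiv> global_sections k X \<pi>s E"
abbreviation "\<O> U \<equiv> str X U"
abbreviation "\<O>\<^sub>k U \<equiv> str_module k X \<pi>s U"
abbreviation "sc U \<equiv> scalar k X \<pi>s U"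
abbreviation "\<E> U \<equiv> msec E U"
abbreviation "\<Gamma> \<equiv> carrier (\<E> (points X))"
abbreviation "\<rho> U \<equiv> mres E (points X) U"

sublocale k: field k by (rule field_k)

lemma cring_O: "openin (base X) U \<Longrightarrow> cring (\<O> U)"
  using ringed by (rule ringed_cring)

lemma res_hom: "openin (base X) U \<Longrightarrow> openin (base X) W \<Longrightarrow> W \<subseteq> U \<Longrightarrow> res X U W \<in> ring_hom (\<O> U) (\<O> W)"
  using ringed by (rule ringed_res_hom)

lemma open_sub_points: "openin (base X) U \<Longrightarrow> U \<subseteq> points X"
  by (rule openin_subset)

lemma open_points: "openin (base X) (points X)"
  by (rule openin_topspace)

lemma points_Spec: "points (Spec k) = prime_spectrum k"
  by (simp add: Spec_def topspace_spec)

lemma global_scalar_hom: "\<pi>s (prime_spectrum k) \<circ> spec_const k \<in> ring_hom k (\<O> (points X))"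
proof -
  let ?P = "prime_spectrum k"
  have "openin (base (Spec k)) ?P" unfolding points_Spec[symmetric] by (rule openin_topspace)
  then have 1: "\<pi>s ?P \<in> ring_hom (str (Spec k) ?P) (\<O> (preim X \<pi> ?P))"
    using structure_map unfolding lrs_morphism_def by blast
  have "continuous_map (base X) (base (Spec k)) \<pi>"
    using structure_map unfolding lrs_morphism_def by blast
  then have "\<pi> ` points X \<subseteq> ?P"
    using continuous_map_image_subset_topspace[of "base X" "base (Spec k)" \<pi>] points_Spec by simp
  then have "preim X \<pi> ?P = points X" by (auto simp: preim_def)
  with 1 show ?thesis using ring_hom_trans[OF spec_const_hom[OF k.is_cring]] by simp
qed

lemma scalar_hom:
  assumes U: "openin (base X) U"
  shows "sc U \<in> ring_hom k (\<O> U)"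
proof -
  have "sc U = res X (points X) U \<circ> (\<pi>s (prime_spectrum k) \<circ> spec_const k)"
    by (simp add: fun_eq_iff scalar_def points_Spec)
  then show ?thesis
    using ring_hom_trans[OF global_scalar_hom res_hom[OF open_points U open_sub_points[OF U]]] by simp
qed

lemma scalar_closed: "openin (base X) U \<Longrightarrow> a \<in> carrier k \<Longrightarrow> sc U a \<in> carrier (\<O> U)"
  using ring_hom_closed[OF scalar_hom] .

text \<open>A nonzero scalar is invertible in the field, so its image is invertible in
  \<open>O(U)\<close>, and \<open>\<one> \<noteq> \<zero>\<close> over a nonempty set. This carries
  linear independence over \<open>O(X)\<close> down to \<open>k\<close>.\<close>

lemma scalar_eq_zero:
  assumes U: "openin (base X) U" "U \<noteq> {}" and a: "a \<in> carrier k" "sc U a = \<zero>\<^bsub>\<O> U\<^esub>"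
  shows "a = \<zero>\<^bsub>k\<^esub>"
proof (rule ccontr)
  interpret U: cring "\<O> U" by (rule cring_O[OF U(1)])
  assume "a \<noteq> \<zero>\<^bsub>k\<^esub>"
  then have "a \<in> Units k" using a(1) by (simp add: k.field_Units)
  then have i: "inv\<^bsub>k\<^esub> a \<in> carrier k" "a \<otimes>\<^bsub>k\<^esub> inv\<^bsub>k\<^esub> a = \<one>\<^bsub>k\<^esub>" by auto
  then have "sc U a \<otimes>\<^bsub>\<O> U\<^esub> sc U (inv\<^bsub>k\<^esub> a) = \<one>\<^bsub>\<O> U\<^esub>"
    using ring_hom_mult[OF scalar_hom[OF U(1)] a(1) i(1)] ring_hom_one[OF scalar_hom[OF U(1)]] by simp
  then show False using a(2) scalar_closed[OF U(1) i(1)] one_not_zero[OF U] by simp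
qed

lemma res_scalar:
  assumes "openin (base X) U" "openin (base X) W" "W \<subseteq> U" "a \<in> carrier k"
  shows "res X U W (sc U a) = sc W a"
proof -
  have "\<pi>s (points (Spec k)) (spec_const k a) \<in> carrier (\<O> (points X))"
    using ring_hom_closed[OF global_scalar_hom assms(4)] by (simp add: points_Spec)
  then show ?thesis unfolding scalar_def
    using ringed_res_res[OF ringed open_points assms(1,2,3) open_sub_points[OF assms(1)]] by simp
qed

lemma E_sheaf: "sheaf_on (base X) (\<lambda>U. carrier (\<E> U)) (mres E)"
  using modules[unfolded sheaf_of_modules_def] by (rule conjunct1)

lemma E_module: "openin (base X) U \<Longrightarrow> Module.module (\<O> U) (\<E> U)"
  using modules[unfolded sheaf_of_modules_def, THEN conjunct2, THEN conjunct1] by blast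

lemma mres_add: "\<lbrakk>openin (base X) U; openin (base X) W; W \<subseteq> U; s \<in> carrier (\<E> U); t \<in> carrier (\<E> U)\<rbrakk>
    \<Longrightarrow> mres E U W (s \<oplus>\<^bsub>\<E> U\<^esub> t) = mres E U W s \<oplus>\<^bsub>\<E> W\<^esub> mres E U W t"
  using modules[unfolded sheaf_of_modules_def, THEN conjunct2, THEN conjunct2, THEN conjunct1] by blast

lemma mres_smult: "\<lbrakk>openin (base X) U; openin (base X) W; W \<subseteq> U; c \<in> carrier (\<O> U); s \<in> carrier (\<E> U)\<rbrakk>
    \<Longrightarrow> mres E U W (c \<odot>\<^bsub>\<E> U\<^esub> s) = res X U W c \<odot>\<^bsub>\<E> W\<^esub> mres E U W s"
  using modules[unfolded sheaf_of_modules_def, THEN conjunct2, THEN conjunct2, THEN conjunct2] by blast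

lemma mres_closed: "\<lbrakk>openin (base X) U; openin (base X) W; W \<subseteq> U; s \<in> carrier (\<E> U)\<rbrakk>
    \<Longrightarrow> mres E U W s \<in> carrier (\<E> W)"
  using E_sheaf[unfolded sheaf_on_def, THEN conjunct1] by blast

lemma mres_mres: "\<lbrakk>openin (base X) U; openin (base X) V; openin (base X) W; W \<subseteq> V; V \<subseteq> U; s \<in> carrier (\<E> U)\<rbrakk>
    \<Longrightarrow> mres E V W (mres E U V s) = mres E U W s"
  using E_sheaf[unfolded sheaf_on_def, THEN conjunct2, THEN conjunct2, THEN conjunct1] by blast

lemma E_group: "openin (base X) U \<Longrightarrow> abelian_group (\<E> U)"
  using E_module by (simp add: module_def)

lemma mres_finsum:
  assumes U: "openin (base X) U" "openin (base X) W" "W \<subseteq> U" and f: "f \<in> A \<rightarrow> carrier (\<E> U)"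
  shows "mres E U W (finsum (\<E> U) f A) = finsum (\<E> W) (\<lambda>i. mres E U W (f i)) A"
  using mres_closed[OF U] mres_add[OF U]
  by (intro finsum_additive[OF E_group[OF U(1)] E_group[OF U(2)] _ _ f])

lemma H_simps:
  "carrier H = \<Gamma>"
  "\<zero>\<^bsub>H\<^esub> = \<zero>\<^bsub>\<E> (points X)\<^esub>" "x \<oplus>\<^bsub>H\<^esub> y = x \<oplus>\<^bsub>\<E> (points X)\<^esub> y"
  "a \<odot>\<^bsub>H\<^esub> x = sc (points X) a \<odot>\<^bsub>\<E> (points X)\<^esub> x"
  by (simp_all add: global_sections_def Let_def)

lemma Ok_simps:
  "carrier (\<O>\<^sub>k U) = carrier (\<O> U)"
  "\<zero>\<^bsub>\<O>\<^sub>k U\<^esub> = \<zero>\<^bsub>\<O> U\<^esub>" "x \<oplus>\<^bsub>\<O>\<^sub>k U\<^esub> y = x \<oplus>\<^bsub>\<O> U\<^esub> y" "a \<odot>\<^bsub>\<O>\<^sub>k U\<^esub> x = sc U a \<otimes>\<^bsub>\<O> U\<^esub> x"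
  by (simp_all add: str_module_def)

lemma H_finsum: "finsum H f A = finsum (\<E> (points X)) f A"
  by (simp add: finsum_def finprod_def global_sections_def Let_def)

lemma Ok_finsum: "finsum (\<O>\<^sub>k U) f A = finsum (\<O> U) f A"
  by (simp add: finsum_def finprod_def str_module_def)

lemma H_module: "Module.module k H"
proof -
  interpret M: Module.module "\<O> (points X)" "\<E> (points X)" by (rule E_module[OF open_points])
  note h = scalar_hom[OF open_points]
  note cl = scalar_closed[OF open_points]
  show ?thesis
  proof (rule moduleI)
    show "cring k" by (rule k.is_cring)
    show "abelian_group H" by (rule abelian_group_cong[OF M.abelian_group_axioms]) (simp_all add: H_simps)
  qed (use cl in \<open>simp_all add: H_simps M.smult_l_distr M.smult_r_distr M.smult_assoc1
      ring_hom_add[OF h] ring_hom_mult[OF h] ring_hom_one[OF h]\<close>)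
qed

lemma Ok_module: 
  assumes U: "openin (base X) U"
  shows "Module.module k (\<O>\<^sub>k U)"
proof -
  interpret U: cring "\<O> U" by (rule cring_O[OF U])
  note h = scalar_hom[OF U]
  note cl = scalar_closed[OF U]
  show ?thesis
  proof (rule moduleI)
    show "cring k" by (rule k.is_cring)
    show "abelian_group (\<O>\<^sub>k U)" by (rule abelian_group_cong[OF U.abelian_group_axioms]) (simp_all add: Ok_simps)
  qed (use cl in \<open>simp_all add: Ok_simps U.l_distr U.r_distr U.m_assoc
      ring_hom_add[OF h] ring_hom_mult[OF h] ring_hom_one[OF h]\<close>)
qed

end

section \<open>The tensor sheaf of a space of sections and its evaluation map\<close>

locale sections_subspace = sheaf_over_field X k \<pi> \<pi>s E
  for X :: "('p, 'r) ringed_space" and k :: "'k ring" and \<pi> :: "'p \<Rightarrow> 'k set"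
    and \<pi>s :: "'k set set \<Rightarrow> ('k set \<Rightarrow> ('k \<times> 'k) set) \<Rightarrow> 'r"
    and E :: "('p, 'r, 'm) mod_sheaf" +
  fixes V :: "'m set"
  assumes submod: "submodule k V H"
begin

abbreviation "V\<^sub>k \<equiv> sub_module H V"
abbreviation "VO \<equiv> tensor_sheaf k X \<pi>s V\<^sub>k"
abbreviation "VT U \<equiv> tensor_group k V\<^sub>k (\<O>\<^sub>k U)"
abbreviation "pt U \<equiv> pure_tensor k V\<^sub>k (\<O>\<^sub>k U)"

lemma Vk_module: "Module.module k V\<^sub>k"
proof -
  interpret H: Module.module k H by (rule H_module)
  show ?thesis unfolding sub_module_def by (rule H.submodule_is_module[OF submod])
qed

lemma V_section: "v \<in> V \<Longrightarrow> v \<in> \<Gamma>"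
  using submodule.subset[OF submod] by (auto simp: H_simps)

lemma Vk_simps: "carrier V\<^sub>k = V" "x \<oplus>\<^bsub>V\<^sub>k\<^esub> y = x \<oplus>\<^bsub>\<E> (points X)\<^esub> y"
  "a \<odot>\<^bsub>V\<^sub>k\<^esub> x = sc (points X) a \<odot>\<^bsub>\<E> (points X)\<^esub> x"
  by (simp_all add: sub_module_def H_simps)

lemma tensor: "openin (base X) U \<Longrightarrow> tensor_modules k V\<^sub>k (\<O>\<^sub>k U)"
  unfolding tensor_modules_def using Vk_module Ok_module by simp

lemma gr_closed: "openin (base X) U \<Longrightarrow> v \<in> V \<Longrightarrow> \<rho> U v \<in> carrier (\<E> U)"
  using mres_closed[OF open_points _ open_sub_points V_section] .

lemma E_comm_group: "openin (base X) U \<Longrightarrow> comm_group (add_monoid (\<E> U))"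
  using abelian_group.a_comm_group[OF E_group] .

text \<open>The pairing of \<open>v\<close> and \<open>f\<close> is balanced because a scalar acting
  on a global section restricts to the same scalar acting over \<open>U\<close>; the universal
  property then makes \<open>tensor_lift\<close> meaningful here.\<close>

lemma evaluation_lift:
  assumes U: "openin (base X) U"
  shows evaluation_hom: "evaluation X E U \<in> hom (VT U) (add_monoid (\<E> U))"
    and evaluation_pure: "\<And>v f. v \<in> V \<Longrightarrow> f \<in> carrier (\<O> U) \<Longrightarrow>
      evaluation X E U (pt U v f) = f \<odot>\<^bsub>\<E> U\<^esub> \<rho> U v"
proof -
  interpret EU: Module.module "\<O> U" "\<E> U" by (rule E_module[OF U])
  interpret tensor_modules k V\<^sub>k "\<O>\<^sub>k U" by (rule tensor[OF U])
  let ?h = "\<lambda>v f. f \<odot>\<^bsub>\<E> U\<^esub> \<rho> U v"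
  have 1: "?h v f \<in> carrier (add_monoid (\<E> U))" if "v \<in> carrier V\<^sub>k" "f \<in> carrier (\<O>\<^sub>k U)" for v f
    using that gr_closed[OF U] by (simp add: Vk_simps Ok_simps)
  have 2: "?h (v \<oplus>\<^bsub>V\<^sub>k\<^esub> v') f = ?h v f \<otimes>\<^bsub>add_monoid (\<E> U)\<^esub> ?h v' f"
    if "v \<in> carrier V\<^sub>k" "v' \<in> carrier V\<^sub>k" "f \<in> carrier (\<O>\<^sub>k U)" for v v' f
    using that gr_closed[OF U] mres_add[OF open_points U open_sub_points[OF U] V_section V_section]
    by (simp add: Vk_simps Ok_simps EU.smult_r_distr)
  have 3: "?h v (f \<oplus>\<^bsub>\<O>\<^sub>k U\<^esub> f') = ?h v f \<otimes>\<^bsub>add_monoid (\<E> U)\<^esub> ?h v f'"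
    if "v \<in> carrier V\<^sub>k" "f \<in> carrier (\<O>\<^sub>k U)" "f' \<in> carrier (\<O>\<^sub>k U)" for v f f'
    using that gr_closed[OF U] by (simp add: Vk_simps Ok_simps EU.smult_l_distr)
  have 4: "?h (a \<odot>\<^bsub>V\<^sub>k\<^esub> v) f = ?h v (a \<odot>\<^bsub>\<O>\<^sub>k U\<^esub> f)"
    if "a \<in> carrier k" "v \<in> carrier V\<^sub>k" "f \<in> carrier (\<O>\<^sub>k U)" for a v f
    using that gr_closed[OF U] scalar_closed[OF U] scalar_closed[OF open_points]
      mres_smult[OF open_points U open_sub_points[OF U] _ V_section]
      res_scalar[OF open_points U open_sub_points[OF U]]
    by (simp add: Vk_simps Ok_simps EU.m_comm flip: EU.smult_assoc1)
  note E' = E_comm_group[OF U]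
  show "evaluation X E U \<in> hom (VT U) (add_monoid (\<E> U))"
    unfolding evaluation_def by (rule lift_hom[OF E' 1 2 3 4])
  fix v f assume "v \<in> V" "f \<in> carrier (\<O> U)"
  then show "evaluation X E U (pt U v f) = f \<odot>\<^bsub>\<E> U\<^esub> \<rho> U v"
    unfolding evaluation_def by (intro lift_pure[OF E' 1 2 3 4]) (simp_all add: Vk_simps Ok_simps)
qed

lemma tensor_sheaf_simps:
  "carrier (msec VO U) = carrier (VT U)" "x \<oplus>\<^bsub>msec VO U\<^esub> y = x \<otimes>\<^bsub>VT U\<^esub> y"
  "g \<odot>\<^bsub>msec VO U\<^esub> x = tensor_lift (VT U) (\<lambda>v f. pt U v (g \<otimes>\<^bsub>\<O> U\<^esub> f)) x"
  "mres VO U W x = tensor_lift (VT W) (\<lambda>v f. pt W v (res X U W f)) x"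
  by (simp_all add: tensor_sheaf_def Let_def)

lemma smult_lift:
  assumes U: "openin (base X) U" and g: "g \<in> carrier (\<O> U)"
  shows smult_hom: "(\<lambda>x. g \<odot>\<^bsub>msec VO U\<^esub> x) \<in> hom (VT U) (VT U)"
    and smult_pure: "\<And>v f. v \<in> V \<Longrightarrow> f \<in> carrier (\<O> U) \<Longrightarrow>
      g \<odot>\<^bsub>msec VO U\<^esub> pt U v f = pt U v (g \<otimes>\<^bsub>\<O> U\<^esub> f)"
proof -
  interpret O: cring "\<O> U" by (rule cring_O[OF U])
  interpret tensor_modules k V\<^sub>k "\<O>\<^sub>k U" by (rule tensor[OF U])
  let ?h = "\<lambda>v f. pt U v (g \<otimes>\<^bsub>\<O> U\<^esub> f)"
  have 1: "?h v f \<in> carrier (VT U)" if "v \<in> carrier V\<^sub>k" "f \<in> carrier (\<O>\<^sub>k U)" for v f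
    using that g by (intro pure_closed) (simp_all add: Ok_simps)
  have 2: "?h (v \<oplus>\<^bsub>V\<^sub>k\<^esub> v') f = ?h v f \<otimes>\<^bsub>VT U\<^esub> ?h v' f"
    if "v \<in> carrier V\<^sub>k" "v' \<in> carrier V\<^sub>k" "f \<in> carrier (\<O>\<^sub>k U)" for v v' f
    using that g by (intro pure_add_left) (simp_all add: Ok_simps)
  have 3: "?h v (f \<oplus>\<^bsub>\<O>\<^sub>k U\<^esub> f') = ?h v f \<otimes>\<^bsub>VT U\<^esub> ?h v f'"
    if "v \<in> carrier V\<^sub>k" "f \<in> carrier (\<O>\<^sub>k U)" "f' \<in> carrier (\<O>\<^sub>k U)" for v f f'
    using that g pure_add_right[of v "g \<otimes>\<^bsub>\<O> U\<^esub> f" "g \<otimes>\<^bsub>\<O> U\<^esub> f'"]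
    by (simp add: Ok_simps O.r_distr)
  have 4: "?h (a \<odot>\<^bsub>V\<^sub>k\<^esub> v) f = ?h v (a \<odot>\<^bsub>\<O>\<^sub>k U\<^esub> f)"
    if "a \<in> carrier k" "v \<in> carrier V\<^sub>k" "f \<in> carrier (\<O>\<^sub>k U)" for a v f
    using that g pure_balanced[of a v "g \<otimes>\<^bsub>\<O> U\<^esub> f"] scalar_closed[OF U]
    by (simp add: Ok_simps O.m_lcomm)
  show "(\<lambda>x. g \<odot>\<^bsub>msec VO U\<^esub> x) \<in> hom (VT U) (VT U)"
    unfolding tensor_sheaf_simps by (rule lift_hom[OF T.comm_group_axioms 1 2 3 4])
  fix v f assume "v \<in> V" "f \<in> carrier (\<O> U)"
  then show "g \<odot>\<^bsub>msec VO U\<^esub> pt U v f = pt U v (g \<otimes>\<^bsub>\<O> U\<^esub> f)"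
    unfolding tensor_sheaf_simps by (intro lift_pure[OF T.comm_group_axioms 1 2 3 4]) (simp_all add: Vk_simps Ok_simps)
qed

lemma restrict_lift:
  assumes U: "openin (base X) U" and W: "openin (base X) W" "W \<subseteq> U"
  shows restrict_hom: "mres VO U W \<in> hom (VT U) (VT W)"
    and restrict_pure: "\<And>v f. v \<in> V \<Longrightarrow> f \<in> carrier (\<O> U) \<Longrightarrow>
      mres VO U W (pt U v f) = pt W v (res X U W f)"
proof -
  interpret tensor_modules k V\<^sub>k "\<O>\<^sub>k U" by (rule tensor[OF U])
  interpret W: tensor_modules k V\<^sub>k "\<O>\<^sub>k W" by (rule tensor[OF W(1)])
  note h = res_hom[OF U W]
  note cl = ring_hom_closed[OF h]
  let ?h = "\<lambda>v f. pt W v (res X U W f)"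
  have 1: "?h v f \<in> carrier (VT W)" if "v \<in> carrier V\<^sub>k" "f \<in> carrier (\<O>\<^sub>k U)" for v f
    using that cl by (intro W.pure_closed) (simp_all add: Ok_simps)
  have 2: "?h (v \<oplus>\<^bsub>V\<^sub>k\<^esub> v') f = ?h v f \<otimes>\<^bsub>VT W\<^esub> ?h v' f"
    if "v \<in> carrier V\<^sub>k" "v' \<in> carrier V\<^sub>k" "f \<in> carrier (\<O>\<^sub>k U)" for v v' f
    using that cl by (intro W.pure_add_left) (simp_all add: Ok_simps)
  have 3: "?h v (f \<oplus>\<^bsub>\<O>\<^sub>k U\<^esub> f') = ?h v f \<otimes>\<^bsub>VT W\<^esub> ?h v f'"
    if "v \<in> carrier V\<^sub>k" "f \<in> carrier (\<O>\<^sub>k U)" "f' \<in> carrier (\<O>\<^sub>k U)" for v f f'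
    using that cl W.pure_add_right[of v "res X U W f" "res X U W f'"]
    by (simp add: Ok_simps ring_hom_add[OF h])
  have 4: "?h (a \<odot>\<^bsub>V\<^sub>k\<^esub> v) f = ?h v (a \<odot>\<^bsub>\<O>\<^sub>k U\<^esub> f)"
    if "a \<in> carrier k" "v \<in> carrier V\<^sub>k" "f \<in> carrier (\<O>\<^sub>k U)" for a v f
    using that cl W.pure_balanced[of a v "res X U W f"] scalar_closed[OF U] res_scalar[OF U W]
    by (simp add: Ok_simps ring_hom_mult[OF h])
  have eq: "mres VO U W = tensor_lift (VT W) ?h"
    by (simp add: tensor_sheaf_def Let_def)
  show "mres VO U W \<in> hom (VT U) (VT W)"
    unfolding eq by (rule lift_hom[OF W.T.comm_group_axioms 1 2 3 4])
  fix v f assume "v \<in> V" "f \<in> carrier (\<O> U)"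
  then show "mres VO U W (pt U v f) = pt W v (res X U W f)"
    unfolding eq by (intro lift_pure[OF W.T.comm_group_axioms 1 2 3 4]) (simp_all add: Vk_simps Ok_simps)
qed

text \<open>Both sides of each compatibility are group homomorphisms on the tensor product, so
  comparing them on pure tensors is enough.\<close>

lemma evaluation_sheaf_hom: "sheaf_hom X VO E (evaluation X E)"
  unfolding sheaf_hom_def
proof (intro conjI allI impI)
  fix U assume U: "openin (base X) U"
  interpret EU: Module.module "\<O> U" "\<E> U" by (rule E_module[OF U])
  interpret tensor_modules k V\<^sub>k "\<O>\<^sub>k U" by (rule tensor[OF U])
  note ev = evaluation_hom[OF U]
  have smult: "evaluation X E U (g \<odot>\<^bsub>msec VO U\<^esub> x) = g \<odot>\<^bsub>\<E> U\<^esub> evaluation X E U x"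
    if g: "g \<in> carrier (\<O> U)" and x: "x \<in> carrier (VT U)" for g x
  proof (rule hom_eqI[where G = "add_monoid (\<E> U)" and x = x and f = "\<lambda>x. evaluation X E U (g \<odot>\<^bsub>msec VO U\<^esub> x)"
        and g = "\<lambda>x. g \<odot>\<^bsub>\<E> U\<^esub> evaluation X E U x"])
    show "(\<lambda>x. evaluation X E U (g \<odot>\<^bsub>msec VO U\<^esub> x)) \<in> hom (VT U) (add_monoid (\<E> U))"
      using hom_compose[OF smult_hom[OF U g] ev] by (simp add: comp_def)
    show "(\<lambda>x. g \<odot>\<^bsub>\<E> U\<^esub> evaluation X E U x) \<in> hom (VT U) (add_monoid (\<E> U))"
    proof (rule homI)
      fix x y assume xy: "x \<in> carrier (VT U)" "y \<in> carrier (VT U)"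
      have cl: "evaluation X E U x \<in> carrier (\<E> U)" "evaluation X E U y \<in> carrier (\<E> U)"
        using hom_in_carrier[OF ev] xy by simp_all
      then show "g \<odot>\<^bsub>\<E> U\<^esub> evaluation X E U x \<in> carrier (add_monoid (\<E> U))" using g by simp
      show "g \<odot>\<^bsub>\<E> U\<^esub> evaluation X E U (x \<otimes>\<^bsub>VT U\<^esub> y)
          = (g \<odot>\<^bsub>\<E> U\<^esub> evaluation X E U x) \<otimes>\<^bsub>add_monoid (\<E> U)\<^esub> (g \<odot>\<^bsub>\<E> U\<^esub> evaluation X E U y)"
        using hom_mult[OF ev xy] cl g by (simp add: EU.smult_r_distr)
    qed
    show "group (add_monoid (\<E> U))" by (rule EU.a_group)
    fix v f assume "v \<in> carrier V\<^sub>k" "f \<in> carrier (\<O>\<^sub>k U)"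
    then have vf: "v \<in> V" "f \<in> carrier (\<O> U)" by (simp_all add: Vk_simps Ok_simps)
    then show "evaluation X E U (g \<odot>\<^bsub>msec VO U\<^esub> pt U v f) = g \<odot>\<^bsub>\<E> U\<^esub> evaluation X E U (pt U v f)"
      using g gr_closed[OF U vf(1)]
      by (simp add: smult_pure[OF U g] evaluation_pure[OF U] EU.smult_assoc1)
  qed (rule x)
  show "evaluation X E U \<in> module_hom (\<O> U) (msec VO U) (\<E> U)"
    unfolding module_hom_def
  proof (intro CollectI conjI allI impI)
    show "evaluation X E U \<in> carrier (msec VO U) \<rightarrow> carrier (\<E> U)"
      using hom_in_carrier[OF ev] by (auto simp: tensor_sheaf_simps(1))
    fix x y assume "x \<in> carrier (msec VO U) \<and> y \<in> carrier (msec VO U)"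
    then show "evaluation X E U (x \<oplus>\<^bsub>msec VO U\<^esub> y) = evaluation X E U x \<oplus>\<^bsub>\<E> U\<^esub> evaluation X E U y"
      using hom_mult[OF ev] by (simp add: tensor_sheaf_simps(1,2))
  next
    fix g x assume "g \<in> carrier (\<O> U) \<and> x \<in> carrier (msec VO U)"
    then show "evaluation X E U (g \<odot>\<^bsub>msec VO U\<^esub> x) = g \<odot>\<^bsub>\<E> U\<^esub> evaluation X E U x"
      using smult by (simp add: tensor_sheaf_simps(1))
  qed
next
  fix U W x
  assume "openin (base X) U \<and> openin (base X) W \<and> W \<subseteq> U \<and> x \<in> carrier (msec VO U)"
  then have U: "openin (base X) U" and W: "openin (base X) W" "W \<subseteq> U" and x: "x \<in> carrier (VT U)"
    by (simp_all add: tensor_sheaf_simps(1))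
  interpret EU: Module.module "\<O> U" "\<E> U" by (rule E_module[OF U])
  interpret EW: Module.module "\<O> W" "\<E> W" by (rule E_module[OF W(1)])
  interpret tensor_modules k V\<^sub>k "\<O>\<^sub>k U" by (rule tensor[OF U])
  have res: "mres E U W \<in> hom (add_monoid (\<E> U)) (add_monoid (\<E> W))"
    using mres_closed[OF U W] mres_add[OF U W] by (auto simp: hom_def)
  show "mres E U W (evaluation X E U x) = evaluation X E W (mres VO U W x)"
  proof (rule hom_eqI[where G = "add_monoid (\<E> W)" and x = x and f = "\<lambda>x. mres E U W (evaluation X E U x)"
        and g = "\<lambda>x. evaluation X E W (mres VO U W x)"])
    show "(\<lambda>x. mres E U W (evaluation X E U x)) \<in> hom (VT U) (add_monoid (\<E> W))"
      using hom_compose[OF evaluation_hom[OF U] res] by (simp add: comp_def)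
    show "(\<lambda>x. evaluation X E W (mres VO U W x)) \<in> hom (VT U) (add_monoid (\<E> W))"
      using hom_compose[OF restrict_hom[OF U W] evaluation_hom[OF W(1)]] by (simp add: comp_def)
    show "group (add_monoid (\<E> W))" by (rule EW.a_group)
    fix v f assume "v \<in> carrier V\<^sub>k" "f \<in> carrier (\<O>\<^sub>k U)"
    then have vf: "v \<in> V" "f \<in> carrier (\<O> U)" by (simp_all add: Vk_simps Ok_simps)
    then show "mres E U W (evaluation X E U (pt U v f)) = evaluation X E W (mres VO U W (pt U v f))"
      using gr_closed[OF U vf(1)] ring_hom_closed[OF res_hom[OF U W] vf(2)]
        mres_mres[OF open_points U W(1) W(2) open_sub_points[OF U] V_section[OF vf(1)]]
      by (simp add: evaluation_pure[OF U] evaluation_pure[OF W(1)] restrict_pure[OF U W] mres_smult[OF U W])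
  qed (rule x)
qed

text \<open>The sections \<open>v i\<close> form a basis of \<open>V\<close>, so every section of \<open>V \<otimes> O\<close> is a sum of
  pure tensors \<open>v i \<otimes> f i\<close>, and injectivity is the linear independence of the \<open>v i\<close> over \<open>O\<close>.\<close>

lemma evaluation_mono:
  assumes v: "\<And>i. i < l \<Longrightarrow> v i \<in> V"
    and span: "\<And>w. w \<in> V \<Longrightarrow> \<exists>c. (\<forall>i<l. c i \<in> carrier k) \<and> w = (\<Oplus>\<^bsub>V\<^sub>k\<^esub>i\<in>{..<l::nat}. c i \<odot>\<^bsub>V\<^sub>k\<^esub> v i)"
    and indep: "\<And>U f. \<lbrakk>openin (base X) U; \<And>i. i < l \<Longrightarrow> f i \<in> carrier (\<O> U);
      (\<Oplus>\<^bsub>\<E> U\<^esub>i\<in>{..<l}. f i \<odot>\<^bsub>\<E> U\<^esub> \<rho> U (v i)) = \<zero>\<^bsub>\<E> U\<^esub>\<rbrakk> \<Longrightarrow> \<forall>i<l. f i = \<zero>\<^bsub>\<O> U\<^esub>"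
  shows "sheaf_mono X VO E (evaluation X E)"
  unfolding sheaf_mono_def
proof (intro conjI allI impI)
  show "sheaf_hom X VO E (evaluation X E)" by (rule evaluation_sheaf_hom)
  fix U assume U: "openin (base X) U"
  interpret EU: Module.module "\<O> U" "\<E> U" by (rule E_module[OF U])
  interpret tensor_modules k V\<^sub>k "\<O>\<^sub>k U" by (rule tensor[OF U])
  interpret ev: group_hom "VT U" "add_monoid (\<E> U)" "evaluation X E U"
    by (simp add: group_hom_def group_hom_axioms_def evaluation_hom[OF U] EU.a_group)
  have ker: "x = \<one>\<^bsub>VT U\<^esub>" if x: "x \<in> carrier (VT U)" "evaluation X E U x = \<zero>\<^bsub>\<E> U\<^esub>" for x
  proof -
    have "\<exists>f. (\<forall>i<l. f i \<in> carrier (\<O>\<^sub>k U)) \<and> x = (\<Otimes>\<^bsub>VT U\<^esub>i\<in>{..<l}. pt U (v i) (f i))"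
      by (rule pure_sum_form[OF _ _ x(1)]) (use v span in \<open>simp_all add: Vk_simps(1)\<close>)
    then obtain f where f: "\<And>i. i < l \<Longrightarrow> f i \<in> carrier (\<O> U)" "x = (\<Otimes>\<^bsub>VT U\<^esub>i\<in>{..<l}. pt U (v i) (f i))"
      by (auto simp: Ok_simps(1))
    have cl: "pt U (v i) (f i) \<in> carrier (VT U)" if "i < l" for i
      using that v f(1) by (intro pure_closed) (simp_all add: Vk_simps Ok_simps)
    have "evaluation X E U x = (\<Oplus>\<^bsub>\<E> U\<^esub>i\<in>{..<l}. evaluation X E U (pt U (v i) (f i)))"
      unfolding f(2) finsum_def using cl
      by (intro hom_finprod[OF T.comm_monoid_axioms EU.a_comm_monoid ev.homh]) auto
    also have "\<dots> = (\<Oplus>\<^bsub>\<E> U\<^esub>i\<in>{..<l}. f i \<odot>\<^bsub>\<E> U\<^esub> \<rho> U (v i))"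
      using v f(1) gr_closed[OF U] by (intro EU.finsum_cong') (auto simp: evaluation_pure[OF U])
    finally have "(\<Oplus>\<^bsub>\<E> U\<^esub>i\<in>{..<l}. f i \<odot>\<^bsub>\<E> U\<^esub> \<rho> U (v i)) = \<zero>\<^bsub>\<E> U\<^esub>" using x(2) by simp
    with U f(1) have "\<forall>i<l. f i = \<zero>\<^bsub>\<O> U\<^esub>" by (rule indep)
    \<comment> \<open>Vanishing coefficients still have to be turned into the trivial tensor: the
      element \<open>w \<otimes> 0\<close> equals its own double.\<close>
    moreover have "pt U w \<zero>\<^bsub>\<O> U\<^esub> = \<one>\<^bsub>VT U\<^esub>" if "w \<in> V" for w
    proof -
      have "pt U w \<zero>\<^bsub>\<O> U\<^esub> \<otimes>\<^bsub>VT U\<^esub> pt U w \<zero>\<^bsub>\<O> U\<^esub> = pt U w \<zero>\<^bsub>\<O> U\<^esub>"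
        using pure_add_right[of w "\<zero>\<^bsub>\<O> U\<^esub>" "\<zero>\<^bsub>\<O> U\<^esub>"] that by (simp add: Vk_simps Ok_simps)
      moreover have "pt U w \<zero>\<^bsub>\<O> U\<^esub> \<in> carrier (VT U)"
        using that by (intro pure_closed) (simp_all add: Vk_simps Ok_simps)
      ultimately show ?thesis using T.r_cancel_one' by metis
    qed
    ultimately show ?thesis unfolding f(2) using v by (intro T.finprod_one_eqI) simp
  qed
  show "inj_on (evaluation X E U) (carrier (msec VO U))"
  proof (rule inj_onI)
    fix x y assume "x \<in> carrier (msec VO U)" "y \<in> carrier (msec VO U)"
      and eq: "evaluation X E U x = evaluation X E U y"
    then have xy: "x \<in> carrier (VT U)" "y \<in> carrier (VT U)" by (simp_all add: tensor_sheaf_simps(1))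
    have "evaluation X E U (x \<otimes>\<^bsub>VT U\<^esub> inv\<^bsub>VT U\<^esub> y) = \<zero>\<^bsub>\<E> U\<^esub>"
      using ev.hom_mult[OF xy(1) T.inv_closed[OF xy(2)]] ev.hom_inv[OF xy(2)] eq ev.hom_closed[OF xy(2)]
        group.r_inv[OF EU.a_group ev.hom_closed[OF xy(2)]] by simp
    then have "x \<otimes>\<^bsub>VT U\<^esub> inv\<^bsub>VT U\<^esub> y = \<one>\<^bsub>VT U\<^esub>" using ker xy by simp
    then show "x = y" using T.inv_solve_right'[of "\<one>\<^bsub>VT U\<^esub>" x y] xy by (simp add: T.inv_solve_right)
  qed
qed

end

section \<open>Linear algebra over the base field\<close>

text \<open>Restricts \<open>V\<close> to the unextended record type on which
  \<open>sub_module\<close> and \<open>ordered_basis\<close> are defined.\<close>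

locale record_vectorspace = vectorspace K V for K :: "'k ring" (structure) and V :: "('k, 'v) module"
begin

text \<open>Let \<open>?w\<close> be the nonzero combination given by \<open>x0\<close>. Complete it
  to a basis of the span of \<open>?w\<close> and the \<open>C i\<close>; the functional is the
  coordinate along \<open>?w\<close>, and \<open>c i\<close> is its value at \<open>C i\<close>.
  Stating the result for the vector \<open>c\<close> shows directly that the linear form in
  \<open>x\<close> vanishes whenever the combination of the \<open>C i\<close> does, also when
  \<open>V\<close> has infinite dimension.\<close>

lemma separating_functional:
  assumes "finite I" "C \<in> I \<rightarrow> carrier V" "x0 \<in> I \<rightarrow> carrier K"
    and "(\<Oplus>\<^bsub>V\<^esub>i\<in>I. x0 i \<odot>\<^bsub>V\<^esub> C i) \<noteq> \<zero>\<^bsub>V\<^esub>"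
  shows "\<exists>c\<in>I \<rightarrow> carrier K. (\<Oplus>i\<in>I. c i \<otimes> x0 i) \<noteq> \<zero> \<and>
    (\<forall>x\<in>I \<rightarrow> carrier K. (\<Oplus>\<^bsub>V\<^esub>i\<in>I. x i \<odot>\<^bsub>V\<^esub> C i) = \<zero>\<^bsub>V\<^esub> \<longrightarrow> (\<Oplus>i\<in>I. c i \<otimes> x i) = \<zero>)"
proof -
  let ?w = "\<Oplus>\<^bsub>V\<^esub>i\<in>I. x0 i \<odot>\<^bsub>V\<^esub> C i"
  have CI: "C i \<in> carrier V" if "i \<in> I" for i using assms(2) that by auto
  have w: "?w \<in> carrier V" using CI assms(3) by (intro M.finsum_closed) auto
  have CV: "C ` I \<subseteq> carrier V" using CI by auto
  have w_ind: "lin_indpt {?w}"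
  proof (rule finite_lin_indpt2)
    fix a assume a: "a \<in> {?w} \<rightarrow> carrier K" "lincomb a {?w} = \<zero>\<^bsub>V\<^esub>"
    then have "a ?w \<odot>\<^bsub>V\<^esub> ?w = \<zero>\<^bsub>V\<^esub>" using w by (simp add: lincomb_def)
    then show "\<forall>v\<in>{?w}. a v = \<zero>"
      using mult_inverse[of "a ?w" ?w "\<zero>\<^bsub>V\<^esub>"] a(1) w assms(4) by (auto simp: rmult_0)
  qed (use w in auto)
  \<comment> \<open>Maximality is sought only among subsets of a finite set, and \<open>?w\<close>
    is kept as a member so that its coordinate is available.\<close>
  let ?P = "\<lambda>S. S \<subseteq> insert ?w (C ` I) \<and> lin_indpt S \<and> ?w \<in> S"
  have "\<exists>B. finite B \<and> maximal B ?P"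
    by (rule maximal_exists[where N = "card (insert ?w (C ` I))" and B = "{?w}"])
      (use w_ind assms(1) in \<open>auto intro: finite_subset card_mono\<close>)
  then obtain B where fin: "finite B" and B_max: "maximal B ?P" by (elim exE conjE)
  have B: "finite B" "?P B" by (rule fin, rule B_max[unfolded maximal_def, THEN conjunct1])
  have max: "S = B" if "B \<subseteq> S" "?P S" for S
    by (rule B_max[unfolded maximal_def, THEN conjunct2, rule_format]) (use that in blast)
  have BV: "B \<subseteq> carrier V" using B(2) w CV by blast
  have "C i \<in> span B" if "i \<in> I" for i
  proof (cases "C i \<in> B")
    case True
    then show ?thesis using in_own_span[OF BV] by blast
  next
    case False
    then have "lin_dep (B \<union> {C i})" using max[of "B \<union> {C i}"] B(2) that by blast
    then show ?thesis using lin_dep_iff_in_span[OF BV _ CI[OF that] False] B(2) by blast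
  qed
  then have "\<forall>i\<in>I. \<exists>t. t \<in> B \<rightarrow> carrier K \<and> lincomb t B = C i"
    using finite_in_span[OF B(1) BV] by blast
  then obtain t where "\<forall>i\<in>I. t i \<in> B \<rightarrow> carrier K \<and> lincomb (t i) B = C i"
    by (rule bchoice[THEN exE])
  then have t: "\<And>i v. i \<in> I \<Longrightarrow> v \<in> B \<Longrightarrow> t i v \<in> carrier K" and tC: "\<And>i. i \<in> I \<Longrightarrow> lincomb (t i) B = C i"
    by auto
  \<comment> \<open>Exchanging the sums exhibits the coordinates in \<open>B\<close> of the
    combination given by \<open>x\<close>; the one along \<open>?w\<close> is linear in
    \<open>x\<close> with coefficients \<open>t i ?w\<close>.\<close>
  have expand: "(\<Oplus>\<^bsub>V\<^esub>i\<in>I. x i \<odot>\<^bsub>V\<^esub> C i) = lincomb (\<lambda>v. \<Oplus>i\<in>I. t i v \<otimes> x i) B"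
    if x: "x \<in> I \<rightarrow> carrier K" for x
  proof -
    have xi: "x i \<in> carrier K" if "i \<in> I" for i using x that by auto
    have "x i \<odot>\<^bsub>V\<^esub> C i = (\<Oplus>\<^bsub>V\<^esub>v\<in>B. (t i v \<otimes> x i) \<odot>\<^bsub>V\<^esub> v)" if i: "i \<in> I" for i
    proof -
      have "x i \<odot>\<^bsub>V\<^esub> C i = lincomb (\<lambda>v. x i \<otimes> t i v) B"
        using lincomb_smult[OF BV, of "t i" "x i"] t[OF i] xi[OF i] tC[OF i] by auto
      also have "\<dots> = (\<Oplus>\<^bsub>V\<^esub>v\<in>B. (t i v \<otimes> x i) \<odot>\<^bsub>V\<^esub> v)"
        unfolding lincomb_def using t[OF i] xi[OF i] BV by (intro M.finsum_cong') (auto simp: m_comm)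
      finally show ?thesis .
    qed
    then have "(\<Oplus>\<^bsub>V\<^esub>i\<in>I. x i \<odot>\<^bsub>V\<^esub> C i) = (\<Oplus>\<^bsub>V\<^esub>i\<in>I. \<Oplus>\<^bsub>V\<^esub>v\<in>B. (t i v \<otimes> x i) \<odot>\<^bsub>V\<^esub> v)"
      using t xi BV by (intro M.finsum_cong') (auto intro!: M.finsum_closed)
    also have "\<dots> = (\<Oplus>\<^bsub>V\<^esub>v\<in>B. \<Oplus>\<^bsub>V\<^esub>i\<in>I. (t i v \<otimes> x i) \<odot>\<^bsub>V\<^esub> v)"
      using t xi BV by (intro M.finsum_swap[OF assms(1) B(1)]) auto
    also have "\<dots> = lincomb (\<lambda>v. \<Oplus>i\<in>I. t i v \<otimes> x i) B"
      unfolding lincomb_def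
    proof (rule M.finsum_cong')
      fix v assume v: "v \<in> B"
      show "(\<Oplus>\<^bsub>V\<^esub>i\<in>I. (t i v \<otimes> x i) \<odot>\<^bsub>V\<^esub> v) = (\<Oplus>i\<in>I. t i v \<otimes> x i) \<odot>\<^bsub>V\<^esub> v"
        using finsum_additive[OF R.abelian_group_axioms M.abelian_group_axioms,
            of "\<lambda>a. a \<odot>\<^bsub>V\<^esub> v" "\<lambda>i. t i v \<otimes> x i" I] t[OF _ v] xi v BV
        by (auto simp: smult_l_distr)
    qed (use t xi BV in \<open>auto intro!: R.finsum_closed\<close>)
    finally show ?thesis .
  qed
  have coeff: "(\<lambda>v. \<Oplus>i\<in>I. t i v \<otimes> x i) \<in> B \<rightarrow> carrier K" if "x \<in> I \<rightarrow> carrier K" for x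
    using t that by (auto intro!: R.finsum_closed)
  have zero: "(\<Oplus>i\<in>I. t i ?w \<otimes> x i) = \<zero>"
    if "x \<in> I \<rightarrow> carrier K" "(\<Oplus>\<^bsub>V\<^esub>i\<in>I. x i \<odot>\<^bsub>V\<^esub> C i) = \<zero>\<^bsub>V\<^esub>" for x
    using lin_dep_crit[OF B(1) subset_refl coeff[OF that(1)], of ?w] expand[OF that(1)] that(2) B(2)
    by metis
  \<comment> \<open>For \<open>x0\<close> the combination is \<open>?w\<close> itself. With a zero
    coordinate along \<open>?w\<close> it would lie in the span of the remaining members of
    \<open>B\<close>, against independence.\<close>
  have "(\<Oplus>i\<in>I. t i ?w \<otimes> x0 i) \<noteq> \<zero>"
  proof
    assume z: "(\<Oplus>i\<in>I. t i ?w \<otimes> x0 i) = \<zero>"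
    let ?c = "\<lambda>v. \<Oplus>i\<in>I. t i v \<otimes> x0 i"
    have "lincomb ?c B = ?c ?w \<odot>\<^bsub>V\<^esub> ?w \<oplus>\<^bsub>V\<^esub> lincomb ?c (B - {?w})"
      using B(2) by (intro lincomb_del2[OF B(1) BV coeff[OF assms(3)]]) blast
    moreover have "lincomb ?c (B - {?w}) \<in> carrier V"
      using BV coeff[OF assms(3)] by (intro lincomb_closed) auto
    ultimately have "?w = lincomb ?c (B - {?w})" using expand[OF assms(3)] z w by simp
    moreover have "?c \<in> (B - {?w}) \<rightarrow> carrier K" using coeff[OF assms(3)] by auto
    ultimately have "?w \<in> span (B - {?w})" using B(1) unfolding span_def by blast
    moreover have "lin_indpt (B - {?w})" using B(2) subset_li_is_li[of B "B - {?w}"] by auto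
    ultimately have "lin_dep (B - {?w} \<union> {?w})"
      using lin_dep_iff_in_span[of "B - {?w}" ?w] BV w by blast
    then show False using B(2) by (simp add: insert_absorb)
  qed
  moreover have "(\<lambda>i. t i ?w) \<in> I \<rightarrow> carrier K" using t B(2) by blast
  ultimately show ?thesis using zero by (intro bexI[of _ "\<lambda>i. t i ?w"]) auto
qed

lemma ordered_basis_expand:
  assumes b: "ordered_basis K V n b" and w: "w \<in> carrier V"
  shows "\<exists>a. (\<forall>j<n. a j \<in> carrier K) \<and> w = (\<Oplus>\<^bsub>V\<^esub>j\<in>{..<n}. a j \<odot>\<^bsub>V\<^esub> b j)"
proof -
  have inj: "inj_on b {..<n}" and gen: "span (b ` {..<n}) = carrier V" and sub: "b ` {..<n} \<subseteq> carrier V"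
    using b by (auto simp: ordered_basis_def basis_def)
  obtain a where a: "a \<in> b ` {..<n} \<rightarrow> carrier K" "lincomb a (b ` {..<n}) = w"
    using finite_in_span[OF _ sub, of w] w gen by auto
  have "w = (\<Oplus>\<^bsub>V\<^esub>v\<in>b ` {..<n}. a v \<odot>\<^bsub>V\<^esub> v)" using a(2) by (simp add: lincomb_def)
  also have "\<dots> = (\<Oplus>\<^bsub>V\<^esub>j\<in>{..<n}. a (b j) \<odot>\<^bsub>V\<^esub> b j)"
    by (rule M.finsum_reindex[OF _ inj]) (use a(1) sub in auto)
  finally show ?thesis using a(1) by (intro exI[of _ "\<lambda>j. a (b j)"]) auto
qed

lemma ordered_basis_mem:
  assumes "ordered_basis K V n b" "j < n"
  shows "b j \<in> carrier V"
  using assms by (auto simp: ordered_basis_def basis_def)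

lemma exists_ordered_basis:
  assumes fin_dim
  shows "\<exists>b. ordered_basis K V dim b"
proof -
  obtain \<beta> where \<beta>: "finite \<beta>" "basis \<beta>" using finite_basis_exists[OF assms] by blast
  have "dim = card \<beta>" by (rule dim_basis[OF \<beta>])
  then obtain b where "bij_betw b {..<dim} \<beta>"
    using ex_bij_betw_nat_finite[OF \<beta>(1)] by (metis atLeast0LessThan)
  then show ?thesis
    using \<beta>(2) by (intro exI[of _ b]) (auto simp: ordered_basis_def bij_betw_def)
qed

text \<open>Independence is assumed for the indexed family, which is stronger than for its image: it
  also excludes repetitions. This provides a point of the Grassmannian, together with a basis that
  represents it.\<close>

lemma span_ordered_basis:
  fixes l :: nat
  assumes v: "\<And>i. i < l \<Longrightarrow> v i \<in> carrier V"
    and indep: "\<And>c. \<lbrakk>\<And>i. i < l \<Longrightarrow> c i \<in> carrier K; (\<Oplus>\<^bsub>V\<^esub>i\<in>{..<l}. c i \<odot>\<^bsub>V\<^esub> v i) = \<zero>\<^bsub>V\<^esub>\<rbrakk>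
      \<Longrightarrow> \<forall>i<l. c i = \<zero>"
  defines "W \<equiv> span (v ` {..<l})"
  shows "subspace K W V" "ordered_basis K (sub_module V W) l v" "vectorspace.dim K (sub_module V W) = l"
proof -
  have sub: "v ` {..<l} \<subseteq> carrier V" using v by auto
  show sW: "subspace K W V" unfolding W_def by (rule span_is_subspace[OF sub])
  then interpret W: vectorspace K "sub_module V W"
    unfolding sub_module_def by (rule subspace_is_vs)
  have inj: "inj_on v {..<l}"
  proof (rule inj_onI, rule ccontr)
    fix i j assume ij: "i \<in> {..<l}" "j \<in> {..<l}" "v i = v j" "i \<noteq> j"
    \<comment> \<open>A repeated vector would give the nontrivial relation with coefficients
      \<open>\<one>\<close> at \<open>i\<close> and \<open>\<ominus> \<one>\<close> at
      \<open>j\<close>.\<close>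
    define c where "c p = (if p = i then \<one> else if p = j then \<ominus> \<one> else \<zero>)" for p
    have cK: "c p \<in> carrier K" for p by (simp add: c_def)
    have "(\<Oplus>\<^bsub>V\<^esub>p\<in>{..<l}. c p \<odot>\<^bsub>V\<^esub> v p) = (\<Oplus>\<^bsub>V\<^esub>p\<in>{i, j}. c p \<odot>\<^bsub>V\<^esub> v p)"
    proof (rule M.add.finprod_mono_neutral_cong_right)
      show "c p \<odot>\<^bsub>V\<^esub> v p = \<zero>\<^bsub>V\<^esub>" if "p \<in> {..<l} - {i, j}" for p
        using that v by (simp add: c_def)
      show "(\<lambda>p. c p \<odot>\<^bsub>V\<^esub> v p) \<in> {..<l} \<rightarrow> carrier V" using cK v by auto
    qed (use ij in auto)
    also have "\<dots> = c i \<odot>\<^bsub>V\<^esub> v i \<oplus>\<^bsub>V\<^esub> c j \<odot>\<^bsub>V\<^esub> v j"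
      using ij v cK by (simp add: Pi_def)
    also have "\<dots> = \<zero>\<^bsub>V\<^esub>"
      using ij v[of i] by (simp add: c_def smult_minus_1 M.r_neg)
    finally have "\<forall>i<l. c i = \<zero>" by (intro indep cK)
    then have "c i = \<zero>" using ij(1) by simp
    then show False by (simp add: c_def)
  qed
  have "lin_indpt (v ` {..<l})"
  proof (rule finite_lin_indpt2[OF _ sub])
    fix a assume a: "a \<in> v ` {..<l} \<rightarrow> carrier K" "lincomb a (v ` {..<l}) = \<zero>\<^bsub>V\<^esub>"
    have "(\<Oplus>\<^bsub>V\<^esub>i\<in>{..<l}. a (v i) \<odot>\<^bsub>V\<^esub> v i) = (\<Oplus>\<^bsub>V\<^esub>w\<in>v ` {..<l}. a w \<odot>\<^bsub>V\<^esub> w)"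
      by (rule M.finsum_reindex[OF _ inj, symmetric]) (use a(1) sub in auto)
    then have "\<forall>i<l. a (v i) = \<zero>" using a by (intro indep) (auto simp: lincomb_def)
    then show "\<forall>w\<in>v ` {..<l}. a w = \<zero>" by auto
  qed simp
  moreover have vW: "v ` {..<l} \<subseteq> W" unfolding W_def by (rule in_own_span[OF sub])
  moreover have "submodule K W V" using sW by simp
  ultimately have "W.basis (v ` {..<l})"
    using span_li_not_depend[of "v ` {..<l}" W] unfolding W.basis_def
    by (simp add: sub_module_def W_def)
  then show "ordered_basis K (sub_module V W) l v" using inj by (simp add: ordered_basis_def)
  show "W.dim = l" using W.dim_basis[OF _ \<open>W.basis (v ` {..<l})\<close>] inj by (simp add: card_image)
qed

end

text \<open>Homogeneous polynomials are inductively generated functions, so the form is assembled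
  from terms that are a constant of degree 0 times a coordinate of degree 1. The induction begins
  with one such term, and the value is identified only at points with coordinates in
  \<open>carrier k\<close>.\<close>

lemma linear_form_homogeneous:
  assumes k: "cring k" and I: "finite I" "I \<noteq> {}" "I \<subseteq> J" and c: "c \<in> I \<rightarrow> carrier k"
  shows "\<exists>f. homogeneous_poly k J 1 f \<and> (\<forall>x\<in>I \<rightarrow> carrier k. f x = (\<Oplus>\<^bsub>k\<^esub>i\<in>I. c i \<otimes>\<^bsub>k\<^esub> x i))"
  using I c
proof (induction I rule: finite_ne_induct)
  case (singleton i)
  interpret cring k by (rule k)
  have "homogeneous_poly k J (0 + 1) (\<lambda>x. c i \<otimes>\<^bsub>k\<^esub> x i)"
    using singleton by (intro homogeneous_poly.mult homogeneous_poly.const homogeneous_poly.coord) auto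
  then show ?case using singleton by (intro exI[of _ "\<lambda>x. c i \<otimes>\<^bsub>k\<^esub> x i"]) (auto simp: Pi_def)
next
  case (insert i I)
  interpret cring k by (rule k)
  obtain f where f: "homogeneous_poly k J 1 f" "\<And>x. x \<in> I \<rightarrow> carrier k \<Longrightarrow> f x = (\<Oplus>\<^bsub>k\<^esub>i\<in>I. c i \<otimes>\<^bsub>k\<^esub> x i)"
    using insert.IH insert.prems by auto
  have "homogeneous_poly k J (0 + 1) (\<lambda>x. c i \<otimes>\<^bsub>k\<^esub> x i)"
    using insert.prems by (intro homogeneous_poly.mult homogeneous_poly.const homogeneous_poly.coord) auto
  then have "homogeneous_poly k J 1 (\<lambda>x. c i \<otimes>\<^bsub>k\<^esub> x i \<oplus>\<^bsub>k\<^esub> f x)"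
    using f(1) by (intro homogeneous_poly.add) simp_all
  moreover have "c i \<otimes>\<^bsub>k\<^esub> x i \<oplus>\<^bsub>k\<^esub> f x = (\<Oplus>\<^bsub>k\<^esub>i\<in>insert i I. c i \<otimes>\<^bsub>k\<^esub> x i)"
    if x: "x \<in> insert i I \<rightarrow> carrier k" for x
  proof -
    have "(\<Oplus>\<^bsub>k\<^esub>i\<in>insert i I. c i \<otimes>\<^bsub>k\<^esub> x i) = c i \<otimes>\<^bsub>k\<^esub> x i \<oplus>\<^bsub>k\<^esub> (\<Oplus>\<^bsub>k\<^esub>i\<in>I. c i \<otimes>\<^bsub>k\<^esub> x i)"
      by (rule finsum_insert) (use insert.hyps insert.prems x in \<open>auto simp: Pi_def\<close>)
    then show ?thesis using f(2)[of x] x by simp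
  qed
  ultimately show ?case by blast
qed

section \<open>Determinants of global sections\<close>

text \<open>What is kept of a trivialization over \<open>U0\<close>: the first \<open>l\<close>
  coordinates, compatible over all smaller open sets, and \<open>l\<close> sections dual to them.
  The dual sections are what global generation is later applied to.\<close>

locale framed_sheaf = sheaf_over_field X k \<pi> \<pi>s E
  for X :: "('p, 'r) ringed_space" and k :: "'k ring" and \<pi> :: "'p \<Rightarrow> 'k set"
    and \<pi>s :: "'k set set \<Rightarrow> ('k set \<Rightarrow> ('k \<times> 'k) set) \<Rightarrow> 'r"
    and E :: "('p, 'r, 'm) mod_sheaf" +
  fixes U0 :: "'p set" and l :: nat and coord :: "'p set \<Rightarrow> 'm \<Rightarrow> nat \<Rightarrow> 'r" and e :: "nat \<Rightarrow> 'm"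
  assumes U0: "openin (base X) U0" "U0 \<noteq> {}"
    and coord_closed: "\<And>W s j. \<lbrakk>openin (base X) W; W \<subseteq> U0; s \<in> carrier (\<E> W); j < l\<rbrakk>
      \<Longrightarrow> coord W s j \<in> carrier (\<O> W)"
    and coord_add: "\<And>W s t j. \<lbrakk>openin (base X) W; W \<subseteq> U0; s \<in> carrier (\<E> W); t \<in> carrier (\<E> W); j < l\<rbrakk>
      \<Longrightarrow> coord W (s \<oplus>\<^bsub>\<E> W\<^esub> t) j = coord W s j \<oplus>\<^bsub>\<O> W\<^esub> coord W t j"
    and coord_smult: "\<And>W c s j. \<lbrakk>openin (base X) W; W \<subseteq> U0; c \<in> carrier (\<O> W); s \<in> carrier (\<E> W); j < l\<rbrakk>
      \<Longrightarrow> coord W (c \<odot>\<^bsub>\<E> W\<^esub> s) j = c \<otimes>\<^bsub>\<O> W\<^esub> coord W s j"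
    and coord_res: "\<And>V W s j. \<lbrakk>openin (base X) V; V \<subseteq> U0; openin (base X) W; W \<subseteq> V; s \<in> carrier (\<E> V); j < l\<rbrakk>
      \<Longrightarrow> coord W (mres E V W s) j = res X V W (coord V s j)"
    and frame_closed: "\<And>i. i < l \<Longrightarrow> e i \<in> carrier (\<E> U0)"
    and coord_frame: "\<And>i j. i < l \<Longrightarrow> j < l \<Longrightarrow>
      coord U0 (e i) j = (if i = j then \<one>\<^bsub>\<O> U0\<^esub> else \<zero>\<^bsub>\<O> U0\<^esub>)"
begin

abbreviation section_det :: "(nat \<Rightarrow> 'm) \<Rightarrow> 'r" where
  "section_det v \<equiv> det_ring (\<O> U0) l (\<lambda>i j. coord U0 (\<rho> U0 (v i)) j)"

lemma coord_lincomb: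
  assumes W: "openin (base X) W" "W \<subseteq> U0" and j: "j < l"
    and c: "c \<in> A \<rightarrow> carrier (\<O> W)" and s: "s \<in> A \<rightarrow> carrier (\<E> W)"
  shows "coord W (\<Oplus>\<^bsub>\<E> W\<^esub>i\<in>A. c i \<odot>\<^bsub>\<E> W\<^esub> s i) j = (\<Oplus>\<^bsub>\<O> W\<^esub>i\<in>A. c i \<otimes>\<^bsub>\<O> W\<^esub> coord W (s i) j)"
proof -
  interpret EW: Module.module "\<O> W" "\<E> W" by (rule E_module[OF W(1)])
  have "coord W (\<Oplus>\<^bsub>\<E> W\<^esub>i\<in>A. c i \<odot>\<^bsub>\<E> W\<^esub> s i) j = (\<Oplus>\<^bsub>\<O> W\<^esub>i\<in>A. coord W (c i \<odot>\<^bsub>\<E> W\<^esub> s i) j)"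
    using coord_closed[OF W _ j] coord_add[OF W _ _ j] c s
    by (intro finsum_additive[where h = "\<lambda>s. coord W s j", OF EW.abelian_group_axioms EW.R.abelian_group_axioms]) auto
  also have "\<dots> = (\<Oplus>\<^bsub>\<O> W\<^esub>i\<in>A. c i \<otimes>\<^bsub>\<O> W\<^esub> coord W (s i) j)"
  proof (rule EW.R.finsum_cong')
    show "(\<lambda>i. c i \<otimes>\<^bsub>\<O> W\<^esub> coord W (s i) j) \<in> A \<rightarrow> carrier (\<O> W)"
      using coord_closed[OF W _ j] c s by (intro Pi_I EW.R.m_closed) auto
    fix i assume "i \<in> A"
    then show "coord W (c i \<odot>\<^bsub>\<E> W\<^esub> s i) j = c i \<otimes>\<^bsub>\<O> W\<^esub> coord W (s i) j"
      using c s by (intro coord_smult[OF W _ _ j]) auto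
  qed simp
  finally show ?thesis .
qed

lemma coord_global_closed:
  assumes "s \<in> \<Gamma>" "openin (base X) W" "W \<subseteq> U0" "j < l"
  shows "coord W (\<rho> W s) j \<in> carrier (\<O> W)"
  using coord_closed[OF assms(2,3) mres_closed[OF open_points assms(2) open_sub_points[OF assms(2)] assms(1)] assms(4)] .

text \<open>Links the determinant over \<open>U0\<close> with determinants over smaller open sets,
  where linear relations and expansions by generators are available.\<close>

lemma res_section_det:
  assumes v: "\<And>i. i < l \<Longrightarrow> v i \<in> \<Gamma>" and W: "openin (base X) W" "W \<subseteq> U0"
  shows "res X U0 W (section_det v) = det_ring (\<O> W) l (\<lambda>i j. coord W (\<rho> W (v i)) j)"
proof -
  interpret OW: cring_det "\<O> W" by (simp add: cring_det_def cring_O[OF W(1)])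
  have "res X U0 W (section_det v)
      = det_ring (\<O> W) l (\<lambda>i j. res X U0 W (coord U0 (\<rho> U0 (v i)) j))"
    using coord_global_closed[OF v U0(1)]
    by (intro ring_hom_det[OF res_hom[OF U0(1) W] cring_O[OF U0(1)] cring_O[OF W(1)]]) auto
  also have "\<dots> = det_ring (\<O> W) l (\<lambda>i j. coord W (\<rho> W (v i)) j)"
  proof (rule OW.det_cong)
    fix i j assume ij: "i < l" "j < l"
    note s = mres_closed[OF open_points U0(1) open_sub_points[OF U0(1)] v[OF ij(1)]]
    show "res X U0 W (coord U0 (\<rho> U0 (v i)) j) = coord W (\<rho> W (v i)) j"
      using coord_res[OF U0(1) subset_refl W s ij(2)]
        mres_mres[OF open_points U0(1) W open_sub_points[OF U0(1)] v[OF ij(1)]] by simp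
    show "coord W (\<rho> W (v i)) j \<in> carrier (\<O> W)"
      by (rule coord_global_closed[OF v[OF ij(1)] W ij(2)])
  qed
  finally show ?thesis .
qed

lemma section_det_closed:
  assumes "\<And>i. i < l \<Longrightarrow> v i \<in> \<Gamma>"
  shows "section_det v \<in> carrier (\<O> U0)"
proof -
  interpret cring_det "\<O> U0" by (simp add: cring_det_def cring_O[OF U0(1)])
  show ?thesis by (rule det_closed) (rule coord_global_closed[OF assms U0(1) subset_refl])
qed

text \<open>The empty family covers the empty set, so separatedness compares the sections on no
  member at all. Linear independence over the empty set is settled by this case.\<close>

lemma zero_on_empty:
  assumes "f \<in> carrier (\<O> {})"
  shows "f = \<zero>\<^bsub>\<O> {}\<^esub>"
proof (rule sheaf_separated[OF ringed_sheaf[OF ringed], of "{}"])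
  interpret cring "\<O> {}" by (rule cring_O) simp
  show "\<zero>\<^bsub>\<O> {}\<^esub> \<in> carrier (\<O> {})" by simp
qed (use assms in auto)

lemma sections_independent:
  assumes v: "\<And>i. i < l \<Longrightarrow> v i \<in> \<Gamma>" and det: "section_det v \<noteq> \<zero>\<^bsub>\<O> U0\<^esub>"
    and U: "openin (base X) U" and f: "\<And>i. i < l \<Longrightarrow> f i \<in> carrier (\<O> U)"
    and sum: "(\<Oplus>\<^bsub>\<E> U\<^esub>i\<in>{..<l}. f i \<odot>\<^bsub>\<E> U\<^esub> \<rho> U (v i)) = \<zero>\<^bsub>\<E> U\<^esub>"
    and i: "i < l"
  shows "f i = \<zero>\<^bsub>\<O> U\<^esub>"
proof (cases "U = {}")
  case True
  then show ?thesis using zero_on_empty f[OF i] by simp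
next
  case False
  \<comment> \<open>Coordinates exist only inside \<open>U0\<close>, so the relation is restricted
    to the intersection, which irreducibility keeps nonempty. Injectivity of restriction returns the
    conclusion to \<open>U\<close>.\<close>
  define W where "W = U \<inter> U0"
  have W: "openin (base X) W" "W \<subseteq> U0" "W \<subseteq> U" "W \<noteq> {}"
    unfolding W_def using U U0 opens_meet[OF U U0(1) False U0(2)] by auto
  interpret OW: cring_det "\<O> W" by (simp add: cring_det_def cring_O[OF W(1)])
  interpret EU: Module.module "\<O> U" "\<E> U" by (rule E_module[OF U])
  interpret EW: Module.module "\<O> W" "\<E> W" by (rule E_module[OF W(1)])
  let ?v = "\<lambda>i. \<rho> W (v i)" and ?g = "\<lambda>i. res X U W (f i)"
  note rh = res_hom[OF U W(1,3)]
  have g: "?g i \<in> carrier (\<O> W)" if "i < l" for i using ring_hom_closed[OF rh f[OF that]] .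
  have vU: "\<rho> U (v i) \<in> carrier (\<E> U)" if "i < l" for i
    using mres_closed[OF open_points U open_sub_points[OF U] v[OF that]] .
  have vW: "?v i \<in> carrier (\<E> W)" if "i < l" for i
    using mres_closed[OF open_points W(1) open_sub_points[OF W(1)] v[OF that]] .
  have "(\<Oplus>\<^bsub>\<E> W\<^esub>i\<in>{..<l}. ?g i \<odot>\<^bsub>\<E> W\<^esub> ?v i)
      = (\<Oplus>\<^bsub>\<E> W\<^esub>i\<in>{..<l}. mres E U W (f i \<odot>\<^bsub>\<E> U\<^esub> \<rho> U (v i)))"
  proof (rule EW.finsum_cong')
    show "(\<lambda>i. mres E U W (f i \<odot>\<^bsub>\<E> U\<^esub> \<rho> U (v i))) \<in> {..<l} \<rightarrow> carrier (\<E> W)"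
      using f vU by (auto intro!: mres_closed[OF U W(1,3)])
    fix i assume "i \<in> {..<l}"
    then have "i < l" by simp
    then show "?g i \<odot>\<^bsub>\<E> W\<^esub> ?v i = mres E U W (f i \<odot>\<^bsub>\<E> U\<^esub> \<rho> U (v i))"
      using mres_smult[OF U W(1,3) f vU] mres_mres[OF open_points U W(1,3) open_sub_points[OF U] v] by simp
  qed simp
  also have "\<dots> = mres E U W (\<Oplus>\<^bsub>\<E> U\<^esub>i\<in>{..<l}. f i \<odot>\<^bsub>\<E> U\<^esub> \<rho> U (v i))"
    using f vU by (intro mres_finsum[OF U W(1,3), symmetric]) auto
  \<comment> \<open>Restriction preserves zero, obtained as the case of an empty sum; the same
    device gives the coordinates of the zero section below.\<close>
  also have "\<dots> = \<zero>\<^bsub>\<E> W\<^esub>"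
    using mres_finsum[OF U W(1,3), of undefined "{}"] unfolding sum by simp
  finally have zero: "(\<Oplus>\<^bsub>\<E> W\<^esub>i\<in>{..<l}. ?g i \<odot>\<^bsub>\<E> W\<^esub> ?v i) = \<zero>\<^bsub>\<E> W\<^esub>" .
  have coords: "(\<Oplus>\<^bsub>\<O> W\<^esub>i\<in>{..<l}. ?g i \<otimes>\<^bsub>\<O> W\<^esub> coord W (?v i) j) = \<zero>\<^bsub>\<O> W\<^esub>" if "j < l" for j
  proof -
    have "(\<Oplus>\<^bsub>\<O> W\<^esub>i\<in>{..<l}. ?g i \<otimes>\<^bsub>\<O> W\<^esub> coord W (?v i) j) = coord W \<zero>\<^bsub>\<E> W\<^esub> j"
      using coord_lincomb[OF W(1,2) that, of ?g "{..<l}" ?v] g vW zero by simp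
    also have "\<dots> = \<zero>\<^bsub>\<O> W\<^esub>"
      using coord_lincomb[OF W(1,2) that, of undefined "{}" undefined] by simp
    finally show ?thesis .
  qed
  have "?g i \<otimes>\<^bsub>\<O> W\<^esub> det_ring (\<O> W) l (\<lambda>i j. coord W (?v i) j) = \<zero>\<^bsub>\<O> W\<^esub>"
    by (rule OW.row_combination_zero[where f = ?g])
      (use coord_global_closed[OF v W(1,2)] g coords i in auto)
  moreover have "det_ring (\<O> W) l (\<lambda>i j. coord W (?v i) j) \<noteq> \<zero>\<^bsub>\<O> W\<^esub>"
  proof -
    have "section_det v \<in> carrier (\<O> U0)" using v by (rule section_det_closed)
    then have "res X U0 W (section_det v) \<noteq> \<zero>\<^bsub>\<O> W\<^esub>" using res_eq_zero[OF U0(1) W(1,2,4)] det by blast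
    moreover have "res X U0 W (section_det v) = det_ring (\<O> W) l (\<lambda>i j. coord W (?v i) j)"
      using v W(1,2) by (rule res_section_det)
    ultimately show ?thesis by simp
  qed
  moreover have "det_ring (\<O> W) l (\<lambda>i j. coord W (?v i) j) \<in> carrier (\<O> W)"
    by (rule OW.det_closed) (rule coord_global_closed[OF v W(1,2)])
  ultimately have "?g i = \<zero>\<^bsub>\<O> W\<^esub>"
    using no_zero_divisors[OF W(1) g[OF i]] by blast
  then show ?thesis by (rule res_eq_zero[OF U W(1,3,4) f[OF i]])
qed

lemma exists_section_det_nonzero:
  assumes gg: "globally_generated X E"
  shows "\<exists>v. (\<forall>i<l. v i \<in> \<Gamma>) \<and> section_det v \<noteq> \<zero>\<^bsub>\<O> U0\<^esub>"
proof -
  obtain x where x: "x \<in> U0" using U0(2) by blast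
  let ?Q = "\<lambda>i W S c. openin (base X) W \<and> x \<in> W \<and> W \<subseteq> U0 \<and> finite S \<and> S \<subseteq> \<Gamma> \<and>
      c \<in> S \<rightarrow> carrier (\<O> W) \<and>
      mres E U0 W (e i) = (\<Oplus>\<^bsub>\<E> W\<^esub> s\<in>S. c s \<odot>\<^bsub>\<E> W\<^esub> \<rho> W s)"
  have "\<forall>i\<in>{..<l}. \<exists>W S c. ?Q i W S c"
  proof
    fix i assume "i \<in> {..<l}"
    then have "e i \<in> carrier (\<E> U0)" using frame_closed by simp
    then show "\<exists>W S c. ?Q i W S c"
      using gg[unfolded globally_generated_def, rule_format, where x = x and U = U0 and e = "e i"] U0(1) x by simp
  qed
  then obtain W where "\<forall>i\<in>{..<l}. \<exists>S c. ?Q i (W i) S c" by (rule bchoice[THEN exE])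
  then obtain S where "\<forall>i\<in>{..<l}. \<exists>c. ?Q i (W i) (S i) c" by (rule bchoice[THEN exE])
  then obtain c where *: "\<forall>i\<in>{..<l}. ?Q i (W i) (S i) (c i)" by (rule bchoice[THEN exE])
  have W: "openin (base X) (W i)" "x \<in> W i" "W i \<subseteq> U0" and S: "finite (S i)" "S i \<subseteq> \<Gamma>"
    and c: "c i \<in> S i \<rightarrow> carrier (\<O> (W i))"
    and ei: "mres E U0 (W i) (e i) = (\<Oplus>\<^bsub>\<E> (W i)\<^esub> s\<in>S i. c i s \<odot>\<^bsub>\<E> (W i)\<^esub> \<rho> (W i) s)"
    if "i < l" for i
    using bspec[OF *, of i] that by simp_all
  \<comment> \<open>A common neighbourhood for all \<open>l\<close> expansions. The intersection
    with \<open>points X\<close> keeps the inner set open also for \<open>l = 0\<close>, when there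
    is no \<open>W i\<close>.\<close>
  define Y where "Y = U0 \<inter> ((\<Inter>i\<in>{..<l}. W i) \<inter> points X)"
  have Y: "openin (base X) Y" "x \<in> Y" "Y \<subseteq> U0"
  proof -
    have "openin (base X) ((\<Inter>i\<in>{..<l}. W i) \<inter> points X)" using W(1) by (intro openin_INT) auto
    then show "openin (base X) Y" unfolding Y_def by (rule openin_Int[OF U0(1)])
    show "x \<in> Y" unfolding Y_def using x W(2) open_sub_points[OF U0(1)] by auto
    show "Y \<subseteq> U0" unfolding Y_def by blast
  qed
  have YW: "Y \<subseteq> W i" if "i < l" for i unfolding Y_def using that by blast
  define SS where "SS = (\<Union>i\<in>{..<l}. S i)"
  have SS: "finite SS" "SS \<subseteq> \<Gamma>" unfolding SS_def using S by auto
  interpret OY: cring_det "\<O> Y" by (simp add: cring_det_def cring_O[OF Y(1)])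
  interpret EY: Module.module "\<O> Y" "\<E> Y" by (rule E_module[OF Y(1)])
  \<comment> \<open>Padding by zero puts the \<open>l\<close> expansions over the common index set
    \<open>SS\<close>, so that their coefficients form one matrix.\<close>
  define C where "C i s = (if s \<in> S i then res X (W i) Y (c i s) else \<zero>\<^bsub>\<O> Y\<^esub>)" for i s
  have C: "C i s \<in> carrier (\<O> Y)" if "i < l" for i s
    using ring_hom_closed[OF res_hom[OF W(1)[OF that] Y(1) YW[OF that]]] c[OF that] by (auto simp: C_def)
  let ?g = "\<lambda>s. \<rho> Y s"
  have gY: "?g s \<in> carrier (\<E> Y)" if "s \<in> SS" for s
    using mres_closed[OF open_points Y(1) open_sub_points[OF Y(1)]] that SS(2) by blast
  have eY: "mres E U0 Y (e i) = (\<Oplus>\<^bsub>\<E> Y\<^esub>s\<in>SS. C i s \<odot>\<^bsub>\<E> Y\<^esub> ?g s)" if i: "i < l" for i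
  proof -
    interpret EW: Module.module "\<O> (W i)" "\<E> (W i)" by (rule E_module[OF W(1)[OF i]])
    note Wi = W[OF i] and Si = S[OF i]
    have gW: "\<rho> (W i) s \<in> carrier (\<E> (W i))" if "s \<in> S i" for s
      using mres_closed[OF open_points Wi(1) open_sub_points[OF Wi(1)]] that Si(2) by blast
    have sub: "S i \<subseteq> SS" using i by (auto simp: SS_def)
    have "mres E U0 Y (e i) = mres E (W i) Y (mres E U0 (W i) (e i))"
      using mres_mres[OF U0(1) Wi(1) Y(1) YW[OF i] Wi(3) frame_closed[OF i]] by simp
    also have "\<dots> = (\<Oplus>\<^bsub>\<E> Y\<^esub>s\<in>S i. mres E (W i) Y (c i s \<odot>\<^bsub>\<E> (W i)\<^esub> \<rho> (W i) s))"
      unfolding ei[OF i] using c[OF i] gW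
      by (intro mres_finsum[OF Wi(1) Y(1) YW[OF i]]) auto
    also have "\<dots> = (\<Oplus>\<^bsub>\<E> Y\<^esub>s\<in>SS. C i s \<odot>\<^bsub>\<E> Y\<^esub> ?g s)"
    proof (rule EY.add.finprod_mono_neutral_cong_left[OF SS(1) sub])
      show "C i s \<odot>\<^bsub>\<E> Y\<^esub> ?g s = \<zero>\<^bsub>\<E> Y\<^esub>" if "s \<in> SS - S i" for s
        using that gY by (simp add: C_def EY.lmult_0)
      show "mres E (W i) Y (c i s \<odot>\<^bsub>\<E> (W i)\<^esub> \<rho> (W i) s) = C i s \<odot>\<^bsub>\<E> Y\<^esub> ?g s"
        if s: "s \<in> S i" for s
      proof -
        have "c i s \<in> carrier (\<O> (W i))" using c[OF i] s by blast
        moreover have "s \<in> \<Gamma>" using Si(2) s by blast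
        ultimately show ?thesis
          using mres_smult[OF Wi(1) Y(1) YW[OF i] _ gW[OF s]] s
            mres_mres[OF open_points Wi(1) Y(1) YW[OF i] open_sub_points[OF Wi(1)]] by (simp add: C_def)
      qed
      show "(\<lambda>s. C i s \<odot>\<^bsub>\<E> Y\<^esub> ?g s) \<in> SS \<rightarrow> carrier (\<E> Y)"
        using C[OF i] gY by auto
    qed
    finally show ?thesis .
  qed
  let ?B = "\<lambda>s j. coord Y (?g s) j"
  have B: "?B s j \<in> carrier (\<O> Y)" if "s \<in> SS" "j < l" for s j
    using coord_closed[OF Y(1,3) gY[OF that(1)] that(2)] .
  have delta: "(\<Oplus>\<^bsub>\<O> Y\<^esub>s\<in>SS. C i s \<otimes>\<^bsub>\<O> Y\<^esub> ?B s j) = (if i = j then \<one>\<^bsub>\<O> Y\<^esub> else \<zero>\<^bsub>\<O> Y\<^esub>)"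
    if "i < l" "j < l" for i j
  proof -
    note rh = res_hom[OF U0(1) Y(1,3)]
    have "(\<Oplus>\<^bsub>\<O> Y\<^esub>s\<in>SS. C i s \<otimes>\<^bsub>\<O> Y\<^esub> ?B s j) = coord Y (mres E U0 Y (e i)) j"
      unfolding eY[OF that(1)] using coord_lincomb[OF Y(1,3) that(2), of "C i" SS ?g] C[OF that(1)] gY by auto
    also have "\<dots> = res X U0 Y (coord U0 (e i) j)"
      by (rule coord_res[OF U0(1) subset_refl Y(1,3) frame_closed[OF that(1)] that(2)])
    finally show ?thesis
      using coord_frame[OF that] ring_hom_one[OF rh] ring_hom_zero'[OF rh cring_O[OF U0(1)] OY.is_cring] by simp
  qed
  have "det_ring (\<O> Y) l (\<lambda>i j. \<Oplus>\<^bsub>\<O> Y\<^esub>s\<in>SS. C i s \<otimes>\<^bsub>\<O> Y\<^esub> ?B s j)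
      = det_ring (\<O> Y) l (\<lambda>i j. if i = j then \<one>\<^bsub>\<O> Y\<^esub> else \<zero>\<^bsub>\<O> Y\<^esub>)"
    by (rule OY.det_cong) (use delta in auto)
  also have "\<dots> = \<one>\<^bsub>\<O> Y\<^esub>" by (rule OY.det_one)
  finally have one: "\<one>\<^bsub>\<O> Y\<^esub> = (\<Oplus>\<^bsub>\<O> Y\<^esub>\<psi>\<in>{..<l} \<rightarrow>\<^sub>E SS.
      (\<Otimes>\<^bsub>\<O> Y\<^esub>i\<in>{..<l}. C i (\<psi> i)) \<otimes>\<^bsub>\<O> Y\<^esub> det_ring (\<O> Y) l (\<lambda>i j. ?B (\<psi> i) j))"
    using OY.det_mult_rows[OF SS(1), of l C ?B] C B by simp
  \<comment> \<open>If all these minors vanished, so would every summand, and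
    \<open>\<one> = \<zero>\<close> would hold over the neighbourhood \<open>Y\<close> of
    \<open>x\<close>.\<close>
  have "\<exists>\<psi>\<in>{..<l} \<rightarrow>\<^sub>E SS. det_ring (\<O> Y) l (\<lambda>i j. ?B (\<psi> i) j) \<noteq> \<zero>\<^bsub>\<O> Y\<^esub>"
  proof (rule ccontr)
    assume neg: "\<not> ?thesis"
    have "(\<Otimes>\<^bsub>\<O> Y\<^esub>i\<in>{..<l}. C i (\<psi> i)) \<otimes>\<^bsub>\<O> Y\<^esub> det_ring (\<O> Y) l (\<lambda>i j. ?B (\<psi> i) j) = \<zero>\<^bsub>\<O> Y\<^esub>"
      if "\<psi> \<in> {..<l} \<rightarrow>\<^sub>E SS" for \<psi>
    proof -
      have "det_ring (\<O> Y) l (\<lambda>i j. ?B (\<psi> i) j) = \<zero>\<^bsub>\<O> Y\<^esub>" using neg that by blast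
      moreover have "(\<Otimes>\<^bsub>\<O> Y\<^esub>i\<in>{..<l}. C i (\<psi> i)) \<in> carrier (\<O> Y)" using C by (intro OY.finprod_closed) auto
      ultimately show ?thesis by simp
    qed
    then have "\<one>\<^bsub>\<O> Y\<^esub> = \<zero>\<^bsub>\<O> Y\<^esub>" unfolding one by (rule OY.add.finprod_one_eqI)
    then show False using one_not_zero[OF Y(1)] Y(2) by blast
  qed
  then obtain \<psi> where \<psi>: "\<psi> \<in> {..<l} \<rightarrow>\<^sub>E SS" "det_ring (\<O> Y) l (\<lambda>i j. ?B (\<psi> i) j) \<noteq> \<zero>\<^bsub>\<O> Y\<^esub>" by blast
  have v: "\<psi> i \<in> \<Gamma>" if "i < l" for i using \<psi>(1) SS(2) that by auto
  have "section_det \<psi> \<noteq> \<zero>\<^bsub>\<O> U0\<^esub>"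
  proof
    assume "section_det \<psi> = \<zero>\<^bsub>\<O> U0\<^esub>"
    moreover have "res X U0 Y (section_det \<psi>) = det_ring (\<O> Y) l (\<lambda>i j. ?B (\<psi> i) j)"
      using v Y(1,3) by (rule res_section_det)
    ultimately have "det_ring (\<O> Y) l (\<lambda>i j. ?B (\<psi> i) j) = \<zero>\<^bsub>\<O> Y\<^esub>"
      using        ring_hom_zero'[OF res_hom[OF U0(1) Y(1,3)] cring_O[OF U0(1)] OY.is_cring] by simp
    then show False using \<psi>(2) by simp
  qed
  then show ?thesis using v by blast
qed

text \<open>The coordinate matrix of the sections is the scalar matrix \<open>a\<close> times the
  coordinate matrix of the \<open>b j\<close>. Expanding along columns leaves minors of
  \<open>a\<close>, and their images in \<open>O(U0)\<close> come from \<open>k\<close> because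
  determinants commute with ring homomorphisms. Writing the sum in \<open>\<O>\<^sub>k U0\<close>
  presents it as a linear combination over \<open>k\<close>.\<close>

lemma section_det_plucker:
  fixes n :: nat
  assumes b: "\<And>j. j < n \<Longrightarrow> b j \<in> \<Gamma>"
    and a: "\<And>i j. i < l \<Longrightarrow> j < n \<Longrightarrow> a i j \<in> carrier k"
  shows "section_det (\<lambda>i. \<Oplus>\<^bsub>H\<^esub>j\<in>{..<n}. a i j \<odot>\<^bsub>H\<^esub> b j)
    = (\<Oplus>\<^bsub>\<O>\<^sub>k U0\<^esub>\<phi>\<in>{..<l} \<rightarrow>\<^sub>E {..<n}. plucker k l a \<phi> \<odot>\<^bsub>\<O>\<^sub>k U0\<^esub>
        (\<Otimes>\<^bsub>\<O> U0\<^esub>m\<in>{..<l}. coord U0 (\<rho> U0 (b (\<phi> m))) m))"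
proof -
  interpret O: cring_det "\<O> U0" by (simp add: cring_det_def cring_O[OF U0(1)])
  interpret k: cring_det k by (simp add: cring_det_def k.is_cring)
  interpret EX: Module.module "\<O> (points X)" "\<E> (points X)" by (rule E_module[OF open_points])
  interpret E0: Module.module "\<O> U0" "\<E> U0" by (rule E_module[OF U0(1)])
  note sub = open_sub_points[OF U0(1)]
  let ?r = "\<rho> U0"
  have r: "?r (b j) \<in> carrier (\<E> U0)" if "j < n" for j
    using mres_closed[OF open_points U0(1) sub b[OF that]] .
  let ?B = "\<lambda>j m. coord U0 (?r (b j)) m"
  have B: "?B j m \<in> carrier (\<O> U0)" if "j < n" "m < l" for j m
    using coord_closed[OF U0(1) subset_refl r[OF that(1)] that(2)] .
  have sa: "sc U0 (a i j) \<in> carrier (\<O> U0)" if "i < l" "j < n" for i j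
    using scalar_closed[OF U0(1) a[OF that]] .
  have row: "coord U0 (?r (\<Oplus>\<^bsub>H\<^esub>j\<in>{..<n}. a i j \<odot>\<^bsub>H\<^esub> b j)) m
      = (\<Oplus>\<^bsub>\<O> U0\<^esub>j\<in>{..<n}. sc U0 (a i j) \<otimes>\<^bsub>\<O> U0\<^esub> ?B j m)" if i: "i < l" and m: "m < l" for i m
  proof -
    have "?r (\<Oplus>\<^bsub>H\<^esub>j\<in>{..<n}. a i j \<odot>\<^bsub>H\<^esub> b j)
        = (\<Oplus>\<^bsub>\<E> U0\<^esub>j\<in>{..<n}. ?r (sc (points X) (a i j) \<odot>\<^bsub>\<E> (points X)\<^esub> b j))"
      unfolding H_finsum H_simps using a[OF i] b scalar_closed[OF open_points]
      by (intro mres_finsum[OF open_points U0(1) sub]) auto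
    also have "\<dots> = (\<Oplus>\<^bsub>\<E> U0\<^esub>j\<in>{..<n}. sc U0 (a i j) \<odot>\<^bsub>\<E> U0\<^esub> ?r (b j))"
    proof (rule E0.finsum_cong')
      show "(\<lambda>j. sc U0 (a i j) \<odot>\<^bsub>\<E> U0\<^esub> ?r (b j)) \<in> {..<n} \<rightarrow> carrier (\<E> U0)"
        using sa[OF i] r by auto
      fix j assume "j \<in> {..<n}"
      then have j: "j < n" by simp
      show "?r (sc (points X) (a i j) \<odot>\<^bsub>\<E> (points X)\<^esub> b j) = sc U0 (a i j) \<odot>\<^bsub>\<E> U0\<^esub> ?r (b j)"
        using mres_smult[OF open_points U0(1) sub scalar_closed[OF open_points a[OF i j]] b[OF j]]
          res_scalar[OF open_points U0(1) sub a[OF i j]] by simp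
    qed simp
    finally show ?thesis
      using coord_lincomb[OF U0(1) subset_refl m, of "\<lambda>j. sc U0 (a i j)" "{..<n}" "\<lambda>j. ?r (b j)"] sa[OF i] r by auto
  qed
  have "section_det (\<lambda>i. \<Oplus>\<^bsub>H\<^esub>j\<in>{..<n}. a i j \<odot>\<^bsub>H\<^esub> b j)
      = det_ring (\<O> U0) l (\<lambda>i m. \<Oplus>\<^bsub>\<O> U0\<^esub>j\<in>{..<n}. sc U0 (a i j) \<otimes>\<^bsub>\<O> U0\<^esub> ?B j m)"
    by (rule O.det_cong) (use row sa B in \<open>auto intro!: O.finsum_closed\<close>)
  also have "\<dots> = (\<Oplus>\<^bsub>\<O> U0\<^esub>\<phi>\<in>{..<l} \<rightarrow>\<^sub>E {..<n}. (\<Otimes>\<^bsub>\<O> U0\<^esub>m\<in>{..<l}. ?B (\<phi> m) m)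
      \<otimes>\<^bsub>\<O> U0\<^esub> det_ring (\<O> U0) l (\<lambda>i j. sc U0 (a i (\<phi> j))))"
    by (rule O.det_mult_cols) (use sa B in auto)
  also have "\<dots> = (\<Oplus>\<^bsub>\<O> U0\<^esub>\<phi>\<in>{..<l} \<rightarrow>\<^sub>E {..<n}. sc U0 (plucker k l a \<phi>) \<otimes>\<^bsub>\<O> U0\<^esub>
      (\<Otimes>\<^bsub>\<O> U0\<^esub>m\<in>{..<l}. ?B (\<phi> m) m))"
  proof (rule O.finsum_cong')
    have P: "sc U0 (plucker k l a \<phi>) \<in> carrier (\<O> U0)" "(\<Otimes>\<^bsub>\<O> U0\<^esub>m\<in>{..<l}. ?B (\<phi> m) m) \<in> carrier (\<O> U0)"
      "det_ring (\<O> U0) l (\<lambda>i j. sc U0 (a i (\<phi> j))) = sc U0 (plucker k l a \<phi>)"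
      if \<phi>: "\<phi> \<in> {..<l} \<rightarrow>\<^sub>E {..<n}" for \<phi>
    proof -
      have lt: "\<phi> j < n" if "j < l" for j using \<phi> that by auto
      have pl: "plucker k l a \<phi> \<in> carrier k"
        unfolding plucker_def using a lt by (intro k.det_closed) auto
      show "sc U0 (plucker k l a \<phi>) \<in> carrier (\<O> U0)" by (rule scalar_closed[OF U0(1) pl])
      show "(\<Otimes>\<^bsub>\<O> U0\<^esub>m\<in>{..<l}. ?B (\<phi> m) m) \<in> carrier (\<O> U0)" using B lt by (intro O.finprod_closed) auto
      show "det_ring (\<O> U0) l (\<lambda>i j. sc U0 (a i (\<phi> j))) = sc U0 (plucker k l a \<phi>)"
        unfolding plucker_def using a lt
        by (intro ring_hom_det[OF scalar_hom[OF U0(1)] k.is_cring O.is_cring, symmetric]) auto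
    qed
    show "(\<lambda>\<phi>. sc U0 (plucker k l a \<phi>) \<otimes>\<^bsub>\<O> U0\<^esub> (\<Otimes>\<^bsub>\<O> U0\<^esub>m\<in>{..<l}. ?B (\<phi> m) m))
        \<in> ({..<l} \<rightarrow>\<^sub>E {..<n}) \<rightarrow> carrier (\<O> U0)"
      using P by (intro Pi_I O.m_closed)
    fix \<phi> assume "\<phi> \<in> {..<l} \<rightarrow>\<^sub>E {..<n}"
    from P[OF this] show "(\<Otimes>\<^bsub>\<O> U0\<^esub>m\<in>{..<l}. ?B (\<phi> m) m) \<otimes>\<^bsub>\<O> U0\<^esub> det_ring (\<O> U0) l (\<lambda>i j. sc U0 (a i (\<phi> j)))
        = sc U0 (plucker k l a \<phi>) \<otimes>\<^bsub>\<O> U0\<^esub> (\<Otimes>\<^bsub>\<O> U0\<^esub>m\<in>{..<l}. ?B (\<phi> m) m)"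
      by (simp add: O.m_comm)
  qed simp
  finally show ?thesis unfolding Ok_finsum Ok_simps .
qed

end

section \<open>From a trivialization of the bundle to a frame\<close>

lemma carrier_func_space: "ring R \<Longrightarrow> carrier (ring.func_space R S) = S \<rightarrow>\<^sub>E carrier R"
  and add_func_space: "ring R \<Longrightarrow> f \<oplus>\<^bsub>ring.func_space R S\<^esub> g = (\<lambda>i\<in>S. f i \<oplus>\<^bsub>R\<^esub> g i)"
  and smult_func_space: "ring R \<Longrightarrow> c \<odot>\<^bsub>ring.func_space R S\<^esub> f = (\<lambda>i\<in>S. c \<otimes>\<^bsub>R\<^esub> f i)"
  by (simp_all add: ring.func_space_def)

context sheaf_over_field
begin

text \<open>\<open>rk\<close> is a choice among the ranks of local trivializations. A point of
  \<open>X\<close> supplies a candidate, so the chosen number is attained on some nonempty open set,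
  which becomes \<open>U0\<close>.\<close>

lemma free_on_rk:
  assumes "vector_bundle X E"
  shows "\<exists>U. U \<noteq> {} \<and> free_on X E U (rk X E)"
proof -
  obtain x where "x \<in> points X" using points_nonempty by blast
  then obtain U n where "x \<in> U" "free_on X E U n"
    using assms unfolding vector_bundle_def by blast
  then have "\<exists>n U. U \<noteq> {} \<and> free_on X E U n" by blast
  then show ?thesis unfolding rk_def by (rule someI_ex)
qed

text \<open>The coordinates are the inverse of the trivialization and the \<open>e i\<close> are the
  images of the unit vectors. Each law for coordinates holds after applying the isomorphism, whose
  injectivity then yields the law itself; \<open>l \<le> n\<close> makes the first \<open>l\<close>
  coordinates available.\<close>

lemma free_on_framed:
  assumes free: "free_on X E U0 n" and U0_ne: "U0 \<noteq> {}" and l: "l \<le> n"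
  shows "\<exists>coord e. framed_sheaf X k \<pi> \<pi>s E U0 l coord e"
proof -
  let ?F = "free_sheaf X n" and ?I = "{..<n}"
  have U0: "openin (base X) U0" using free by (simp add: free_on_def)
  obtain \<phi> where \<phi>: "sheaf_iso (open_sub X U0) ?F E \<phi>" using free by (auto simp: free_on_def)
  have sub: "openin (base (open_sub X U0)) W" if "openin (base X) W" "W \<subseteq> U0" for W
    using that openin_open_subtopology[OF U0] by (simp add: open_sub_def)
  have str: "str (open_sub X U0) = str X" by (simp add: open_sub_def)
  note iso = \<phi>[unfolded sheaf_iso_def sheaf_hom_def str]
  have bij: "bij_betw (\<phi> W) (carrier (msec ?F W)) (carrier (\<E> W))" if "openin (base X) W" "W \<subseteq> U0" for W
    using iso[THEN conjunct2] sub[OF that] by blast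
  have hom: "\<phi> W \<in> module_hom (\<O> W) (msec ?F W) (\<E> W)" if "openin (base X) W" "W \<subseteq> U0" for W
    using iso[THEN conjunct1, THEN conjunct1] sub[OF that] by blast
  have nat: "mres E V W (\<phi> V s) = \<phi> W (mres ?F V W s)"
    if "openin (base X) V" "V \<subseteq> U0" "openin (base X) W" "W \<subseteq> V" "s \<in> carrier (msec ?F V)" for V W s
    using iso[THEN conjunct1, THEN conjunct2] sub[of V] sub[of W] that by (meson order_trans)
  have ring_O: "ring (\<O> W)" if "openin (base X) W" for W
    using cring_O[OF that] by (rule cring.axioms(1))
  have car: "carrier (msec ?F W) = ?I \<rightarrow>\<^sub>E carrier (\<O> W)" if "openin (base X) W" for W
    using carrier_func_space[OF ring_O[OF that]] by (simp add: free_sheaf_def)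
  have add: "s \<oplus>\<^bsub>msec ?F W\<^esub> t = (\<lambda>i\<in>?I. s i \<oplus>\<^bsub>\<O> W\<^esub> t i)" if "openin (base X) W" for W s t
    using add_func_space[OF ring_O[OF that]] by (simp add: free_sheaf_def)
  have smult: "c \<odot>\<^bsub>msec ?F W\<^esub> s = (\<lambda>i\<in>?I. c \<otimes>\<^bsub>\<O> W\<^esub> s i)" if "openin (base X) W" for W c s
    using smult_func_space[OF ring_O[OF that]] by (simp add: free_sheaf_def)
  have res: "mres ?F V W s = (\<lambda>i\<in>?I. res X V W (s i))" for V W s
    by (simp add: free_sheaf_def)
  define coord where "coord W = inv_into (carrier (msec ?F W)) (\<phi> W)" for W
  have coord: "coord W s \<in> carrier (msec ?F W)" "\<phi> W (coord W s) = s"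
    if "openin (base X) W" "W \<subseteq> U0" "s \<in> carrier (\<E> W)" for W s
  proof -
    have "s \<in> \<phi> W ` carrier (msec ?F W)" using bij_betw_imp_surj_on[OF bij[OF that(1,2)]] that(3) by simp
    then show "coord W s \<in> carrier (msec ?F W)" "\<phi> W (coord W s) = s"
      unfolding coord_def by (rule inv_into_into, rule f_inv_into_f)
  qed
  have coord_eq: "coord W (\<phi> W t) = t" if "openin (base X) W" "W \<subseteq> U0" "t \<in> carrier (msec ?F W)" for W t
    unfolding coord_def using bij_betw_imp_inj_on[OF bij[OF that(1,2)]] that(3) by (rule inv_into_f_f)
  have coord_mem: "coord W s i \<in> carrier (\<O> W)"
    if "openin (base X) W" "W \<subseteq> U0" "s \<in> carrier (\<E> W)" "i < n" for W s i
    using coord(1)[OF that(1-3)] that(4) unfolding car[OF that(1)] by auto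
  define e where "e i = \<phi> U0 (\<lambda>j\<in>?I. if i = j then \<one>\<^bsub>\<O> U0\<^esub> else \<zero>\<^bsub>\<O> U0\<^esub>)" for i
  have e_mem: "(\<lambda>j\<in>?I. if i = j then \<one>\<^bsub>\<O> U0\<^esub> else \<zero>\<^bsub>\<O> U0\<^esub>) \<in> carrier (msec ?F U0)" for i
  proof -
    interpret cring "\<O> U0" by (rule cring_O[OF U0])
    show ?thesis unfolding car[OF U0] by auto
  qed
  have "framed_sheaf X k \<pi> \<pi>s E U0 l coord e"
  proof
    show "openin (base X) U0" "U0 \<noteq> {}" by (fact U0, fact U0_ne)
  next
    fix W s j assume "openin (base X) W" "W \<subseteq> U0" "s \<in> carrier (\<E> W)" "j < l"
    then show "coord W s j \<in> carrier (\<O> W)" using coord_mem l by simp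
  next
    fix W s t j
    assume W: "openin (base X) W" "W \<subseteq> U0" and s: "s \<in> carrier (\<E> W)" and t: "t \<in> carrier (\<E> W)" and j: "j < l"
    interpret cring "\<O> W" by (rule cring_O[OF W(1)])
    note cs = coord[OF W s] and ct = coord[OF W t]
    have mem: "coord W s \<oplus>\<^bsub>msec ?F W\<^esub> coord W t \<in> carrier (msec ?F W)"
      unfolding add[OF W(1)] car[OF W(1)] using coord_mem[OF W s] coord_mem[OF W t] by auto
    have "\<phi> W (coord W s \<oplus>\<^bsub>msec ?F W\<^esub> coord W t) = s \<oplus>\<^bsub>\<E> W\<^esub> t"
      using module_hom_add[OF hom[OF W] cs(1) ct(1)] cs(2) ct(2) by simp
    then have "coord W (s \<oplus>\<^bsub>\<E> W\<^esub> t) = coord W s \<oplus>\<^bsub>msec ?F W\<^esub> coord W t"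
      using coord_eq[OF W mem] by simp
    then show "coord W (s \<oplus>\<^bsub>\<E> W\<^esub> t) j = coord W s j \<oplus>\<^bsub>\<O> W\<^esub> coord W t j"
      using j l by (simp add: add[OF W(1)])
  next
    fix W c s j
    assume W: "openin (base X) W" "W \<subseteq> U0" and c: "c \<in> carrier (\<O> W)" and s: "s \<in> carrier (\<E> W)" and j: "j < l"
    interpret cring "\<O> W" by (rule cring_O[OF W(1)])
    note cs = coord[OF W s]
    have mem: "c \<odot>\<^bsub>msec ?F W\<^esub> coord W s \<in> carrier (msec ?F W)"
      unfolding smult[OF W(1)] car[OF W(1)] using coord_mem[OF W s] c by auto
    have "\<phi> W (c \<odot>\<^bsub>msec ?F W\<^esub> coord W s) = c \<odot>\<^bsub>\<E> W\<^esub> s"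
      using module_hom_smult[OF hom[OF W] c cs(1)] cs(2) by simp
    then have "coord W (c \<odot>\<^bsub>\<E> W\<^esub> s) = c \<odot>\<^bsub>msec ?F W\<^esub> coord W s"
      using coord_eq[OF W mem] by simp
    then show "coord W (c \<odot>\<^bsub>\<E> W\<^esub> s) j = c \<otimes>\<^bsub>\<O> W\<^esub> coord W s j"
      using j l by (simp add: smult[OF W(1)])
  next
    fix V W s j
    assume V: "openin (base X) V" "V \<subseteq> U0" and W: "openin (base X) W" "W \<subseteq> V" and s: "s \<in> carrier (\<E> V)" and j: "j < l"
    have WU: "W \<subseteq> U0" using V W by blast
    note cs = coord[OF V s]
    have mem: "mres ?F V W (coord V s) \<in> carrier (msec ?F W)"
      unfolding res car[OF W(1)] using coord_mem[OF V s] ring_hom_closed[OF res_hom[OF V(1) W]] by auto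
    have "\<phi> W (mres ?F V W (coord V s)) = mres E V W s"
      using nat[OF V W cs(1)] cs(2) by simp
    then have "coord W (mres E V W s) = mres ?F V W (coord V s)"
      using coord_eq[OF W(1) WU mem] by simp
    then show "coord W (mres E V W s) j = res X V W (coord V s j)"
      using j l by (simp add: res)
  next
    fix i assume "i < l"
    show "e i \<in> carrier (\<E> U0)"
      unfolding e_def using module_hom_closed[OF hom[OF U0 subset_refl]] e_mem by blast
    fix j assume "j < l"
    then show "coord U0 (e i) j = (if i = j then \<one>\<^bsub>\<O> U0\<^esub> else \<zero>\<^bsub>\<O> U0\<^esub>)"
      unfolding e_def coord_eq[OF U0 subset_refl e_mem] using l by simp
  qed
  then show ?thesis by blast
qed

lemma mres_self: "s \<in> \<Gamma> \<Longrightarrow> \<rho> (points X) s = s"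
  using E_sheaf[unfolded sheaf_on_def, THEN conjunct2, THEN conjunct1] open_points by blast

end

section \<open>The linear form in Plucker coordinates and the evaluation map\<close>

context framed_sheaf
begin

lemma H_vectorspace: "record_vectorspace k H"
  by (simp add: record_vectorspace_def vectorspace_def H_module field_k)

text \<open>A functional on \<open>O(U0)\<close> that does not vanish at one particular determinant turns the
  determinant into a \<open>k\<close>-linear form in the Plucker coordinates.\<close>

lemma generic_plucker_form:
  fixes n :: nat
  assumes b: "\<And>j. j < n \<Longrightarrow> b j \<in> \<Gamma>"
    and a0: "\<And>i j. i < l \<Longrightarrow> j < n \<Longrightarrow> a0 i j \<in> carrier k"
    and nz: "section_det (\<lambda>i. \<Oplus>\<^bsub>H\<^esub>j\<in>{..<n}. a0 i j \<odot>\<^bsub>H\<^esub> b j) \<noteq> \<zero>\<^bsub>\<O> U0\<^esub>"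
  shows "\<exists>f. homogeneous_poly k ({..<l} \<rightarrow>\<^sub>E {..<n}) 1 f \<and> f (plucker k l a0) \<noteq> \<zero>\<^bsub>k\<^esub> \<and>
    (\<forall>a. (\<forall>i<l. \<forall>j<n. a i j \<in> carrier k) \<longrightarrow> f (plucker k l a) \<noteq> \<zero>\<^bsub>k\<^esub> \<longrightarrow>
      section_det (\<lambda>i. \<Oplus>\<^bsub>H\<^esub>j\<in>{..<n}. a i j \<odot>\<^bsub>H\<^esub> b j) \<noteq> \<zero>\<^bsub>\<O> U0\<^esub>)"
proof -
  let ?I = "{..<l} \<rightarrow>\<^sub>E {..<n}"
  interpret O: record_vectorspace k "\<O>\<^sub>k U0"
    by (simp add: record_vectorspace_def vectorspace_def Ok_module[OF U0(1)] field_k)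
  interpret OU: cring "\<O> U0" by (rule cring_O[OF U0(1)])
  interpret kd: cring_det k by (simp add: cring_det_def k.is_cring)
  let ?C = "\<lambda>\<phi>. \<Otimes>\<^bsub>\<O> U0\<^esub>m\<in>{..<l}. coord U0 (\<rho> U0 (b (\<phi> m))) m"
  have fin: "finite ?I" by (intro finite_PiE) auto
  have C: "?C \<in> ?I \<rightarrow> carrier (\<O>\<^sub>k U0)"
  proof
    fix \<phi> assume "\<phi> \<in> ?I"
    then have "\<phi> m < n" if "m < l" for m using that by auto
    then show "?C \<phi> \<in> carrier (\<O>\<^sub>k U0)"
      unfolding Ok_simps using coord_global_closed[OF b U0(1) subset_refl] by (intro OU.finprod_closed) auto
  qed
  have pl: "plucker k l a \<in> ?I \<rightarrow> carrier k" if "\<And>i j. i < l \<Longrightarrow> j < n \<Longrightarrow> a i j \<in> carrier k" for a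
  proof
    fix \<phi> assume \<phi>: "\<phi> \<in> ?I"
    then have "\<phi> m < n" if "m < l" for m using that by auto
    then show "plucker k l a \<phi> \<in> carrier k" unfolding plucker_def using that by (intro kd.det_closed) auto
  qed
  have sd: "section_det (\<lambda>i. \<Oplus>\<^bsub>H\<^esub>j\<in>{..<n}. a i j \<odot>\<^bsub>H\<^esub> b j)
      = (\<Oplus>\<^bsub>\<O>\<^sub>k U0\<^esub>\<phi>\<in>?I. plucker k l a \<phi> \<odot>\<^bsub>\<O>\<^sub>k U0\<^esub> ?C \<phi>)"
    if "\<And>i j. i < l \<Longrightarrow> j < n \<Longrightarrow> a i j \<in> carrier k" for a
    using b that by (rule section_det_plucker)
  have nz': "(\<Oplus>\<^bsub>\<O>\<^sub>k U0\<^esub>\<phi>\<in>?I. plucker k l a0 \<phi> \<odot>\<^bsub>\<O>\<^sub>k U0\<^esub> ?C \<phi>) \<noteq> \<zero>\<^bsub>\<O>\<^sub>k U0\<^esub>"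
    using nz sd[of a0] a0 by (simp add: Ok_simps(2))
  \<comment> \<open>An empty sum would be zero, so the nonzero determinant excludes the case
    \<open>n = 0 < l\<close>, in which there are no Plucker coordinates to form a
    polynomial.\<close>
  then have ne: "?I \<noteq> {}" by (metis O.M.finsum_empty)
  obtain c where c: "c \<in> ?I \<rightarrow> carrier k"
    "(\<Oplus>\<^bsub>k\<^esub>\<phi>\<in>?I. c \<phi> \<otimes>\<^bsub>k\<^esub> plucker k l a0 \<phi>) \<noteq> \<zero>\<^bsub>k\<^esub>"
    "\<forall>x\<in>?I \<rightarrow> carrier k. (\<Oplus>\<^bsub>\<O>\<^sub>k U0\<^esub>\<phi>\<in>?I. x \<phi> \<odot>\<^bsub>\<O>\<^sub>k U0\<^esub> ?C \<phi>) = \<zero>\<^bsub>\<O>\<^sub>k U0\<^esub>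
      \<longrightarrow> (\<Oplus>\<^bsub>k\<^esub>\<phi>\<in>?I. c \<phi> \<otimes>\<^bsub>k\<^esub> x \<phi>) = \<zero>\<^bsub>k\<^esub>"
    using O.separating_functional[OF fin C pl[OF a0] nz'] by blast
  obtain f where f: "homogeneous_poly k ?I 1 f"
    "\<forall>x\<in>?I \<rightarrow> carrier k. f x = (\<Oplus>\<^bsub>k\<^esub>\<phi>\<in>?I. c \<phi> \<otimes>\<^bsub>k\<^esub> x \<phi>)"
    using linear_form_homogeneous[OF k.is_cring fin ne subset_refl c(1)] by blast
  show ?thesis
  proof (intro exI[of _ f] conjI allI impI)
    show "homogeneous_poly k ?I 1 f" by (rule f(1))
    show "f (plucker k l a0) \<noteq> \<zero>\<^bsub>k\<^esub>" using f(2) pl[OF a0] c(2) by simp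
    fix a assume a: "\<forall>i<l. \<forall>j<n. a i j \<in> carrier k" and fa: "f (plucker k l a) \<noteq> \<zero>\<^bsub>k\<^esub>"
    have pa: "plucker k l a \<in> ?I \<rightarrow> carrier k" using a by (intro pl) blast
    have "(\<Oplus>\<^bsub>\<O>\<^sub>k U0\<^esub>\<phi>\<in>?I. plucker k l a \<phi> \<odot>\<^bsub>\<O>\<^sub>k U0\<^esub> ?C \<phi>) \<noteq> \<zero>\<^bsub>\<O>\<^sub>k U0\<^esub>"
    proof
      assume "(\<Oplus>\<^bsub>\<O>\<^sub>k U0\<^esub>\<phi>\<in>?I. plucker k l a \<phi> \<odot>\<^bsub>\<O>\<^sub>k U0\<^esub> ?C \<phi>) = \<zero>\<^bsub>\<O>\<^sub>k U0\<^esub>"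
      then have "(\<Oplus>\<^bsub>k\<^esub>\<phi>\<in>?I. c \<phi> \<otimes>\<^bsub>k\<^esub> plucker k l a \<phi>) = \<zero>\<^bsub>k\<^esub>" by (rule bspec[OF c(3) pa, THEN mp])
      then show False using fa bspec[OF f(2) pa] by simp
    qed
    moreover have "section_det (\<lambda>i. \<Oplus>\<^bsub>H\<^esub>j\<in>{..<n}. a i j \<odot>\<^bsub>H\<^esub> b j)
      = (\<Oplus>\<^bsub>\<O>\<^sub>k U0\<^esub>\<phi>\<in>?I. plucker k l a \<phi> \<odot>\<^bsub>\<O>\<^sub>k U0\<^esub> ?C \<phi>)" using a by (intro sd) blast
    ultimately show "section_det (\<lambda>i. \<Oplus>\<^bsub>H\<^esub>j\<in>{..<n}. a i j \<odot>\<^bsub>H\<^esub> b j) \<noteq> \<zero>\<^bsub>\<O> U0\<^esub>"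
      by (simp add: Ok_simps(2))
  qed
qed

text \<open>The basis property over \<open>k\<close> supplies the spanning premise of
  \<open>evaluation_mono\<close>, and one nonzero determinant over \<open>U0\<close> supplies
  independence over the sections of every open set.\<close>

lemma evaluation_mono_of_basis:
  assumes V: "subspace k V H" and basis: "ordered_basis k (sub_module H V) l v"
    and det: "section_det v \<noteq> \<zero>\<^bsub>\<O> U0\<^esub>"
  shows "sheaf_mono X (tensor_sheaf k X \<pi>s (sub_module H V)) E (evaluation X E)"
proof -
  interpret H: record_vectorspace k H by (rule H_vectorspace)
  have sm: "submodule k V H" using V by (simp add: subspace_def)
  interpret sections_subspace X k \<pi> \<pi>s E V
    by (rule sections_subspace.intro[OF sheaf_over_field_axioms sections_subspace_axioms.intro[OF sm]])
  interpret W: record_vectorspace k V\<^sub>k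
    by (simp add: record_vectorspace_def vectorspace_def Vk_module field_k)
  have vV: "v i \<in> V" if "i < l" for i using W.ordered_basis_mem[OF basis that] by (simp add: Vk_simps)
  show ?thesis
  proof (rule evaluation_mono[of l v])
    show "v i \<in> V" if "i < l" for i using that by (rule vV)
    show "\<exists>c. (\<forall>i<l. c i \<in> carrier k) \<and> w = (\<Oplus>\<^bsub>V\<^sub>k\<^esub>i\<in>{..<l}. c i \<odot>\<^bsub>V\<^sub>k\<^esub> v i)" if "w \<in> V" for w
      using W.ordered_basis_expand[OF basis] that by (simp add: Vk_simps(1))
    show "\<forall>i<l. f i = \<zero>\<^bsub>\<O> U\<^esub>"
      if U: "openin (base X) U" and f: "\<And>i. i < l \<Longrightarrow> f i \<in> carrier (\<O> U)"
        and sum: "(\<Oplus>\<^bsub>\<E> U\<^esub>i\<in>{..<l}. f i \<odot>\<^bsub>\<E> U\<^esub> \<rho> U (v i)) = \<zero>\<^bsub>\<E> U\<^esub>" for U f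
    proof (intro allI impI)
      fix i assume "i < l"
      with V_section[OF vV] det U f sum show "f i = \<zero>\<^bsub>\<O> U\<^esub>" by (rule sections_independent)
    qed
  qed
qed

end

theorem mainTheorem1:
  fixes k :: "'k ring"
    and X :: "('p, 'r) ringed_space"
    and \<pi> :: "'p \<Rightarrow> 'k set"
    and \<pi>s :: "'k set set \<Rightarrow> ('k set \<Rightarrow> ('k \<times> 'k) set) \<Rightarrow> 'r"
    and E :: "('p, 'r, 'm) mod_sheaf"
    and l :: nat
  defines "H \<equiv> global_sections k X \<pi>s E"
  assumes "field k"
    and "variety k X \<pi> \<pi>s"
    and "vector_bundle X E"
    and "globally_generated X E"
    and "vectorspace.fin_dim k H"
    and "l \<le> rk X E"
  shows "\<exists>\<U>. zariski_open k l H \<U> \<and> \<U> \<noteq> {} \<and>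
    (\<forall>V\<in>\<U>. sheaf_mono X (tensor_sheaf k X \<pi>s (sub_module H V)) E (evaluation X E))"
proof -
  interpret integral_space X
    using assms(3) by (intro integral_scheme) (simp_all add: variety_def)
  interpret S: sheaf_over_field X k \<pi> \<pi>s E
    by (rule sheaf_over_field.intro[OF integral_space_axioms sheaf_over_field_axioms.intro])
      (use assms(2-4) in \<open>simp_all add: variety_def vector_bundle_def\<close>)
  obtain U0 coord e where "framed_sheaf X k \<pi> \<pi>s E U0 l coord e"
    using S.free_on_rk[OF assms(4)] S.free_on_framed assms(7) by blast
  then interpret framed_sheaf X k \<pi> \<pi>s E U0 l coord e .
  have H_eq: "global_sections k X \<pi>s E = H" by (simp add: H_def)
  interpret H: record_vectorspace k H unfolding H_def by (rule H_vectorspace)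
  define n where "n = H.dim"
  obtain b where b: "ordered_basis k H n b" using H.exists_ordered_basis assms(6) n_def by blast
  have bE: "b j \<in> carrier (msec E (points X))" if "j < n" for j
    using H.ordered_basis_mem[OF b that] S.H_simps(1) by (simp add: H_def)
  obtain v where v: "\<And>i. i < l \<Longrightarrow> v i \<in> carrier (msec E (points X))" and det: "section_det v \<noteq> \<zero>\<^bsub>str X U0\<^esub>"
    using exists_section_det_nonzero[OF assms(5)] by blast
  have vH: "v i \<in> carrier H" if "i < l" for i using v[OF that] S.H_simps(1) by (simp add: H_def)
  have "\<forall>i\<in>{..<l}. \<exists>a. (\<forall>j<n. a j \<in> carrier k) \<and> v i = (\<Oplus>\<^bsub>H\<^esub>j\<in>{..<n}. a j \<odot>\<^bsub>H\<^esub> b j)"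
    using H.ordered_basis_expand[OF b vH] by blast
  then obtain a0 where "\<forall>i\<in>{..<l}. (\<forall>j<n. a0 i j \<in> carrier k) \<and> v i = (\<Oplus>\<^bsub>H\<^esub>j\<in>{..<n}. a0 i j \<odot>\<^bsub>H\<^esub> b j)"
    by (rule bchoice[THEN exE])
  then have a0: "\<And>i j. i < l \<Longrightarrow> j < n \<Longrightarrow> a0 i j \<in> carrier k"
    and va0: "\<And>i. i < l \<Longrightarrow> v i = (\<Oplus>\<^bsub>H\<^esub>j\<in>{..<n}. a0 i j \<odot>\<^bsub>H\<^esub> b j)" by auto
  \<comment> \<open>The expansions in the basis replace the \<open>v i\<close>, because the Plucker
    form is evaluated on such combinations. The two families agree for indices below
    \<open>l\<close>, which are the ones the determinant reads.\<close>
  let ?v0 = "\<lambda>i. \<Oplus>\<^bsub>H\<^esub>j\<in>{..<n}. a0 i j \<odot>\<^bsub>H\<^esub> b j"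
  have v0: "?v0 i \<in> carrier (msec E (points X))" if "i < l" for i using v va0 that by metis
  have v0H: "?v0 i \<in> carrier H" if "i < l" for i using vH va0 that by metis
  have det0: "section_det ?v0 \<noteq> \<zero>\<^bsub>str X U0\<^esub>"
  proof -
    interpret O: cring_det "str X U0" by (simp add: cring_det_def S.cring_O[OF U0(1)])
    have "section_det v = section_det ?v0"
      by (rule O.det_cong) (use va0 coord_global_closed[OF v0 U0(1) subset_refl] in auto)
    then show ?thesis using det by simp
  qed
  have "\<exists>f. homogeneous_poly k ({..<l} \<rightarrow>\<^sub>E {..<n}) 1 f \<and> f (plucker k l a0) \<noteq> \<zero>\<^bsub>k\<^esub> \<and>
    (\<forall>a. (\<forall>i<l. \<forall>j<n. a i j \<in> carrier k) \<longrightarrow> f (plucker k l a) \<noteq> \<zero>\<^bsub>k\<^esub> \<longrightarrow>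
      section_det (\<lambda>i. \<Oplus>\<^bsub>H\<^esub>j\<in>{..<n}. a i j \<odot>\<^bsub>H\<^esub> b j) \<noteq> \<zero>\<^bsub>str X U0\<^esub>)"
    using bE a0 det0 by (rule generic_plucker_form[unfolded H_eq])
  then obtain f where f: "homogeneous_poly k ({..<l} \<rightarrow>\<^sub>E {..<n}) 1 f" "f (plucker k l a0) \<noteq> \<zero>\<^bsub>k\<^esub>"
    "\<And>a. \<forall>i<l. \<forall>j<n. a i j \<in> carrier k \<Longrightarrow> f (plucker k l a) \<noteq> \<zero>\<^bsub>k\<^esub> \<Longrightarrow>
      section_det (\<lambda>i. \<Oplus>\<^bsub>H\<^esub>j\<in>{..<n}. a i j \<odot>\<^bsub>H\<^esub> b j) \<noteq> \<zero>\<^bsub>str X U0\<^esub>"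
    by (elim exE conjE) (rule that, iprover+)
  \<comment> \<open>The complement of one hyperplane section in the Plucker embedding, written with
    the singleton \<open>{f}\<close> so as to match \<open>zariski_open\<close> literally.\<close>
  define \<U> where "\<U> = {V \<in> Grass k l H. \<exists>a. represents k H n b l a V \<and> (\<exists>f\<in>{f}. f (plucker k l a) \<noteq> \<zero>\<^bsub>k\<^esub>)}"
  have "zariski_open k l H \<U>"
    unfolding zariski_open_def Let_def n_def[symmetric]
  proof (intro exI conjI)
    show "ordered_basis k H n b" by (rule b)
    show "{f} \<subseteq> {f. \<exists>d. homogeneous_poly k ({..<l} \<rightarrow>\<^sub>E {..<n}) d f}" using f(1) by blast
  qed (rule \<U>_def)
  moreover have "\<U> \<noteq> {}"
  proof -
    let ?V = "H.span (?v0 ` {..<l})"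
    \<comment> \<open>A relation over \<open>k\<close> is read as a relation over
      \<open>O(X)\<close> by passing to the images of the scalars. Independence over the whole space
      makes these images zero, and a scalar with zero image is zero.\<close>
    have indep: "\<forall>i<l. c i = \<zero>\<^bsub>k\<^esub>"
      if c: "\<And>i. i < l \<Longrightarrow> c i \<in> carrier k" and sum: "(\<Oplus>\<^bsub>H\<^esub>i\<in>{..<l}. c i \<odot>\<^bsub>H\<^esub> ?v0 i) = \<zero>\<^bsub>H\<^esub>" for c
    proof (intro allI impI)
      fix i assume i: "i < l"
      let ?c = "\<lambda>i. scalar k X \<pi>s (points X) (c i)"
      have cl: "?c i \<in> carrier (str X (points X))" if "i < l" for i
        using S.scalar_closed[OF S.open_points c[OF that]] .
      interpret EX: Module.module "str X (points X)" "msec E (points X)" by (rule S.E_module[OF S.open_points])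
      have "(\<Oplus>\<^bsub>msec E (points X)\<^esub>i\<in>{..<l}. ?c i \<odot>\<^bsub>msec E (points X)\<^esub> mres E (points X) (points X) (?v0 i))
          = (\<Oplus>\<^bsub>msec E (points X)\<^esub>i\<in>{..<l}. ?c i \<odot>\<^bsub>msec E (points X)\<^esub> ?v0 i)"
        by (rule EX.finsum_cong') (use cl v0 S.mres_self in auto)
      also have "\<dots> = (\<Oplus>\<^bsub>H\<^esub>i\<in>{..<l}. c i \<odot>\<^bsub>H\<^esub> ?v0 i)"
        unfolding H_def S.H_finsum S.H_simps ..
      also have "\<dots> = \<zero>\<^bsub>msec E (points X)\<^esub>" unfolding sum unfolding H_def S.H_simps ..
      finally have "?c i = \<zero>\<^bsub>str X (points X)\<^esub>"
        using i by (intro sections_independent[OF v0 det0 S.open_points cl])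
      then show "c i = \<zero>\<^bsub>k\<^esub>" by (rule S.scalar_eq_zero[OF S.open_points points_nonempty c[OF i]])
    qed
    have sp: "VectorSpace.subspace k ?V H" "ordered_basis k (sub_module H ?V) l ?v0"
      "vectorspace.dim k (sub_module H ?V) = l"
      by (rule H.span_ordered_basis, fact v0H, rule indep, assumption+)+
    have "?V \<in> Grass k l H" unfolding Grass_def using sp(1,3) by blast
    moreover have "represents k H n b l a0 ?V"
      unfolding represents_def using a0 sp(2) by blast
    ultimately have "?V \<in> \<U>" using f(2) unfolding \<U>_def by blast
    then show ?thesis by blast
  qed
  moreover have "sheaf_mono X (tensor_sheaf k X \<pi>s (sub_module H V)) E (evaluation X E)" if mem: "V \<in> \<U>" for V
  proof -
    obtain a where V: "V \<in> Grass k l H" and a: "represents k H n b l a V" "f (plucker k l a) \<noteq> \<zero>\<^bsub>k\<^esub>"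
      using mem unfolding \<U>_def by blast
    have "section_det (\<lambda>i. \<Oplus>\<^bsub>H\<^esub>j\<in>{..<n}. a i j \<odot>\<^bsub>H\<^esub> b j) \<noteq> \<zero>\<^bsub>str X U0\<^esub>"
      using f(3) a unfolding represents_def by blast
    then show ?thesis
      using evaluation_mono_of_basis[unfolded H_eq] V a(1) unfolding represents_def Grass_def by blast
  qed
  ultimately show ?thesis by blast
qed

end
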